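(* Let $M$ be a simple left $B$-module, and write $I=B(z^{-1}y)$. If $M\not\cong B/I$, then $M$ is a simple $\mathcal{V}_{p,q}$-module. If $M=B/I$, then $B\supset V+I\supset I$ gives a composition series for $M$ (that is, $M=B/I\supset (V+I)/I\supset 0$ is a composition series) when $M$ is regarded as a $\mathcal{V}_{p,q}$-module, where $V$ is the subalgebra of $B$ generated by the elements $L_n=z^{-1}x^{n+1}y$, $n\in\mathbb{Z}$, through which $\mathcal{V}_{p,q}$ acts.
   Context: $\Bbbk$ is an uncountable, algebraically closed field of characteristic zero and $p,q\in\Bbbk^\times$. Let $H=\Bbbk\langle x,y,z\mid zx-p^{-1}xz,\ zy-pyz,\ yx-qxy-z\rangle$. Let $Q$ be the quotient division ring of the following noetherian domain, in one of two cases. Independent case ($q^r\ne p^s$ for all $(r,s)\in\mathbb{Z}^2\setminus\{(0,0)\}$): the algebra $\mathcal{A}_{p,q}$ on generators $x,y,z^{\pm1},\omega^{\pm1}$ with relations $zx=p^{-1}xz$, $zy=pyz$, $\omega x=q^{-1}x\omega$, $\omega y=qy\omega$, $yx-qxy=z$, $yx-p^{-1}xy=\omega^{-1}$ (and $z\omega=\omega z$). Dependent case ($q^r=p^s$ for some positive integers $r,s$ with $\gcd(r,s)=1$, $pq\neq1$, and $H$ is not a polynomial identity ring): the algebra $A_p(r,s)=H/(\Omega-1)H$, where $\Omega=(yx-p^{-1}xy)^rz^s$ is central in $H$. Let $B'$ be the subring ($\Bbbk$-subalgebra) of $Q$ generated by $x$ and $z^{-1}y$; one has $(z^{-1}y)x=pq\,x(z^{-1}y)+1$.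 Let $B=B'[x^{-1}]\subset Q$ be its localization at the powers of $x$. With $[k]=\frac{q^k-p^{-k}}{q-p^{-1}}$ for $k\in\mathbb{Z}$, the two-parameter Virasoro algebra $\mathcal{V}_{p,q}$ is the $\Bbbk$-algebra on generators $\{L_n\}_{n\in\mathbb{Z}}$ with relations $p^{n-m}L_nL_m-q^{m-n}L_mL_n=[m-n]L_{m+n}$ for all $m,n\in\mathbb{Z}$. The elements $L_n=z^{-1}x^{n+1}y\in B$ satisfy these relations, and every left $B$-module is regarded as a $\mathcal{V}_{p,q}$-module by letting the generator $L_n$ act as $z^{-1}x^{n+1}y$. *)

theory Defs
  imports "HOL-Algebra.Algebra" "HOL-Algebra.Algebraic_Closure_Type"
    "HOL-Library.Poly_Mapping" "HOL-Library.Countable_Set"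
begin

section \<open>Algebras given by generators and relations\<close>

text \<open>
  The free algebra on a set \<open>'g\<close> of generators is the monoid algebra of the free monoid of
  words in \<open>'g\<close>.  Words are lists wrapped in a type of their own so that the (additively written)
  monoid structure required by \<^type>\<open>poly_mapping\<close> is not imposed on all lists; the ring
  structure of \<open>'g word \<Rightarrow>\<^sub>0 'k\<close> is then the library's convolution product.
\<close>

datatype 'g word = Word (letters: "'g list")

instantiation word :: (type) monoid_add
begin

definition zero_word :: "'a word" where
  "zero_word = Word []"

definition plus_word :: "'a word \<Rightarrow> 'a word \<Rightarrow> 'a word" where
  "plus_word u v = Word (letters u @ letters v)"

instance
  by standard (simp_all add: zero_word_def plus_word_def)

end

type_synonym ('g, 'k) free_algebra = "'g word \<Rightarrow>\<^sub>0 'k"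

definition gen :: "'g \<Rightarrow> ('g, 'k::ring_1) free_algebra" where
  "gen g = Poly_Mapping.single (Word [g]) 1"

definition scal :: "'k \<Rightarrow> ('g, 'k::ring_1) free_algebra" where
  "scal c = Poly_Mapping.single (Word []) c"

definition relation_ideal :: "('g, 'k::ring_1) free_algebra set \<Rightarrow> ('g, 'k) free_algebra set" where
  "relation_ideal S = genideal ring_of_type_algebra S"

definition presented_algebra ::
  "('g, 'k::ring_1) free_algebra set \<Rightarrow> ('g, 'k) free_algebra set ring" where
  "presented_algebra S = ring_of_type_algebra Quot relation_ideal S"

definition presented_class ::
  "('g, 'k::ring_1) free_algebra set \<Rightarrow> ('g, 'k) free_algebra \<Rightarrow> ('g, 'k) free_algebra set" where
  "presented_class S f = relation_ideal S +>\<^bsub>ring_of_type_algebra\<^esub> f"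

text \<open>
  Value of a noncommutative polynomial in a ring \<open>R\<close>, which is a \<open>'k\<close>-algebra through \<open>\<kappa>\<close>,
  when the generators are sent to the elements \<open>\<rho> g\<close>.
\<close>

definition free_eval ::
  "('a, 'b) ring_scheme \<Rightarrow> ('k \<Rightarrow> 'a) \<Rightarrow> ('g \<Rightarrow> 'a) \<Rightarrow> ('g, 'k::ring_1) free_algebra \<Rightarrow> 'a" where
  "free_eval R \<kappa> \<rho> f =
     (\<Oplus>\<^bsub>R\<^esub>w\<in>Poly_Mapping.keys f.
        \<kappa> (Poly_Mapping.lookup f w) \<otimes>\<^bsub>R\<^esub> foldr (\<lambda>g a. \<rho> g \<otimes>\<^bsub>R\<^esub> a) (letters w) \<one>\<^bsub>R\<^esub>)"

definition is_PI_algebra :: "('a, 'b) ring_scheme \<Rightarrow> ('k::field \<Rightarrow> 'a) \<Rightarrow> bool" where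
  "is_PI_algebra R \<kappa> \<longleftrightarrow>
     (\<exists>f :: (nat, 'k) free_algebra. f \<noteq> 0 \<and>
        (\<forall>\<rho>. (\<forall>i. \<rho> i \<in> carrier R) \<longrightarrow> free_eval R \<kappa> \<rho> f = \<zero>\<^bsub>R\<^esub>))"

section \<open>Quotient division rings\<close>

definition is_division_ring :: "('a, 'b) ring_scheme \<Rightarrow> bool" where
  "is_division_ring Q \<longleftrightarrow> ring Q \<and> Units Q = carrier Q - {\<zero>\<^bsub>Q\<^esub>}"

text \<open>
  \<open>Q\<close>, with the embedding \<open>\<iota>\<close>, is the (two-sided) quotient division ring of \<open>A\<close>: every element
  of \<open>Q\<close> is both a right fraction \<open>a s\<inverse>\<close> and a left fraction \<open>s\<inverse> a\<close>.
\<close>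

definition quotient_division_ring ::
  "('a, 'b) ring_scheme \<Rightarrow> ('q, 'c) ring_scheme \<Rightarrow> ('a \<Rightarrow> 'q) \<Rightarrow> bool" where
  "quotient_division_ring A Q \<iota> \<longleftrightarrow>
     ring A \<and> is_division_ring Q \<and> \<iota> \<in> ring_hom A Q \<and> inj_on \<iota> (carrier A) \<and>
     (\<forall>u\<in>carrier Q.
        (\<exists>a\<in>carrier A. \<exists>s\<in>carrier A - {\<zero>\<^bsub>A\<^esub>}. u = \<iota> a \<otimes>\<^bsub>Q\<^esub> inv\<^bsub>Q\<^esub> (\<iota> s)) \<and>
        (\<exists>a\<in>carrier A. \<exists>s\<in>carrier A - {\<zero>\<^bsub>A\<^esub>}. u = inv\<^bsub>Q\<^esub> (\<iota> s) \<otimes>\<^bsub>Q\<^esub> \<iota> a))"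

section \<open>The algebras \<open>H\<close>, \<open>\<A>\<^bsub>p,q\<^esub>\<close> and \<open>A\<^sub>p(r,s)\<close>\<close>

datatype H_gen = HX | HY | HZ

definition H_rels :: "'k::field \<Rightarrow> 'k \<Rightarrow> (H_gen, 'k) free_algebra set" where
  "H_rels p q =
     {gen HZ * gen HX - scal (inverse p) * gen HX * gen HZ,
      gen HZ * gen HY - scal p * gen HY * gen HZ,
      gen HY * gen HX - scal q * gen HX * gen HY - gen HZ}"

definition H_alg :: "'k::field \<Rightarrow> 'k \<Rightarrow> (H_gen, 'k) free_algebra set ring" where
  "H_alg p q = presented_algebra (H_rels p q)"

definition H_class ::
  "'k::field \<Rightarrow> 'k \<Rightarrow> (H_gen, 'k) free_algebra \<Rightarrow> (H_gen, 'k) free_algebra set" where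
  "H_class p q = presented_class (H_rels p q)"

datatype A_gen = AX | AY | AZ | AZinv | AW | AWinv

text \<open>\<open>AW\<close> stands for \<open>\<omega>\<close>.\<close>

definition A_rels :: "'k::field \<Rightarrow> 'k \<Rightarrow> (A_gen, 'k) free_algebra set" where
  "A_rels p q =
     {gen AZ * gen AZinv - 1, gen AZinv * gen AZ - 1,
      gen AW * gen AWinv - 1, gen AWinv * gen AW - 1,
      gen AZ * gen AX - scal (inverse p) * gen AX * gen AZ,
      gen AZ * gen AY - scal p * gen AY * gen AZ,
      gen AW * gen AX - scal (inverse q) * gen AX * gen AW,
      gen AW * gen AY - scal q * gen AY * gen AW,
      gen AY * gen AX - scal q * gen AX * gen AY - gen AZ,
      gen AY * gen AX - scal (inverse p) * gen AX * gen AY - gen AWinv,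
      gen AZ * gen AW - gen AW * gen AZ}"

definition A_alg :: "'k::field \<Rightarrow> 'k \<Rightarrow> (A_gen, 'k) free_algebra set ring" where
  "A_alg p q = presented_algebra (A_rels p q)"

definition A_class ::
  "'k::field \<Rightarrow> 'k \<Rightarrow> (A_gen, 'k) free_algebra \<Rightarrow> (A_gen, 'k) free_algebra set" where
  "A_class p q = presented_class (A_rels p q)"

definition Omega ::
  "'k::field \<Rightarrow> 'k \<Rightarrow> nat \<Rightarrow> nat \<Rightarrow> (H_gen, 'k) free_algebra set" where
  "Omega p q r s =
     H_class p q ((gen HY * gen HX - scal (inverse p) * gen HX * gen HY) ^ r * gen HZ ^ s)"

definition Omega_ideal ::
  "'k::field \<Rightarrow> 'k \<Rightarrow> nat \<Rightarrow> nat \<Rightarrow> (H_gen, 'k) free_algebra set set" where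
  "Omega_ideal p q r s =
     (Omega p q r s \<ominus>\<^bsub>H_alg p q\<^esub> \<one>\<^bsub>H_alg p q\<^esub>) <#\<^bsub>H_alg p q\<^esub> carrier (H_alg p q)"

definition Ars_alg ::
  "'k::field \<Rightarrow> 'k \<Rightarrow> nat \<Rightarrow> nat \<Rightarrow> (H_gen, 'k) free_algebra set set ring" where
  "Ars_alg p q r s = H_alg p q Quot Omega_ideal p q r s"

definition Ars_class ::
  "'k::field \<Rightarrow> 'k \<Rightarrow> nat \<Rightarrow> nat \<Rightarrow> (H_gen, 'k) free_algebra \<Rightarrow>
     (H_gen, 'k) free_algebra set set" where
  "Ars_class p q r s f = Omega_ideal p q r s +>\<^bsub>H_alg p q\<^esub> H_class p q f"

section \<open>The two cases for \<open>Q\<close>\<close>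

text \<open>
  In both cases \<open>\<kappa>\<close> is the structure map of the \<open>'k\<close>-algebra \<open>Q\<close>, and \<open>x\<close>, \<open>y\<close>, \<open>z\<close> are the
  generators viewed in \<open>Q\<close>.
\<close>

definition independent_case ::
  "'k::field \<Rightarrow> 'k \<Rightarrow> 'q ring \<Rightarrow> ('k \<Rightarrow> 'q) \<Rightarrow> 'q \<Rightarrow> 'q \<Rightarrow> 'q \<Rightarrow> bool" where
  "independent_case p q Q \<kappa> x y z \<longleftrightarrow>
     (\<forall>r s :: int. (r, s) \<noteq> (0, 0) \<longrightarrow> q powi r \<noteq> p powi s) \<and>
     (\<exists>\<iota>. quotient_division_ring (A_alg p q) Q \<iota> \<and>
        \<kappa> = (\<lambda>c. \<iota> (A_class p q (scal c))) \<and>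
        x = \<iota> (A_class p q (gen AX)) \<and>
        y = \<iota> (A_class p q (gen AY)) \<and>
        z = \<iota> (A_class p q (gen AZ)))"

definition dependent_case ::
  "'k::field \<Rightarrow> 'k \<Rightarrow> 'q ring \<Rightarrow> ('k \<Rightarrow> 'q) \<Rightarrow> 'q \<Rightarrow> 'q \<Rightarrow> 'q \<Rightarrow> bool" where
  "dependent_case p q Q \<kappa> x y z \<longleftrightarrow>
     (\<exists>r s :: nat. r > 0 \<and> s > 0 \<and> gcd r s = 1 \<and> q ^ r = p ^ s \<and>
        p * q \<noteq> 1 \<and>
        \<not> is_PI_algebra (H_alg p q) (\<lambda>c. H_class p q (scal c)) \<and>
        (\<exists>\<iota>. quotient_division_ring (Ars_alg p q r s) Q \<iota> \<and>
           \<kappa> = (\<lambda>c. \<iota> (Ars_class p q r s (scal c))) \<and>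
           x = \<iota> (Ars_class p q r s (gen HX)) \<and>
           y = \<iota> (Ars_class p q r s (gen HY)) \<and>
           z = \<iota> (Ars_class p q r s (gen HZ))))"

section \<open>The subalgebras \<open>B\<close> and \<open>V\<close> of \<open>Q\<close>\<close>

definition subalgebra_generated :: "('q, 'b) ring_scheme \<Rightarrow> ('k \<Rightarrow> 'q) \<Rightarrow> 'q set \<Rightarrow> 'q set" where
  "subalgebra_generated Q \<kappa> S = generate_ring Q (range \<kappa> \<union> S)"

definition B'_set :: "'q ring \<Rightarrow> ('k \<Rightarrow> 'q) \<Rightarrow> 'q \<Rightarrow> 'q \<Rightarrow> 'q \<Rightarrow> 'q set" where
  "B'_set Q \<kappa> x y z = subalgebra_generated Q \<kappa> {x, inv\<^bsub>Q\<^esub> z \<otimes>\<^bsub>Q\<^esub> y}"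

text \<open>\<open>B = B'[x\<inverse>]\<close>, formed inside \<open>Q\<close>.\<close>

definition B_alg :: "'q ring \<Rightarrow> ('k \<Rightarrow> 'q) \<Rightarrow> 'q \<Rightarrow> 'q \<Rightarrow> 'q \<Rightarrow> 'q ring" where
  "B_alg Q \<kappa> x y z = Q\<lparr>carrier := generate_ring Q (B'_set Q \<kappa> x y z \<union> {inv\<^bsub>Q\<^esub> x})\<rparr>"

definition L_elem :: "'q ring \<Rightarrow> 'q \<Rightarrow> 'q \<Rightarrow> 'q \<Rightarrow> int \<Rightarrow> 'q" where
  "L_elem Q x y z n = inv\<^bsub>Q\<^esub> z \<otimes>\<^bsub>Q\<^esub> x [^]\<^bsub>Q\<^esub> (n + 1) \<otimes>\<^bsub>Q\<^esub> y"

definition V_set :: "'q ring \<Rightarrow> ('k \<Rightarrow> 'q) \<Rightarrow> 'q \<Rightarrow> 'q \<Rightarrow> 'q \<Rightarrow> 'q set" where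
  "V_set Q \<kappa> x y z = subalgebra_generated (B_alg Q \<kappa> x y z) \<kappa> (range (L_elem Q x y z))"

section \<open>The two-parameter Virasoro algebra\<close>

definition pq_bracket :: "'k::field \<Rightarrow> 'k \<Rightarrow> int \<Rightarrow> 'k" where
  "pq_bracket p q k = (q powi k - p powi (- k)) / (q - inverse p)"

definition Virasoro_rels :: "'k::field \<Rightarrow> 'k \<Rightarrow> (int, 'k) free_algebra set" where
  "Virasoro_rels p q =
     {scal (p powi (n - m)) * gen n * gen m - scal (q powi (m - n)) * gen m * gen n
        - scal (pq_bracket p q (m - n)) * gen (m + n) | m n. True}"

definition Virasoro_alg :: "'k::field \<Rightarrow> 'k \<Rightarrow> (int, 'k) free_algebra set ring" where
  "Virasoro_alg p q = presented_algebra (Virasoro_rels p q)"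

text \<open>
  The algebra homomorphism to \<open>B\<close> with \<open>L\<^sub>n \<mapsto> z\<inverse> x\<^bsup>n+1\<^esup> y\<close>: a residue class is sent to the common
  value of its representatives.
\<close>

definition Virasoro_map ::
  "'q ring \<Rightarrow> ('k::field \<Rightarrow> 'q) \<Rightarrow> 'q \<Rightarrow> 'q \<Rightarrow> 'q \<Rightarrow> (int, 'k) free_algebra set \<Rightarrow> 'q" where
  "Virasoro_map Q \<kappa> x y z C =
     the_elem (free_eval (B_alg Q \<kappa> x y z) \<kappa> (L_elem Q x y z) ` C)"

section \<open>Left modules over a ring\<close>

text \<open>
  The library's \<^locale>\<open>module\<close> requires a commutative ring of scalars.  As there, the
  multiplicative part of a module record carries no meaning.
\<close>

locale left_module = R?: ring R + M?: abelian_group M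
  for R :: "('r, 'b) ring_scheme" (structure) and M :: "('r, 'm, 'z) module_scheme" (structure) +
  assumes smult_closed:
      "\<lbrakk>a \<in> carrier R; m \<in> carrier M\<rbrakk> \<Longrightarrow> a \<odot>\<^bsub>M\<^esub> m \<in> carrier M"
    and smult_l_distr:
      "\<lbrakk>a \<in> carrier R; b \<in> carrier R; m \<in> carrier M\<rbrakk> \<Longrightarrow>
        (a \<oplus>\<^bsub>R\<^esub> b) \<odot>\<^bsub>M\<^esub> m = a \<odot>\<^bsub>M\<^esub> m \<oplus>\<^bsub>M\<^esub> b \<odot>\<^bsub>M\<^esub> m"
    and smult_r_distr:
      "\<lbrakk>a \<in> carrier R; m \<in> carrier M; n \<in> carrier M\<rbrakk> \<Longrightarrow>
        a \<odot>\<^bsub>M\<^esub> (m \<oplus>\<^bsub>M\<^esub> n) = a \<odot>\<^bsub>M\<^esub> m \<oplus>\<^bsub>M\<^esub> a \<odot>\<^bsub>M\<^esub> n"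
    and smult_assoc:
      "\<lbrakk>a \<in> carrier R; b \<in> carrier R; m \<in> carrier M\<rbrakk> \<Longrightarrow>
        (a \<otimes>\<^bsub>R\<^esub> b) \<odot>\<^bsub>M\<^esub> m = a \<odot>\<^bsub>M\<^esub> (b \<odot>\<^bsub>M\<^esub> m)"
    and smult_one:
      "m \<in> carrier M \<Longrightarrow> \<one>\<^bsub>R\<^esub> \<odot>\<^bsub>M\<^esub> m = m"

definition simple_left_module :: "('r, 'b) ring_scheme \<Rightarrow> ('r, 'm) module \<Rightarrow> bool" where
  "simple_left_module R M \<longleftrightarrow>
     left_module R M \<and> carrier M \<noteq> {\<zero>\<^bsub>M\<^esub>} \<and>
     (\<forall>N. submodule N R M \<longrightarrow> N = {\<zero>\<^bsub>M\<^esub>} \<or> N = carrier M)"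

definition left_module_iso ::
  "('r, 'b) ring_scheme \<Rightarrow> ('r, 'm) module \<Rightarrow> ('r, 'n) module \<Rightarrow> bool" where
  "left_module_iso R M N \<longleftrightarrow>
     (\<exists>h. bij_betw h (carrier M) (carrier N) \<and>
        (\<forall>m\<in>carrier M. \<forall>m'\<in>carrier M. h (m \<oplus>\<^bsub>M\<^esub> m') = h m \<oplus>\<^bsub>N\<^esub> h m') \<and>
        (\<forall>a\<in>carrier R. \<forall>m\<in>carrier M. h (a \<odot>\<^bsub>M\<^esub> m) = a \<odot>\<^bsub>N\<^esub> h m))"

definition regular_module :: "('r, 'b) ring_scheme \<Rightarrow> ('r, 'r) module" where
  "regular_module R =
     \<lparr>carrier = carrier R, monoid.mult = monoid.mult R, one = one R, ring.zero = ring.zero R, add = add R,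
      module.smult = monoid.mult R\<rparr>"

definition quotient_module :: "('r, 'm) module \<Rightarrow> 'm set \<Rightarrow> ('r, 'm set) module" where
  "quotient_module M N =
     \<lparr>carrier = a_rcosets\<^bsub>M\<^esub> N, monoid.mult = undefined, one = undefined,
      ring.zero = N, add = set_add M,
      module.smult = (\<lambda>a C. (\<Union>m\<in>C. N +>\<^bsub>M\<^esub> (a \<odot>\<^bsub>M\<^esub> m)))\<rparr>"

definition restrict_scalars :: "('s \<Rightarrow> 'r) \<Rightarrow> ('r, 'm) module \<Rightarrow> ('s, 'm) module" where
  "restrict_scalars \<phi> M =
     \<lparr>carrier = carrier M, monoid.mult = monoid.mult M, one = one M, ring.zero = ring.zero M, add = add M,
      module.smult = (\<lambda>a m. \<phi> a \<odot>\<^bsub>M\<^esub> m)\<rparr>"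

definition composition_series ::
  "('r, 'b) ring_scheme \<Rightarrow> ('r, 'm) module \<Rightarrow> 'm set list \<Rightarrow> bool" where
  "composition_series R M Ns \<longleftrightarrow>
     left_module R M \<and> Ns \<noteq> [] \<and> hd Ns = carrier M \<and> last Ns = {\<zero>\<^bsub>M\<^esub>} \<and>
     (\<forall>N\<in>set Ns. submodule N R M) \<and>
     (\<forall>i. Suc i < length Ns \<longrightarrow>
        Ns ! Suc i \<subset> Ns ! i \<and>
        simple_left_module R (quotient_module (M\<lparr>carrier := Ns ! i\<rparr>) (Ns ! Suc i)))"

end

theory Submission
  imports Defs
begin

text \<open>
  Put \<open>u = z\<inverse>y\<close> and \<open>t = pq\<close>. The relations give \<open>ux = t xu + 1\<close>, and everything takes place in
  the ring \<open>B\<close> generated by the scalars, \<open>x\<^sup>\<plusminus>\<^sup>1\<close> and \<open>u\<close>. The key element is \<open>w = ux - xu = (t -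
  1)xu + 1\<close>, which satisfies \<open>wx = t xw\<close>. Since \<open>w - 1\<close> is a non-zero scalar multiple of \<open>xu\<close>,
  every element of \<open>B\<close> is a finite sum \<open>\<Sum>\<^sub>i x\<^sup>i f\<^sub>i(w)\<close> with \<open>i \<in> \<int>\<close> and polynomials \<open>f\<^sub>i\<close>, and
  the left ideal \<open>I = Bu\<close> is \<open>B(w - 1)\<close>. The Virasoro generator \<open>L\<^sub>n\<close> is a non-zero scalar
  multiple of \<open>x\<^sup>n(w - 1)\<close>, so it lies in \<open>I\<close>, and \<open>V = k + I\<close>.

  Two facts about \<open>p\<close>, \<open>q\<close> and \<open>Q\<close> are used. First, \<open>w = z\<inverse>(yx - p\<inverse>xy)\<close> is not zero: the second
  factor is \<open>\<omega>\<inverse>\<close> in the independent case, and a factor of \<open>\<Omega> = 1\<close> in the dependent one. Second,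
  \<open>t\<close> is not a root of unity. In the dependent case this is where the absence of polynomial
  identities enters: if \<open>t\<close> were a root of unity then so would be \<open>p\<close> and \<open>q\<close>, hence \<open>H\<close> would be
  finite over the central subalgebra generated by \<open>x\<^sup>N\<close>, \<open>y\<^sup>N\<close>, \<open>z\<^sup>N\<close> for some \<open>N\<close> and would
  satisfy a standard identity (\<open>finite_over_center_at_roots_of_unity\<close>,
  \<open>is_PI_algebra_if_finite_over_center\<close>).

  Given these facts, the scalars \<open>t\<^sup>i\<close> are distinct and \<open>w\<close> separates the components of a sum \<open>\<Sum>\<^sub>i
  x\<^sup>i f\<^sub>i(w)\<close>: conjugation by \<open>w\<close> multiplies \<open>x\<^sup>i f\<^sub>i(w)\<close> by \<open>t\<^sup>i\<close>, and so does left
  multiplication by \<open>w\<close> modulo \<open>I\<close> (\<open>eigencomponents_in_subspace\<close>). The first observation and the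
  algebraic closedness of \<open>k\<close> show \<open>1 \<notin> I\<close> (\<open>one_not_in_I\<close>). The second shows that a subspace
  which contains \<open>I\<close> and is stable under \<open>w\<close> contains a power of \<open>x\<close> with non-zero exponent unless
  it lies in \<open>k + I\<close> (\<open>subspace_dichotomy\<close>). Hence \<open>I\<close> is a maximal left ideal of \<open>B\<close>. Moreover
  \<open>B/(k + I)\<close> is simple over \<open>V\<close>, because \<open>(w - 1)x\<^sup>i \<equiv> (t\<^sup>i - 1)x\<^sup>i\<close> modulo \<open>I\<close>, whereas \<open>(k +
  I)/I\<close> is one-dimensional.

  Finally let \<open>N\<close> be a \<open>V\<close>-submodule of a simple \<open>B\<close>-module \<open>M\<close>. As \<open>Bu \<subseteq> V\<close>, the vectors \<open>un\<close>
  with \<open>n \<in> N\<close> lie in the largest \<open>B\<close>-submodule contained in \<open>N\<close>. If that is \<open>M\<close> then \<open>N = M\<close>. If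
  it is zero then \<open>u\<close> kills \<open>N\<close>, and a non-zero vector of \<open>N\<close> gives an isomorphism \<open>B/I \<cong> M\<close>
  (\<open>simple_restrict_scalars\<close>).
\<close>

section \<open>Left modules over a noncommutative ring\<close>

lemma left_moduleI:
  assumes "ring R" "abelian_group M"
    and "\<And>a m. a \<in> carrier R \<Longrightarrow> m \<in> carrier M \<Longrightarrow> a \<odot>\<^bsub>M\<^esub> m \<in> carrier M"
    and "\<And>a b m. a \<in> carrier R \<Longrightarrow> b \<in> carrier R \<Longrightarrow> m \<in> carrier M \<Longrightarrow>
        (a \<oplus>\<^bsub>R\<^esub> b) \<odot>\<^bsub>M\<^esub> m = a \<odot>\<^bsub>M\<^esub> m \<oplus>\<^bsub>M\<^esub> b \<odot>\<^bsub>M\<^esub> m"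
    and "\<And>a m n. a \<in> carrier R \<Longrightarrow> m \<in> carrier M \<Longrightarrow> n \<in> carrier M \<Longrightarrow>
        a \<odot>\<^bsub>M\<^esub> (m \<oplus>\<^bsub>M\<^esub> n) = a \<odot>\<^bsub>M\<^esub> m \<oplus>\<^bsub>M\<^esub> a \<odot>\<^bsub>M\<^esub> n"
    and "\<And>a b m. a \<in> carrier R \<Longrightarrow> b \<in> carrier R \<Longrightarrow> m \<in> carrier M \<Longrightarrow>
        (a \<otimes>\<^bsub>R\<^esub> b) \<odot>\<^bsub>M\<^esub> m = a \<odot>\<^bsub>M\<^esub> (b \<odot>\<^bsub>M\<^esub> m)"
    and "\<And>m. m \<in> carrier M \<Longrightarrow> \<one>\<^bsub>R\<^esub> \<odot>\<^bsub>M\<^esub> m = m"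
  shows "left_module R M"
  by (intro left_module.intro left_module_axioms.intro assms)

lemma submoduleE:
  assumes "submodule N R M"
  shows "N \<subseteq> carrier M" "\<zero>\<^bsub>M\<^esub> \<in> N"
    "\<And>a b. a \<in> N \<Longrightarrow> b \<in> N \<Longrightarrow> a \<oplus>\<^bsub>M\<^esub> b \<in> N"
    "\<And>a. a \<in> N \<Longrightarrow> \<ominus>\<^bsub>M\<^esub> a \<in> N"
    "\<And>r a. r \<in> carrier R \<Longrightarrow> a \<in> N \<Longrightarrow> r \<odot>\<^bsub>M\<^esub> a \<in> N"
proof -
  interpret submodule N R M by fact
  show "N \<subseteq> carrier M" "\<zero>\<^bsub>M\<^esub> \<in> N"
    "\<And>a b. a \<in> N \<Longrightarrow> b \<in> N \<Longrightarrow> a \<oplus>\<^bsub>M\<^esub> b \<in> N"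
    "\<And>a. a \<in> N \<Longrightarrow> \<ominus>\<^bsub>M\<^esub> a \<in> N"
    "\<And>r a. r \<in> carrier R \<Longrightarrow> a \<in> N \<Longrightarrow> r \<odot>\<^bsub>M\<^esub> a \<in> N"
    using subset one_closed m_closed m_inv_closed by (auto simp: a_inv_def)
qed

context left_module
begin

lemma smult_zero:
  assumes "a \<in> carrier R" shows "a \<odot>\<^bsub>M\<^esub> \<zero>\<^bsub>M\<^esub> = \<zero>\<^bsub>M\<^esub>"
  using smult_r_distr[OF assms M.zero_closed M.zero_closed] assms
  by (simp add: smult_closed)

lemma zero_smult:
  assumes "m \<in> carrier M" shows "\<zero> \<odot>\<^bsub>M\<^esub> m = \<zero>\<^bsub>M\<^esub>"
  using smult_l_distr[OF R.zero_closed R.zero_closed assms] assms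
  by (simp add: smult_closed)

lemma minus_smult:
  assumes "a \<in> carrier R" "m \<in> carrier M" shows "(\<ominus> a) \<odot>\<^bsub>M\<^esub> m = \<ominus>\<^bsub>M\<^esub> (a \<odot>\<^bsub>M\<^esub> m)"
proof -
  have "(\<ominus> a) \<odot>\<^bsub>M\<^esub> m \<oplus>\<^bsub>M\<^esub> a \<odot>\<^bsub>M\<^esub> m = \<zero>\<^bsub>M\<^esub>"
    using smult_l_distr[of "\<ominus> a" a m] assms by (simp add: R.l_neg zero_smult)
  then show ?thesis
    using assms by (simp add: M.minus_equality smult_closed)
qed

lemma submoduleI:
  assumes "N \<subseteq> carrier M" "\<zero>\<^bsub>M\<^esub> \<in> N"
    and "\<And>a b. a \<in> N \<Longrightarrow> b \<in> N \<Longrightarrow> a \<oplus>\<^bsub>M\<^esub> b \<in> N"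
    and smult: "\<And>r a. r \<in> carrier R \<Longrightarrow> a \<in> N \<Longrightarrow> r \<odot>\<^bsub>M\<^esub> a \<in> N"
  shows "submodule N R M"
proof -
  have "\<ominus>\<^bsub>M\<^esub> a \<in> N" if "a \<in> N" for a
    using smult[of "\<ominus> \<one>" a] minus_smult[of \<one> a] that assms(1) by (auto simp: smult_one)
  then show ?thesis
    using assms by (intro submodule.intro subgroup.intro) (auto simp: a_inv_def submodule_axioms_def)
qed

lemma left_module_restrict_carrier:
  assumes "submodule N R M"
  shows "left_module R (M\<lparr>carrier := N\<rparr>)"
proof -
  interpret N: submodule N R M by fact
  note NE = submoduleE[OF assms]
  have "\<exists>y\<in>N. y \<oplus>\<^bsub>M\<^esub> n = \<zero>\<^bsub>M\<^esub>" if "n \<in> N" for n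
    using that NE(1,4) M.l_neg by blast
  then have ab: "abelian_group (M\<lparr>carrier := N\<rparr>)"
    using NE(1-3) by (intro abelian_groupI) (auto simp: subset_eq M.a_assoc intro: M.a_comm)
  show ?thesis
    by (rule left_moduleI[OF R.ring_axioms ab])
       (use NE in \<open>auto simp: smult_l_distr smult_r_distr smult_assoc smult_one subset_eq\<close>)
qed

end

text \<open>
  Quotients are formed for module records without additional fields, and are again such records.
\<close>

locale plain_left_module = left_module R M
  for R :: "('r, 'b) ring_scheme" (structure) and M :: "('r, 'm) module" (structure)
begin

lemma quotient_module_smult:
  assumes "submodule N R M" "a \<in> carrier R" "m \<in> carrier M"
  shows "a \<odot>\<^bsub>quotient_module M N\<^esub> (N +>\<^bsub>M\<^esub> m) = N +>\<^bsub>M\<^esub> (a \<odot>\<^bsub>M\<^esub> m)"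
proof -
  interpret N: submodule N R M by fact
  have sub: "N \<subseteq> carrier M" using N.subset by simp
  have self: "m \<in> N +>\<^bsub>M\<^esub> m"
    using M.add.rcos_self[OF assms(3) N.subgroup_axioms] by (simp add: a_r_coset_def)
  have eq: "N +>\<^bsub>M\<^esub> (a \<odot>\<^bsub>M\<^esub> m') = N +>\<^bsub>M\<^esub> (a \<odot>\<^bsub>M\<^esub> m)" if "m' \<in> N +>\<^bsub>M\<^esub> m" for m'
  proof -
    from that obtain n where n: "n \<in> N" "m' = n \<oplus>\<^bsub>M\<^esub> m"
      by (auto simp: a_r_coset_def')
    then have "a \<odot>\<^bsub>M\<^esub> m' = a \<odot>\<^bsub>M\<^esub> n \<oplus>\<^bsub>M\<^esub> a \<odot>\<^bsub>M\<^esub> m"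
      using sub assms by (simp add: smult_r_distr subset_eq)
    also have "\<dots> \<in> N +>\<^bsub>M\<^esub> (a \<odot>\<^bsub>M\<^esub> m)"
      using n assms by (auto simp: a_r_coset_def')
    finally show ?thesis
      using M.a_repr_independence[OF _ _ N.subgroup_axioms] assms smult_closed by metis
  qed
  have "(\<Union>m'\<in>N +>\<^bsub>M\<^esub> m. N +>\<^bsub>M\<^esub> (a \<odot>\<^bsub>M\<^esub> m')) = N +>\<^bsub>M\<^esub> (a \<odot>\<^bsub>M\<^esub> m)"
    using eq self by blast
  then show ?thesis
    by (simp add: quotient_module_def)
qed

lemma quotient_module_add:
  assumes "submodule N R M" "m \<in> carrier M" "m' \<in> carrier M"
  shows "(N +>\<^bsub>M\<^esub> m) \<oplus>\<^bsub>quotient_module M N\<^esub> (N +>\<^bsub>M\<^esub> m') = N +>\<^bsub>M\<^esub> (m \<oplus>\<^bsub>M\<^esub> m')"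
proof -
  interpret N: submodule N R M by fact
  have "N \<lhd> add_monoid M"
    using M.a_comm_group N.subgroup_axioms comm_group.subgroup_imp_normal by blast
  from normal.rcos_sum[OF this] assms show ?thesis
    by (simp add: quotient_module_def set_add_def a_r_coset_def)
qed

lemma carrier_quotient_module:
  "carrier (quotient_module M N) = (\<lambda>m. N +>\<^bsub>M\<^esub> m) ` carrier M"
  by (auto simp: quotient_module_def A_RCOSETS_def')

lemma left_module_quotient:
  assumes "submodule N R M"
  shows "left_module R (quotient_module M N)"
proof -
  interpret N: submodule N R M by fact
  note [simp] = carrier_quotient_module quotient_module_add[OF assms] quotient_module_smult[OF assms]
    smult_l_distr smult_r_distr smult_assoc smult_one smult_closed M.a_assoc
  have zero: "\<zero>\<^bsub>quotient_module M N\<^esub> = N +>\<^bsub>M\<^esub> \<zero>\<^bsub>M\<^esub>"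
    using M.a_coset_add_zero N.subset by (simp add: quotient_module_def)
  have neg: "\<exists>C\<in>carrier (quotient_module M N).
      C \<oplus>\<^bsub>quotient_module M N\<^esub> (N +>\<^bsub>M\<^esub> m) = \<zero>\<^bsub>quotient_module M N\<^esub>"
    if "m \<in> carrier M" for m
    using that by (intro bexI[of _ "N +>\<^bsub>M\<^esub> (\<ominus>\<^bsub>M\<^esub> m)"]) (auto simp: zero M.l_neg)
  have ab: "abelian_group (quotient_module M N)"
    by (rule abelian_groupI) (use neg in \<open>auto simp: zero M.a_comm M.a_lcomm\<close>)
  show ?thesis
    by (rule left_moduleI[OF R.ring_axioms ab]) auto
qed

lemma coset_eq_iff:
  assumes "submodule N R M" "m \<in> carrier M" "m' \<in> carrier M"
  shows "N +>\<^bsub>M\<^esub> m = N +>\<^bsub>M\<^esub> m' \<longleftrightarrow> m \<ominus>\<^bsub>M\<^esub> m' \<in> N"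
proof -
  interpret N: submodule N R M by fact
  interpret A: abelian_subgroup N M
    using N.subgroup_axioms M.abelian_group_axioms
    by (intro abelian_subgroupI3 additive_subgroupI) auto
  show ?thesis
    using A.a_rcos_module_rev[of m' m] A.a_rcos_module_imp[of m' m]
     A.a_rcos_self[of m] M.a_repr_independence[of m N m', OF _ _ N.subgroup_axioms] assms
    by (metis M.minus_eq)
qed

lemma coset_eq_self_iff:
  assumes "submodule N R M" "m \<in> carrier M"
  shows "N +>\<^bsub>M\<^esub> m = N \<longleftrightarrow> m \<in> N"
  using coset_eq_iff[OF assms M.zero_closed] submoduleE(1)[OF assms(1)] assms(2)
    M.a_coset_add_zero[of N] M.minus_equality[OF M.r_zero[OF M.zero_closed]]
  by (simp add: a_minus_def)

text \<open>
  The half of the correspondence theorem that turns statements about submodules between \<open>N\<close> and \<open>M\<close>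
  into statements about all submodules of \<open>M / N\<close>.
\<close>

lemma submodule_of_quotient_preimage:
  assumes N: "submodule N R M" and W: "submodule W R (quotient_module M N)"
  defines "P \<equiv> {m \<in> carrier M. N +>\<^bsub>M\<^esub> m \<in> W}"
  shows "submodule P R M" "N \<subseteq> P" "W = (\<lambda>m. N +>\<^bsub>M\<^esub> m) ` P"
proof -
  interpret QM: plain_left_module R "quotient_module M N"
    by (simp add: plain_left_module_def left_module_quotient N)
  note WE = submoduleE[OF W] and NE = submoduleE[OF N]
  have zero: "N +>\<^bsub>M\<^esub> m = \<zero>\<^bsub>quotient_module M N\<^esub>" if "m \<in> N" for m
    using coset_eq_self_iff[OF N] NE(1) that by (auto simp: quotient_module_def)
  show "N \<subseteq> P"
    using NE(1) zero WE(2) by (auto simp: P_def)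
  show "W = (\<lambda>m. N +>\<^bsub>M\<^esub> m) ` P"
    using WE(1) by (auto simp: P_def carrier_quotient_module)
  show "submodule P R M"
  proof (rule submoduleI)
    show "\<zero>\<^bsub>M\<^esub> \<in> P" using \<open>N \<subseteq> P\<close> NE(2) by blast
    show "a \<oplus>\<^bsub>M\<^esub> b \<in> P" if "a \<in> P" "b \<in> P" for a b
      using that WE(3)[of "N +>\<^bsub>M\<^esub> a" "N +>\<^bsub>M\<^esub> b"] by (simp add: P_def quotient_module_add[OF N])
    show "r \<odot>\<^bsub>M\<^esub> a \<in> P" if "r \<in> carrier R" "a \<in> P" for r a
      using that WE(5)[of r "N +>\<^bsub>M\<^esub> a"] by (simp add: P_def quotient_module_smult[OF N] smult_closed)
  qed (simp add: P_def)
qed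

lemma simple_quotientI:
  assumes N: "submodule N R M" "N \<noteq> carrier M"
    and max: "\<And>P. submodule P R M \<Longrightarrow> N \<subseteq> P \<Longrightarrow> P = N \<or> P = carrier M"
  shows "simple_left_module R (quotient_module M N)"
  unfolding simple_left_module_def
proof (intro conjI allI impI)
  show "left_module R (quotient_module M N)" by (rule left_module_quotient[OF N(1)])
  have z: "\<zero>\<^bsub>quotient_module M N\<^esub> = N" by (simp add: quotient_module_def)
  obtain m where "m \<in> carrier M" "m \<notin> N"
    using N submoduleE(1)[OF N(1)] by blast
  then show "carrier (quotient_module M N) \<noteq> {\<zero>\<^bsub>quotient_module M N\<^esub>}"
    using coset_eq_self_iff[OF N(1)] by (auto simp: z carrier_quotient_module)
  fix W assume W: "submodule W R (quotient_module M N)"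
  note P = submodule_of_quotient_preimage[OF N(1) W]
  from max[OF P(1,2)] show "W = {\<zero>\<^bsub>quotient_module M N\<^esub>} \<or> W = carrier (quotient_module M N)"
  proof
    assume "{m \<in> carrier M. N +>\<^bsub>M\<^esub> m \<in> W} = N"
    with P(3) have W: "W = (\<lambda>m. N +>\<^bsub>M\<^esub> m) ` N" by simp
    have "N +>\<^bsub>M\<^esub> m = N" if "m \<in> N" for m
      using coset_eq_self_iff[OF N(1)] submoduleE(1)[OF N(1)] that by blast
    then have "W = {N}" using W submoduleE(2)[OF N(1)] by auto
    then show ?thesis by (simp add: z)
  next
    assume "{m \<in> carrier M. N +>\<^bsub>M\<^esub> m \<in> W} = carrier M"
    with P(3) show ?thesis by (simp add: carrier_quotient_module)
  qed
qed

text \<open>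
  Both factors are compared with submodules of \<open>M\<close> by taking preimages, so that no isomorphism \<open>(M
  / N) / (P / N) \<cong> M / P\<close> has to be constructed.
\<close>

lemma composition_series_quotient:
  assumes N: "submodule N R M" and P: "submodule P R M" "N \<subset> P" "P \<subset> carrier M"
    and top: "\<And>P'. submodule P' R M \<Longrightarrow> P \<subseteq> P' \<Longrightarrow> P' = P \<or> P' = carrier M"
    and bottom: "\<And>P'. submodule P' R M \<Longrightarrow> N \<subseteq> P' \<Longrightarrow> P' \<subseteq> P \<Longrightarrow> P' = N \<or> P' = P"
  shows "composition_series R (quotient_module M N)
    [carrier (quotient_module M N), (\<lambda>m. N +>\<^bsub>M\<^esub> m) ` P, {N}]"
proof -
  let ?Q = "quotient_module M N" and ?C = "\<lambda>m. N +>\<^bsub>M\<^esub> m"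
  interpret Q: plain_left_module R ?Q
    by (simp add: plain_left_module_def left_module_quotient N)
  note NE = submoduleE[OF N] and PE = submoduleE[OF P(1)]
  note Q_simps = quotient_module_add[OF N] quotient_module_smult[OF N]
  have zero: "\<zero>\<^bsub>?Q\<^esub> = N" by (simp add: quotient_module_def)
  have C_N: "?C m = N" if "m \<in> N" for m
    using coset_eq_self_iff[OF N] NE(1) that by blast
  have mem: "m \<in> P" if "?C m \<in> ?C ` P" "m \<in> carrier M" for m
  proof -
    obtain m' where m': "m' \<in> P" "?C m = ?C m'" using \<open>?C m \<in> ?C ` P\<close> by blast
    then have c: "m' \<in> carrier M" using PE(1) by blast
    have "m \<ominus>\<^bsub>M\<^esub> m' \<in> P"
      using coset_eq_iff[OF N that(2) c] m'(2) P(2) by blast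
    then have "(m \<ominus>\<^bsub>M\<^esub> m') \<oplus>\<^bsub>M\<^esub> m' \<in> P" using m'(1) by (rule PE(3))
    then show ?thesis using that(2) c by (simp add: a_minus_def M.a_assoc M.l_neg)
  qed
  have sub_P: "submodule (?C ` P) R ?Q"
  proof (rule Q.submoduleI)
    show "?C ` P \<subseteq> carrier ?Q" using PE(1) by (auto simp: carrier_quotient_module)
    show "\<zero>\<^bsub>?Q\<^esub> \<in> ?C ` P" using C_N[OF NE(2)] PE(2) by (auto simp: zero)
    show "a \<oplus>\<^bsub>?Q\<^esub> b \<in> ?C ` P" if ab: "a \<in> ?C ` P" "b \<in> ?C ` P" for a b
    proof -
      obtain m n where "m \<in> P" "a = ?C m" "n \<in> P" "b = ?C n" using ab by blast
      then have "a \<oplus>\<^bsub>?Q\<^esub> b = ?C (m \<oplus>\<^bsub>M\<^esub> n)" "m \<oplus>\<^bsub>M\<^esub> n \<in> P"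
        by (simp_all add: Q_simps PE(3) subsetD[OF PE(1)])
      then show ?thesis by blast
    qed
    show "r \<odot>\<^bsub>?Q\<^esub> a \<in> ?C ` P" if r: "r \<in> carrier R" and a: "a \<in> ?C ` P" for r a
    proof -
      obtain m where "m \<in> P" "a = ?C m" using a by blast
      then have "r \<odot>\<^bsub>?Q\<^esub> a = ?C (r \<odot>\<^bsub>M\<^esub> m)" "r \<odot>\<^bsub>M\<^esub> m \<in> P"
        using r by (simp_all add: Q_simps PE(5) subsetD[OF PE(1)])
      then show ?thesis by blast
    qed
  qed
  have N_add: "N \<oplus>\<^bsub>?Q\<^esub> N = N"
    using Q.M.r_zero[OF Q.M.zero_closed] by (simp only: zero)
  have N_smult: "r \<odot>\<^bsub>?Q\<^esub> N = N" if "r \<in> carrier R" for r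
    using Q.smult_zero[OF that] by (simp only: zero)
  have N_closed: "N \<in> carrier ?Q" using Q.M.zero_closed by (simp only: zero)
  have sub_N: "submodule {N} R ?Q"
    by (rule Q.submoduleI) (simp_all add: zero N_add N_smult N_closed)
  have sub_carrier: "submodule (carrier ?Q) R ?Q"
    by (rule Q.submoduleI) (simp_all add: Q.smult_closed)
  obtain n where n: "n \<in> P" "n \<notin> N" using P(2) by blast
  then have "?C n \<noteq> N" using coset_eq_self_iff[OF N] PE(1) by blast
  then have strict_N: "{N} \<subset> ?C ` P" using C_N[OF NE(2)] PE(2) n(1) by blast
  obtain m where m: "m \<in> carrier M" "m \<notin> P" using P(3) by blast
  then have strict_P: "?C ` P \<subset> carrier ?Q"
    using mem[of m] PE(1) by (auto simp: carrier_quotient_module)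
  have simple_top: "simple_left_module R (quotient_module ?Q (?C ` P))"
  proof (rule Q.simple_quotientI[OF sub_P])
    fix W assume W: "submodule W R ?Q" "?C ` P \<subseteq> W"
    note pre = submodule_of_quotient_preimage[OF N W(1)]
    have "P \<subseteq> {m \<in> carrier M. ?C m \<in> W}" using W(2) PE(1) by blast
    from top[OF pre(1) this] show "W = ?C ` P \<or> W = carrier ?Q"
      using pre(3) by (auto simp: carrier_quotient_module)
  qed (use strict_P in blast)
  interpret PN: plain_left_module R "?Q\<lparr>carrier := ?C ` P\<rparr>"
    using Q.left_module_restrict_carrier[OF sub_P] by (simp add: plain_left_module_def)
  have simple_bottom: "simple_left_module R (quotient_module (?Q\<lparr>carrier := ?C ` P\<rparr>) {N})"
  proof (rule PN.simple_quotientI)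
    show "submodule {N} R (?Q\<lparr>carrier := ?C ` P\<rparr>)"
      by (rule PN.submoduleI)
         (use psubset_imp_subset[OF strict_N] in \<open>simp_all add: zero N_add N_smult\<close>)
    show "{N} \<noteq> carrier (?Q\<lparr>carrier := ?C ` P\<rparr>)" using strict_N by auto
    fix W assume W: "submodule W R (?Q\<lparr>carrier := ?C ` P\<rparr>)" "{N} \<subseteq> W"
    note WE = submoduleE[OF W(1)]
    have W_sub: "W \<subseteq> ?C ` P" and W_zero: "\<zero>\<^bsub>?Q\<^esub> \<in> W" using WE(1,2) by simp_all
    have "submodule W R ?Q"
    proof (rule Q.submoduleI)
      show "W \<subseteq> carrier ?Q" using W_sub strict_P by blast
      show "a \<oplus>\<^bsub>?Q\<^esub> b \<in> W" if "a \<in> W" "b \<in> W" for a b using WE(3)[OF that] by simp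
      show "r \<odot>\<^bsub>?Q\<^esub> a \<in> W" if "r \<in> carrier R" "a \<in> W" for r a using WE(5)[OF that] by simp
    qed (rule W_zero)
    note pre = submodule_of_quotient_preimage[OF N this]
    have "{m \<in> carrier M. ?C m \<in> W} \<subseteq> P" using W_sub mem by blast
    from bottom[OF pre(1,2) this] show "W = {N} \<or> W = carrier (?Q\<lparr>carrier := ?C ` P\<rparr>)"
    proof
      assume "{m \<in> carrier M. ?C m \<in> W} = N"
      then have "W = ?C ` N" using pre(3) by simp
      also have "\<dots> = {N}" using C_N NE(2) by blast
      finally show ?thesis ..
    next
      assume "{m \<in> carrier M. ?C m \<in> W} = P"
      then show ?thesis using pre(3) by simp
    qed
  qed
  let ?Ns = "[carrier ?Q, ?C ` P, {N}]"
  have step: "?Ns ! Suc i \<subset> ?Ns ! i \<and>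
      simple_left_module R (quotient_module (?Q\<lparr>carrier := ?Ns ! i\<rparr>) (?Ns ! Suc i))"
    if "Suc i < length ?Ns" for i
  proof -
    have "i = 0 \<or> i = 1" using that by auto
    then show ?thesis
      using strict_P strict_N simple_top simple_bottom by (elim disjE) simp_all
  qed
  have subs: "\<forall>N'\<in>set ?Ns. submodule N' R ?Q"
    using sub_carrier sub_P sub_N by simp
  show ?thesis
    unfolding composition_series_def
    by (intro conjI allI impI Q.left_module_axioms subs step) (simp_all add: zero)
qed

end

lemma abelian_group_transfer:
  assumes "abelian_group M"
    and "carrier N = carrier M" "\<zero>\<^bsub>N\<^esub> = \<zero>\<^bsub>M\<^esub>" "add N = add M"
  shows "abelian_group N"
proof -
  interpret M: abelian_group M by fact
  have "\<exists>b\<in>carrier M. b \<oplus>\<^bsub>M\<^esub> a = \<zero>\<^bsub>M\<^esub>" if "a \<in> carrier M" for a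
    using that M.l_neg by blast
  then show ?thesis
    by (intro abelian_groupI) (auto simp: assms(2-4) M.a_assoc intro: M.a_comm)
qed

lemma left_module_regular:
  assumes "ring R" shows "left_module R (regular_module R)"
proof -
  interpret ring R by fact
  have ab: "abelian_group (regular_module R)"
    by (rule abelian_group_transfer[OF abelian_group_axioms]) (simp_all add: regular_module_def)
  show ?thesis
    by (rule left_moduleI[OF ring_axioms ab])
       (simp_all add: regular_module_def l_distr r_distr m_assoc)
qed

lemma left_module_restrict_scalars:
  assumes "ring S" "\<phi> \<in> ring_hom S R" "left_module R M"
  shows "left_module S (restrict_scalars \<phi> M)"
proof -
  interpret plain_left_module R M using assms(3) by (simp add: plain_left_module_def)
  have ab: "abelian_group (restrict_scalars \<phi> M)"
    by (rule abelian_group_transfer[OF M.abelian_group_axioms]) (simp_all add: restrict_scalars_def)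
  note hom = ring_hom_closed[OF assms(2)] ring_hom_add[OF assms(2)] ring_hom_mult[OF assms(2)]
    ring_hom_one[OF assms(2)]
  show ?thesis
    by (rule left_moduleI[OF assms(1) ab])
       (simp_all add: restrict_scalars_def hom smult_closed smult_l_distr smult_r_distr
          smult_assoc smult_one)
qed

text \<open>
  The map \<open>r \<mapsto> r m\<close> identifies the module with \<open>R / ann(m)\<close>, and a maximal left ideal that kills \<open>m\<close>
  is all of the annihilator.
\<close>

lemma (in plain_left_module) simple_module_iso_quotient:
  assumes simple: "simple_left_module R M"
    and I: "submodule I R (regular_module R)"
    and max: "\<And>P. submodule P R (regular_module R) \<Longrightarrow> I \<subseteq> P \<Longrightarrow> P = I \<or> P = carrier R"
    and m: "m \<in> carrier M" "m \<noteq> \<zero>\<^bsub>M\<^esub>" "\<And>a. a \<in> I \<Longrightarrow> a \<odot>\<^bsub>M\<^esub> m = \<zero>\<^bsub>M\<^esub>"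
  shows "left_module_iso R M (quotient_module (regular_module R) I)"
proof -
  interpret Reg: plain_left_module R "regular_module R"
    by (simp add: plain_left_module_def left_module_regular R.ring_axioms)
  let ?Reg = "regular_module R"
  have Reg_simps: "carrier ?Reg = carrier R" "\<And>a b. a \<oplus>\<^bsub>?Reg\<^esub> b = a \<oplus> b" "\<zero>\<^bsub>?Reg\<^esub> = \<zero>"
    "\<And>a b. a \<odot>\<^bsub>?Reg\<^esub> b = a \<otimes> b"
    by (auto simp: regular_module_def)
  have Reg_minus: "\<ominus>\<^bsub>?Reg\<^esub> a = \<ominus> a" for a
    by (simp add: a_inv_def m_inv_def regular_module_def)
  define ann where "ann = {a \<in> carrier R. a \<odot>\<^bsub>M\<^esub> m = \<zero>\<^bsub>M\<^esub>}"
  have "submodule ann R ?Reg"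
    by (rule Reg.submoduleI)
       (auto simp: ann_def Reg_simps Reg_minus smult_l_distr smult_assoc
         zero_smult minus_smult smult_zero m)
  moreover have "I \<subseteq> ann"
    using submoduleE(1)[OF I] m(3) by (auto simp: ann_def Reg_simps)
  moreover have "\<one> \<notin> ann" using m by (simp add: ann_def smult_one)
  ultimately have ann: "ann = I" using max by blast
  define img where "img = (\<lambda>a. a \<odot>\<^bsub>M\<^esub> m) ` carrier R"
  have "submodule img R M"
  proof (rule submoduleI)
    show "img \<subseteq> carrier M" using m by (auto simp: img_def smult_closed)
    show "\<zero>\<^bsub>M\<^esub> \<in> img" unfolding img_def using m zero_smult by (metis R.zero_closed image_eqI)
    show "a \<oplus>\<^bsub>M\<^esub> b \<in> img" if "a \<in> img" "b \<in> img" for a b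
      using that m smult_l_distr unfolding img_def by (smt (verit) R.add.m_closed image_iff)
    show "r \<odot>\<^bsub>M\<^esub> a \<in> img" if "r \<in> carrier R" "a \<in> img" for r a
      using that m smult_assoc unfolding img_def by (smt (verit) R.m_closed image_iff)
  qed
  moreover have "m \<in> img"
    unfolding img_def using m smult_one by (metis R.one_closed image_eqI)
  ultimately have img: "img = carrier M"
    using simple m(2) unfolding simple_left_module_def by blast
  have coset_iff: "I +>\<^bsub>?Reg\<^esub> a = I +>\<^bsub>?Reg\<^esub> b \<longleftrightarrow> a \<odot>\<^bsub>M\<^esub> m = b \<odot>\<^bsub>M\<^esub> m"
    if ab: "a \<in> carrier R" "b \<in> carrier R" for a b
  proof -
    have "I +>\<^bsub>?Reg\<^esub> a = I +>\<^bsub>?Reg\<^esub> b \<longleftrightarrow> a \<oplus> \<ominus> b \<in> ann"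
      using Reg.coset_eq_iff[OF I, of a b] ab by (simp add: Reg_simps ann a_minus_def Reg_minus)
    also have "\<dots> \<longleftrightarrow> a \<odot>\<^bsub>M\<^esub> m \<oplus>\<^bsub>M\<^esub> \<ominus>\<^bsub>M\<^esub> (b \<odot>\<^bsub>M\<^esub> m) = \<zero>\<^bsub>M\<^esub>"
      using ab m by (simp add: ann_def smult_l_distr minus_smult)
    also have "\<dots> \<longleftrightarrow> a \<odot>\<^bsub>M\<^esub> m = b \<odot>\<^bsub>M\<^esub> m"
      using ab m by (metis M.add.inv_closed M.minus_equality M.minus_minus M.r_neg smult_closed)
    finally show ?thesis .
  qed
  \<comment> \<open>The inverse of \<open>I + r \<mapsto> r m\<close>; preimages of \<open>n\<close> differ by elements of \<open>I\<close>, so any choice will do.\<close>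
  define h where "h n = I +>\<^bsub>?Reg\<^esub> (SOME a. a \<in> carrier R \<and> a \<odot>\<^bsub>M\<^esub> m = n)" for n
  have h: "h (a \<odot>\<^bsub>M\<^esub> m) = I +>\<^bsub>?Reg\<^esub> a" if "a \<in> carrier R" for a
  proof -
    have "(SOME b. b \<in> carrier R \<and> b \<odot>\<^bsub>M\<^esub> m = a \<odot>\<^bsub>M\<^esub> m) \<in> carrier R \<and>
      (SOME b. b \<in> carrier R \<and> b \<odot>\<^bsub>M\<^esub> m = a \<odot>\<^bsub>M\<^esub> m) \<odot>\<^bsub>M\<^esub> m = a \<odot>\<^bsub>M\<^esub> m"
      by (rule someI[of _ a]) (use that in simp)
    then show ?thesis unfolding h_def using coset_iff that by blast
  qed
  have ex: "\<exists>a\<in>carrier R. n = a \<odot>\<^bsub>M\<^esub> m" if "n \<in> carrier M" for n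
    using that img by (auto simp: img_def)
  show ?thesis
    unfolding left_module_iso_def
  proof (intro exI[of _ h] conjI ballI)
    show "bij_betw h (carrier M) (carrier (quotient_module ?Reg I))"
      unfolding bij_betw_def
    proof
      show "inj_on h (carrier M)"
        by (rule inj_onI) (use ex h coset_iff in metis)
      show "h ` carrier M = carrier (quotient_module ?Reg I)"
        unfolding Reg.carrier_quotient_module img[symmetric] img_def
        by (auto simp: image_image h Reg_simps cong: image_cong)
    qed
    show "h (n \<oplus>\<^bsub>M\<^esub> n') = h n \<oplus>\<^bsub>quotient_module ?Reg I\<^esub> h n'"
      if nn: "n \<in> carrier M" "n' \<in> carrier M" for n n'
    proof -
      obtain a b where ab: "a \<in> carrier R" "n = a \<odot>\<^bsub>M\<^esub> m" "b \<in> carrier R" "n' = b \<odot>\<^bsub>M\<^esub> m"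
        using ex nn by meson
      then have "n \<oplus>\<^bsub>M\<^esub> n' = (a \<oplus> b) \<odot>\<^bsub>M\<^esub> m" by (simp add: smult_l_distr m)
      then show ?thesis
        using ab h[of "a \<oplus> b"] Reg.quotient_module_add[OF I, of a b] by (simp add: h Reg_simps)
    qed
    show "h (a \<odot>\<^bsub>M\<^esub> n) = a \<odot>\<^bsub>quotient_module ?Reg I\<^esub> h n"
      if an: "a \<in> carrier R" "n \<in> carrier M" for a n
    proof -
      obtain b where b: "b \<in> carrier R" "n = b \<odot>\<^bsub>M\<^esub> m" using ex an by meson
      then have "a \<odot>\<^bsub>M\<^esub> n = (a \<otimes> b) \<odot>\<^bsub>M\<^esub> m" using an m by (simp add: smult_assoc)
      then show ?thesis
        using an b h[of "a \<otimes> b"] Reg.quotient_module_smult[OF I, of a b] by (simp add: h Reg_simps)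
    qed
  qed
qed

section \<open>Free and presented algebras\<close>

lemma ring_of_type_algebra_simps:
  "carrier ring_of_type_algebra = UNIV" "f \<oplus>\<^bsub>ring_of_type_algebra\<^esub> g = f + g"
  "f \<otimes>\<^bsub>ring_of_type_algebra\<^esub> g = f * g" "\<one>\<^bsub>ring_of_type_algebra\<^esub> = 1"
  "\<zero>\<^bsub>ring_of_type_algebra\<^esub> = 0"
  by (simp_all add: ring_of_type_algebra_def)

lemma ring_type_algebra: "ring (ring_of_type_algebra :: 'a::ring_1 ring)"
proof (rule ringI)
  have "\<exists>y. y + x = 0" for x :: 'a
    using add.left_inverse by blast
  then show "abelian_group (ring_of_type_algebra :: 'a ring)"
    by (intro abelian_groupI) (simp_all add: ring_of_type_algebra_simps add_ac)
  show "Group.monoid (ring_of_type_algebra :: 'a ring)"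
    by (rule monoidI) (simp_all add: ring_of_type_algebra_simps mult.assoc)
qed (simp_all add: ring_of_type_algebra_simps algebra_simps)

lemma free_algebra_induct [case_names monomial add]:
  fixes f :: "('g, 'k::ring_1) free_algebra"
  assumes "\<And>w c. P (Poly_Mapping.single w c)" "\<And>f g. P f \<Longrightarrow> P g \<Longrightarrow> P (f + g)"
  shows "P f"
proof (induction "card (Poly_Mapping.keys f)" arbitrary: f)
  case 0
  then have "f = Poly_Mapping.single (Word []) 0" by simp
  then show ?case using assms(1) by metis
next
  case (Suc n)
  then obtain w where w: "w \<in> Poly_Mapping.keys f"
    by (metis card.empty ex_in_conv nat.distinct(1))
  let ?g = "f - Poly_Mapping.single w (Poly_Mapping.lookup f w)"
  have "Poly_Mapping.keys ?g = Poly_Mapping.keys f - {w}"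
    by (auto simp: in_keys_iff lookup_minus lookup_single when_def split: if_splits)
  then have "P ?g" using Suc w by (intro Suc(1)) auto
  then have "P (?g + Poly_Mapping.single w (Poly_Mapping.lookup f w))" by (intro assms)
  then show ?case by simp
qed

lemma monomial_eq_prod:
  "Poly_Mapping.single (Word gs) c = scal c * prod_list (map gen gs)"
proof -
  have "Poly_Mapping.single (Word gs) 1 = prod_list (map gen gs :: ('a, 'b) free_algebra list)"
  proof (induction gs)
    case Nil
    show ?case by (simp add: zero_word_def[symmetric] single_one)
  next
    case (Cons g gs)
    have "Poly_Mapping.single (Word (g # gs)) (1 :: 'b) = gen g * Poly_Mapping.single (Word gs) 1"
      by (simp add: gen_def mult_single plus_word_def)
    with Cons show ?case by simp
  qed
  then show ?thesis
    by (simp add: scal_def mult_single plus_word_def flip: \<open>_ = prod_list _\<close>)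
qed

lemma scal_commutes: "scal c * f = f * scal (c :: 'k::comm_ring_1)"
  by (induction f rule: free_algebra_induct)
     (simp_all add: scal_def mult_single plus_word_def algebra_simps)

lemma scal_simps:
  "scal 1 = 1" "scal 0 = 0" "scal (a + b) = scal a + scal b"
  by (simp_all add: scal_def single_add zero_word_def[symmetric])

lemma scal_times: "scal (a * b) = scal a * scal b"
  by (simp add: scal_def mult_single plus_word_def)

locale central_algebra = ring R for R (structure) +
  fixes \<kappa> :: "'k::field \<Rightarrow> 'a"
  assumes scal_closed [simp]: "\<kappa> c \<in> carrier R"
    and scal_one: "\<kappa> 1 = \<one>"
    and scal_add: "\<kappa> (a + b) = \<kappa> a \<oplus> \<kappa> b"
    and scal_mult: "\<kappa> (a * b) = \<kappa> a \<otimes> \<kappa> b"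
    and scal_central: "r \<in> carrier R \<Longrightarrow> r \<otimes> \<kappa> c = \<kappa> c \<otimes> r"
begin

lemma scal_zero: "\<kappa> 0 = \<zero>"
  using scal_add[of 0 0] by simp

lemma scal_minus: "\<kappa> (- a) = \<ominus> \<kappa> a"
  using scal_add[of "- a" a] by (simp add: scal_zero minus_equality)

lemma scal_lcomm:
  assumes "a \<in> carrier R" "b \<in> carrier R"
  shows "a \<otimes> (\<kappa> c \<otimes> b) = \<kappa> c \<otimes> (a \<otimes> b)"
  using assms m_assoc[of a "\<kappa> c" b] m_assoc[of "\<kappa> c" a b] scal_central[of a c] by simp

lemma scal_inj:
  assumes "\<zero> \<noteq> \<one>" shows "\<kappa> a = \<zero> \<longleftrightarrow> a = 0"
proof
  assume "\<kappa> a = \<zero>"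
  then have "\<kappa> (a * inverse a) = \<zero>" by (simp add: scal_mult)
  then show "a = 0" using assms by (cases "a = 0") (simp_all add: scal_one)
qed (simp add: scal_zero)

context
  fixes \<rho> :: "'g \<Rightarrow> 'a"
  assumes \<rho>: "\<And>g. \<rho> g \<in> carrier R"
begin

abbreviation word_value :: "'g list \<Rightarrow> 'a" where
  "word_value gs \<equiv> foldr (\<lambda>g a. \<rho> g \<otimes> a) gs \<one>"

lemma word_value_closed: "word_value gs \<in> carrier R"
  by (induction gs) (simp_all add: \<rho>)

lemma word_value_append: "word_value (gs @ hs) = word_value gs \<otimes> word_value hs"
  by (induction gs) (simp_all add: \<rho> word_value_closed m_assoc del: foldr_append)

lemma free_eval_superset:
  assumes "finite W" "Poly_Mapping.keys f \<subseteq> W"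
  shows "free_eval R \<kappa> \<rho> f = (\<Oplus>w\<in>W. \<kappa> (Poly_Mapping.lookup f w) \<otimes> word_value (letters w))"
  unfolding free_eval_def using assms
  by (intro add.finprod_mono_neutral_cong_left)
     (auto simp: in_keys_iff scal_zero word_value_closed Pi_def)

lemma free_eval_closed: "free_eval R \<kappa> \<rho> f \<in> carrier R"
  unfolding free_eval_def by (intro finsum_closed) (auto simp: word_value_closed)

lemma free_eval_monomial:
  "free_eval R \<kappa> \<rho> (Poly_Mapping.single w c) = \<kappa> c \<otimes> word_value (letters w)"
  using free_eval_superset[of "{w}" "Poly_Mapping.single w c"] by (simp add: word_value_closed)

lemma free_eval_add: "free_eval R \<kappa> \<rho> (f + g) = free_eval R \<kappa> \<rho> f \<oplus> free_eval R \<kappa> \<rho> g"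
proof -
  let ?W = "Poly_Mapping.keys f \<union> Poly_Mapping.keys g"
  have "free_eval R \<kappa> \<rho> (f + g) =
      (\<Oplus>w\<in>?W. \<kappa> (Poly_Mapping.lookup f w) \<otimes> word_value (letters w) \<oplus>
        \<kappa> (Poly_Mapping.lookup g w) \<otimes> word_value (letters w))"
    using free_eval_superset[of ?W "f + g"] keys_add[of f g]
    by (simp add: lookup_add scal_add l_distr word_value_closed)
  also have "\<dots> = free_eval R \<kappa> \<rho> f \<oplus> free_eval R \<kappa> \<rho> g"
    by (simp add: finsum_addf word_value_closed Pi_def free_eval_superset[of ?W])
  finally show ?thesis .
qed

lemma free_eval_mult: "free_eval R \<kappa> \<rho> (f * g) = free_eval R \<kappa> \<rho> f \<otimes> free_eval R \<kappa> \<rho> g"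
proof (induction f rule: free_algebra_induct)
  case (monomial w c)
  show ?case
  proof (induction g rule: free_algebra_induct)
    case (monomial v d)
    let ?w = "word_value (letters w)" and ?v = "word_value (letters v)"
    have "(\<kappa> c \<otimes> ?w) \<otimes> (\<kappa> d \<otimes> ?v) = \<kappa> (c * d) \<otimes> (?w \<otimes> ?v)"
      using scal_lcomm[of ?w ?v d] by (simp add: word_value_closed scal_mult m_assoc)
    then show ?case
      by (simp add: mult_single free_eval_monomial plus_word_def word_value_append
          del: foldr_append)
  next
    case (add g h)
    then show ?case by (simp add: distrib_left free_eval_add r_distr free_eval_closed)
  qed
next
  case (add f g)
  then show ?case by (simp add: distrib_right free_eval_add l_distr free_eval_closed)
qed

lemma free_eval_scal: "free_eval R \<kappa> \<rho> (scal c) = \<kappa> c"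
  by (simp add: scal_def free_eval_monomial)

lemma free_eval_gen: "free_eval R \<kappa> \<rho> (gen g) = \<rho> g"
  by (simp add: gen_def free_eval_monomial scal_one \<rho>)

lemma free_eval_hom: "free_eval R \<kappa> \<rho> \<in> ring_hom ring_of_type_algebra R"
  by (rule ring_hom_memI)
     (simp_all add: ring_of_type_algebra_simps free_eval_closed free_eval_add free_eval_mult
        free_eval_scal scal_one flip: scal_simps(1))

end
end

text \<open>
  For locating the image of a homomorphism: a free algebra is generated, as a ring, by its scalars
  and its generators.
\<close>

lemma free_algebra_hom_in_subring:
  fixes \<theta> :: "('g, 'k::ring_1) free_algebra \<Rightarrow> 'a"
  assumes \<theta>: "\<theta> \<in> ring_hom ring_of_type_algebra R" and "subring T R"
    and "\<And>c. \<theta> (scal c) \<in> T" "\<And>g. \<theta> (gen g) \<in> T"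
  shows "\<theta> f \<in> T"
proof (induction f rule: free_algebra_induct)
  case (monomial w c)
  have "\<theta> (prod_list (map gen gs)) \<in> T" for gs
    using ring_hom_one[OF \<theta>] ring_hom_mult[OF \<theta>] assms(2,4)
    by (induction gs) (simp_all add: ring_of_type_algebra_simps subringE)
  then show ?case
    using ring_hom_mult[OF \<theta>] assms(2,3)
    by (cases w) (simp add: ring_of_type_algebra_simps subringE monomial_eq_prod)
next
  case (add f g)
  then show ?case
    using ring_hom_add[OF \<theta>] assms(2) by (simp add: ring_of_type_algebra_simps subringE)
qed

lemma ideal_relation_ideal: "ideal (relation_ideal S) ring_of_type_algebra"
  unfolding relation_ideal_def
  by (rule ring.genideal_ideal[OF ring_type_algebra]) (simp add: ring_of_type_algebra_simps)

lemma ring_presented_algebra: "ring (presented_algebra S)"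
  unfolding presented_algebra_def by (rule ideal.quotient_is_ring[OF ideal_relation_ideal])

lemma presented_class_hom:
  "presented_class S \<in> ring_hom ring_of_type_algebra (presented_algebra S)"
  using ideal.rcos_ring_hom[OF ideal_relation_ideal, of S]
  by (simp add: presented_algebra_def presented_class_def[abs_def])

lemma carrier_presented_algebra: "carrier (presented_algebra S) = range (presented_class S)"
  by (auto simp: presented_algebra_def FactRing_def A_RCOSETS_def' presented_class_def
      ring_of_type_algebra_simps)

lemma presented_class_relation:
  assumes "r \<in> S" shows "presented_class S r = \<zero>\<^bsub>presented_algebra S\<^esub>"
proof -
  have "r \<in> relation_ideal S"
    using assms ring.genideal_self[OF ring_type_algebra, of S]
    by (auto simp: relation_ideal_def ring_of_type_algebra_simps)
  then have "relation_ideal S +>\<^bsub>ring_of_type_algebra\<^esub> r = relation_ideal S"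
    by (intro abelian_group.a_coset_join2 ring.is_abelian_group[OF ring_type_algebra]
         additive_subgroup.a_subgroup[OF ideal.axioms(1)[OF ideal_relation_ideal]])
       (simp add: ring_of_type_algebra_simps)
  then show ?thesis
    by (simp add: presented_class_def presented_algebra_def FactRing_def)
qed

text \<open>The kernel of \<open>\<theta>\<close> is one of the ideals whose intersection is the relation ideal.\<close>

lemma relation_ideal_eval:
  assumes \<theta>: "\<theta> \<in> ring_hom ring_of_type_algebra R" and "ring R"
    and rels: "\<And>r. r \<in> S \<Longrightarrow> \<theta> r = \<zero>\<^bsub>R\<^esub>"
    and f: "f \<in> relation_ideal S"
  shows "\<theta> f = \<zero>\<^bsub>R\<^esub>"
proof -
  interpret h: ring_hom_ring ring_of_type_algebra R \<theta>
    by (rule ring_hom_ringI2[OF ring_type_algebra assms(2) \<theta>])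
  have "relation_ideal S \<subseteq> a_kernel ring_of_type_algebra R \<theta>"
    unfolding relation_ideal_def
  proof (rule ring.genideal_minimal[OF ring_type_algebra h.kernel_is_ideal], rule subsetI)
    fix r assume "r \<in> S"
    then show "r \<in> a_kernel ring_of_type_algebra R \<theta>"
      unfolding a_kernel_def' ring_of_type_algebra_simps(1) using rels by simp
  qed
  then show ?thesis
    using f unfolding a_kernel_def' by blast
qed

text \<open>
  Representatives of one class differ by an element of the relation ideal, so \<open>\<theta>\<close> is constant on a
  class.
\<close>

lemma presented_class_eval:
  fixes \<theta> :: "('g, 'k::ring_1) free_algebra \<Rightarrow> 'a"
  assumes \<theta>: "\<theta> \<in> ring_hom ring_of_type_algebra R" and "ring R"
    and rels: "\<And>r. r \<in> S \<Longrightarrow> \<theta> r = \<zero>\<^bsub>R\<^esub>"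
  shows "the_elem (\<theta> ` presented_class S f) = \<theta> f"
proof -
  interpret R: ring R by fact
  let ?J = "relation_ideal S"
  have eq: "\<theta> (g + f) = \<theta> f" if "g \<in> ?J" for g
  proof -
    have "\<theta> (g + f) = \<theta> g \<oplus>\<^bsub>R\<^esub> \<theta> f"
      using ring_hom_add[OF \<theta>, of g f] by (simp add: ring_of_type_algebra_simps)
    also have "\<theta> g = \<zero>\<^bsub>R\<^esub>"
      by (rule relation_ideal_eval[OF \<theta> assms(2) rels that])
    also have "\<zero>\<^bsub>R\<^esub> \<oplus>\<^bsub>R\<^esub> \<theta> f = \<theta> f"
      using ring_hom_closed[OF \<theta>, of f] by (simp add: ring_of_type_algebra_simps)
    finally show ?thesis .
  qed
  have zero: "0 \<in> ?J"
    using additive_subgroup.zero_closed[OF ideal.axioms(1)[OF ideal_relation_ideal]]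
    by (simp only: ring_of_type_algebra_simps)
  have "presented_class S f = (\<lambda>g. g + f) ` ?J"
    by (auto simp: presented_class_def a_r_coset_def' ring_of_type_algebra_simps)
  then have "\<theta> ` presented_class S f = (\<lambda>g. \<theta> (g + f)) ` ?J"
    by (simp only: image_image)
  also have "\<dots> = (\<lambda>g. \<theta> f) ` ?J"
    by (intro image_cong refl eq)
  also have "\<dots> = {\<theta> f}"
    using zero by blast
  finally have "\<theta> ` presented_class S f = {\<theta> f}" .
  then show ?thesis by simp
qed

section \<open>Polynomial identities of algebras finite over a central subring\<close>

definition standard_polynomial :: "nat \<Rightarrow> (nat, 'k::ring_1) free_algebra" where
  "standard_polynomial n =
     (\<Sum>\<pi> | \<pi> permutes {..<n}. Poly_Mapping.single (Word (map \<pi> [0..<n])) (of_int (sign \<pi>)))"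

text \<open>
  Only the identity permutation contributes to the coefficient of the word \<open>0 1 \<dots> (n - 1)\<close>.
\<close>

lemma standard_polynomial_nonzero:
  "standard_polynomial n \<noteq> (0 :: (nat, 'k::ring_1) free_algebra)"
proof -
  have "\<pi> = id" if "\<pi> permutes {..<n}" "map \<pi> [0..<n] = [0..<n]" for \<pi> :: "nat \<Rightarrow> nat"
  proof
    fix i
    show "\<pi> i = id i"
    proof (cases "i < n")
      case True
      then have "map \<pi> [0..<n] ! i = i" using that(2) by simp
      then show ?thesis using True by simp
    next
      case False
      then show ?thesis using that(1) by (simp add: permutes_not_in)
    qed
  qed
  then have "Poly_Mapping.lookup (standard_polynomial n :: (nat, 'k) free_algebra) (Word [0..<n]) =
      (\<Sum>\<pi> | \<pi> permutes {..<n}. if \<pi> = id then 1 else 0)"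
    unfolding standard_polynomial_def lookup_sum
    by (intro sum.cong) (auto simp: lookup_single when_def)
  also have "\<dots> = 1"
    by (simp add: finite_permutations permutes_id)
  finally show ?thesis by force
qed

context central_algebra
begin

lemma word_value_cong:
  "(\<And>g. g \<in> set gs \<Longrightarrow> \<rho> g = \<rho>' g) \<Longrightarrow> word_value \<rho> gs = word_value \<rho>' gs"
  by (induction gs) simp_all

lemma word_value_add:
  assumes "\<And>i. h i \<in> carrier R" "a \<in> carrier R" "b \<in> carrier R" "distinct gs" "m \<in> set gs"
  shows "word_value (h(m := a \<oplus> b)) gs = word_value (h(m := a)) gs \<oplus> word_value (h(m := b)) gs"
  using assms(4,5)
proof (induction gs)
  case (Cons g gs)
  have closed: "word_value (h(m := c)) gs \<in> carrier R" if "c \<in> carrier R" for c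
    by (rule word_value_closed) (simp add: assms that)
  show ?case
  proof (cases "g = m")
    case True
    then have "word_value (h(m := c)) gs = word_value h gs" for c
      using Cons.prems by (intro word_value_cong) auto
    then show ?thesis
      using True
      by (simp add: l_distr assms word_value_closed del: fun_upd_apply add: fun_upd_same)
  next
    case False
    then show ?thesis
      using Cons by (simp add: r_distr assms closed fun_upd_other del: fun_upd_apply)
  qed
qed simp

lemma word_value_smult:
  assumes "\<And>i. h i \<in> carrier R" "a \<in> carrier R" "z \<in> carrier R"
    and central: "\<And>r. r \<in> carrier R \<Longrightarrow> r \<otimes> z = z \<otimes> r"
    and "distinct gs" "m \<in> set gs"
  shows "word_value (h(m := z \<otimes> a)) gs = z \<otimes> word_value (h(m := a)) gs"
  using assms(5,6)
proof (induction gs)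
  case (Cons g gs)
  have closed: "word_value (h(m := c)) gs \<in> carrier R" if "c \<in> carrier R" for c
    by (rule word_value_closed) (simp add: assms that)
  show ?case
  proof (cases "g = m")
    case True
    then have "word_value (h(m := c)) gs = word_value h gs" for c
      using Cons.prems by (intro word_value_cong) auto
    then show ?thesis
      using True
      by (simp add: m_assoc assms word_value_closed del: fun_upd_apply add: fun_upd_same)
  next
    case False
    have "h g \<otimes> (z \<otimes> b) = z \<otimes> (h g \<otimes> b)" if "b \<in> carrier R" for b
      using that assms(1,3) by (simp add: central flip: m_assoc)
    then show ?thesis
      using False Cons by (simp add: assms closed fun_upd_other del: fun_upd_apply)
  qed
qed simp

definition standard_value :: "nat \<Rightarrow> (nat \<Rightarrow> 'a) \<Rightarrow> 'a" where
  "standard_value n h =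
     (\<Oplus>\<pi>\<in>{\<pi>. \<pi> permutes {..<n}}. \<kappa> (of_int (sign \<pi>)) \<otimes> word_value h (map \<pi> [0..<n]))"

lemma free_eval_standard_polynomial:
  assumes "\<And>i. h i \<in> carrier R"
  shows "free_eval R \<kappa> h (standard_polynomial n) = standard_value n h"
proof -
  have "free_eval R \<kappa> h (\<Sum>\<pi>\<in>P. Poly_Mapping.single (Word (map \<pi> [0..<n])) (of_int (sign \<pi>))) =
      (\<Oplus>\<pi>\<in>P. \<kappa> (of_int (sign \<pi>)) \<otimes> word_value h (map \<pi> [0..<n]))" if "finite P" for P
    using that
  proof induction
    case empty
    show ?case by (simp add: free_eval_def)
  next
    case (insert \<pi> P)
    then show ?case
      by (simp add: free_eval_add[OF assms] free_eval_monomial[OF assms] word_value_closed[OF assms]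
          Pi_def del: foldr_map fun_upd_apply)
  qed
  then show ?thesis
    by (simp add: standard_polynomial_def standard_value_def finite_permutations
        del: foldr_map fun_upd_apply)
qed

lemma standard_value_closed:
  assumes "\<And>i. h i \<in> carrier R" shows "standard_value n h \<in> carrier R"
  unfolding standard_value_def
  by (intro finsum_closed) (simp add: word_value_closed[OF assms] del: foldr_map fun_upd_apply)

lemma permutation_word:
  assumes "\<pi> permutes {..<n}" "m < n"
  shows "distinct (map \<pi> [0..<n])" "m \<in> set (map \<pi> [0..<n])"
  using permutes_inj_on[OF assms(1)] permutes_image[OF assms(1)] assms(2)
  by (auto simp: distinct_map atLeast0LessThan)

lemma standard_value_add:
  assumes "\<And>i. h i \<in> carrier R" "a \<in> carrier R" "b \<in> carrier R" "m < n"
  shows "standard_value n (h(m := a \<oplus> b)) =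
    standard_value n (h(m := a)) \<oplus> standard_value n (h(m := b))"
proof -
  have closed: "word_value (h(m := c)) gs \<in> carrier R" if "c \<in> carrier R" for c gs
    by (rule word_value_closed) (simp add: assms that)
  have "standard_value n (h(m := a \<oplus> b)) =
    (\<Oplus>\<pi>\<in>{\<pi>. \<pi> permutes {..<n}}.
      \<kappa> (of_int (sign \<pi>)) \<otimes> word_value (h(m := a)) (map \<pi> [0..<n]) \<oplus>
      \<kappa> (of_int (sign \<pi>)) \<otimes> word_value (h(m := b)) (map \<pi> [0..<n]))"
    unfolding standard_value_def
    by (intro finsum_cong')
       (simp_all add: word_value_add[OF assms(1-3) permutation_word[OF _ assms(4)]] r_distr closed
         assms Pi_def del: foldr_map fun_upd_apply)
  then show ?thesis
    by (simp add: standard_value_def finsum_addf closed assms Pi_def del: foldr_map fun_upd_apply)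
qed

lemma standard_value_smult:
  assumes "\<And>i. h i \<in> carrier R" "a \<in> carrier R" "z \<in> carrier R"
    and central: "\<And>r. r \<in> carrier R \<Longrightarrow> r \<otimes> z = z \<otimes> r" and "m < n"
  shows "standard_value n (h(m := z \<otimes> a)) = z \<otimes> standard_value n (h(m := a))"
proof -
  have closed: "word_value (h(m := a)) gs \<in> carrier R" for gs
    by (rule word_value_closed) (simp add: assms)
  have "standard_value n (h(m := z \<otimes> a)) =
    (\<Oplus>\<pi>\<in>{\<pi>. \<pi> permutes {..<n}}.
      z \<otimes> (\<kappa> (of_int (sign \<pi>)) \<otimes> word_value (h(m := a)) (map \<pi> [0..<n])))"
    unfolding standard_value_def
    by (intro finsum_cong')
       (simp_all add: word_value_smult[OF assms(1-3) central permutation_word[OF _ assms(5)]]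
         scal_lcomm closed assms(3) Pi_def del: foldr_map fun_upd_apply)
  then show ?thesis
    by (simp add: standard_value_def finsum_rdistr closed assms finite_permutations Pi_def
        del: foldr_map fun_upd_apply)
qed

end

text \<open>
  Composing every permutation with the transposition of two positions that hold equal entries
  changes all signs and no product, so the value equals its own negative.
\<close>

lemma standard_value_alternating:
  fixes R (structure) and \<kappa> :: "'k::field_char_0 \<Rightarrow> 'a"
  assumes "central_algebra R \<kappa>"
    and h: "\<And>i. h i \<in> carrier R" and ij: "i < n" "j < n" "i \<noteq> j" "h i = h j"
  shows "central_algebra.standard_value R \<kappa> n h = \<zero>"
proof -
  interpret central_algebra R \<kappa> by fact
  let ?P = "{\<pi>. \<pi> permutes {..<n}}" and ?\<tau> = "transpose i j"
  let ?w = "\<lambda>\<pi>. word_value h (map \<pi> [0..<n])"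
  have \<tau>: "?\<tau> permutes {..<n}" using ij by (intro permutes_swap_id) auto
  have flip: "\<kappa> (of_int (sign (?\<tau> \<circ> \<pi>))) \<otimes> ?w (?\<tau> \<circ> \<pi>) = \<kappa> (- 1) \<otimes> (\<kappa> (of_int (sign \<pi>)) \<otimes> ?w \<pi>)"
    if "\<pi> permutes {..<n}" for \<pi>
  proof -
    have "h \<circ> ?\<tau> = h"
      using ij by (auto simp: fun_eq_iff transpose_def)
    then have "h (?\<tau> k) = h k" for k by (metis comp_apply)
    then have "?w (?\<tau> \<circ> \<pi>) = ?w \<pi>" by (simp add: foldr_map comp_def)
    moreover have "sign (?\<tau> \<circ> \<pi>) = - sign \<pi>"
      using that \<tau> ij by (simp add: sign_compose permutes_imp_permutation[of "{..<n}"] sign_swap_id)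
    then have "\<kappa> (of_int (sign (?\<tau> \<circ> \<pi>))) = \<kappa> (- 1) \<otimes> \<kappa> (of_int (sign \<pi>))"
      by (simp flip: scal_mult)
    ultimately show ?thesis
      by (simp add: m_assoc word_value_closed[OF h] del: foldr_map fun_upd_apply)
  qed
  have "standard_value n h = (\<Oplus>\<pi>\<in>?P. \<kappa> (of_int (sign (?\<tau> \<circ> \<pi>))) \<otimes> ?w (?\<tau> \<circ> \<pi>))"
  proof -
    have "(\<lambda>\<pi>. ?\<tau> \<circ> \<pi>) ` ?P = ?P"
      using image_compose_permutations_left[OF \<tau>] by (simp add: setcompr_eq_image)
    moreover have "inj_on (\<lambda>\<pi>. ?\<tau> \<circ> \<pi>) ?P"
      by (rule inj_onI) (metis comp_assoc id_comp transpose_comp_involutory)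
    ultimately show ?thesis
      unfolding standard_value_def
      using add.finprod_reindex[of "\<lambda>\<pi>. \<kappa> (of_int (sign \<pi>)) \<otimes> ?w \<pi>" "\<lambda>\<pi>. ?\<tau> \<circ> \<pi>" ?P]
      by (simp add: word_value_closed[OF h] Pi_def del: foldr_map fun_upd_apply)
  qed
  also have "\<dots> = (\<Oplus>\<pi>\<in>?P. \<kappa> (- 1) \<otimes> (\<kappa> (of_int (sign \<pi>)) \<otimes> ?w \<pi>))"
    by (intro finsum_cong')
       (simp_all add: flip word_value_closed[OF h] Pi_def del: foldr_map fun_upd_apply)
  also have "\<dots> = \<kappa> (- 1) \<otimes> standard_value n h"
    unfolding standard_value_def
    by (subst finsum_rdistr)
       (simp_all add: word_value_closed[OF h] finite_permutations Pi_def del: foldr_map fun_upd_apply)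
  finally have neg: "standard_value n h = \<kappa> (- 1) \<otimes> standard_value n h" .
  have cl: "standard_value n h \<in> carrier R" by (rule standard_value_closed[OF h])
  have "\<kappa> 2 \<otimes> standard_value n h = (\<kappa> 1 \<oplus> \<kappa> 1) \<otimes> standard_value n h"
    by (simp flip: scal_add)
  also have "\<dots> = standard_value n h \<oplus> \<kappa> (- 1) \<otimes> standard_value n h"
    using cl neg by (simp add: l_distr scal_one)
  also have "\<dots> = (\<kappa> 1 \<oplus> \<kappa> (- 1)) \<otimes> standard_value n h"
    using cl by (simp add: l_distr scal_one)
  also have "\<dots> = \<zero>"
    using cl by (simp add: scal_zero flip: scal_add)
  finally have "\<kappa> (1 / 2) \<otimes> (\<kappa> 2 \<otimes> standard_value n h) = \<zero>" by simp
  then show ?thesis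
    using cl by (simp add: scal_one flip: m_assoc scal_mult)
qed

text \<open>
  Coefficients are applied one at a time, so \<open>Z\<close> may consist of generators of the ring of
  coefficients only.
\<close>

inductive_set additive_span :: "('a, 'b) ring_scheme \<Rightarrow> 'a set \<Rightarrow> 'a set \<Rightarrow> 'a set"
  for R Z E where
    base: "e \<in> E \<Longrightarrow> e \<in> additive_span R Z E"
  | add: "a \<in> additive_span R Z E \<Longrightarrow> b \<in> additive_span R Z E \<Longrightarrow> a \<oplus>\<^bsub>R\<^esub> b \<in> additive_span R Z E"
  | smult: "z \<in> Z \<Longrightarrow> a \<in> additive_span R Z E \<Longrightarrow> z \<otimes>\<^bsub>R\<^esub> a \<in> additive_span R Z E"

text \<open>
  The standard polynomial in more variables than \<open>E\<close> has elements is additive and central-linear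
  in each argument. Expanding one argument after the other therefore reduces its vanishing to
  arguments from \<open>E\<close>, two of which coincide.
\<close>

theorem is_PI_algebra_if_finite_over_center:
  fixes R (structure) and \<kappa> :: "'k::field_char_0 \<Rightarrow> 'a"
  assumes "central_algebra R \<kappa>"
    and E: "finite E" "E \<subseteq> carrier R"
    and Z: "Z \<subseteq> carrier R" "\<And>z r. z \<in> Z \<Longrightarrow> r \<in> carrier R \<Longrightarrow> r \<otimes> z = z \<otimes> r"
    and span: "carrier R \<subseteq> additive_span R Z E"
  shows "is_PI_algebra R \<kappa>"
proof -
  interpret central_algebra R \<kappa> by fact
  define n where "n = Suc (card E)"
  have "standard_value n h = \<zero>"
    if "m \<le> n" "\<And>i. h i \<in> carrier R" "\<And>i. m \<le> i \<Longrightarrow> i < n \<Longrightarrow> h i \<in> E" for m h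
    using that
  proof (induction m arbitrary: h)
    case 0
    have "h ` {..<n} \<subseteq> E" using 0 by auto
    then have "\<not> inj_on h {..<n}"
      using card_inj_on_le[of h "{..<n}" E] E(1) by (auto simp: n_def)
    then obtain i j where "i < n" "j < n" "i \<noteq> j" "h i = h j"
      by (auto simp: inj_on_def)
    then show ?case
      by (intro standard_value_alternating[OF assms(1)] 0)
  next
    case (Suc m)
    then have m: "m < n" by simp
    have "a \<in> carrier R \<and> standard_value n (h(m := a)) = \<zero>" if "a \<in> additive_span R Z E" for a
      using that
    proof induction
      case (base e)
      moreover have "standard_value n (h(m := e)) = \<zero>"
        using Suc.prems base E(2) by (intro Suc.IH) auto
      ultimately show ?case using E(2) by blast
    next
      case (add a b)
      then show ?case using standard_value_add[of h a b m n] Suc.prems(2) m by (simp del: fun_upd_apply)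
    next
      case (smult z a)
      then show ?case using standard_value_smult[of h a z m n] Suc.prems(2) m Z(2)[OF smult(1)] Z(1)
        by (auto simp: subset_eq simp del: fun_upd_apply)
    qed
    then have "standard_value n (h(m := h m)) = \<zero>"
      using span Suc.prems(2) by blast
    then show ?case by simp
  qed
  from this[of n] have "free_eval R \<kappa> \<rho> (standard_polynomial n) = \<zero>" if "\<forall>i. \<rho> i \<in> carrier R" for \<rho>
    using that by (simp add: free_eval_standard_polynomial)
  then show ?thesis
    unfolding is_PI_algebra_def using standard_polynomial_nonzero by blast
qed

section \<open>Skew-commuting elements\<close>

context central_algebra
begin

definition scale :: "'k \<Rightarrow> 'a \<Rightarrow> 'a" (infixr "\<bullet>" 75) where
  "c \<bullet> a = \<kappa> c \<otimes> a"

lemma scale_closed [simp]: "a \<in> carrier R \<Longrightarrow> c \<bullet> a \<in> carrier R"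
  by (simp add: scale_def)

lemma scale_mult:
  assumes "a \<in> carrier R" "b \<in> carrier R"
  shows "(c \<bullet> a) \<otimes> b = c \<bullet> (a \<otimes> b)" "a \<otimes> (c \<bullet> b) = c \<bullet> (a \<otimes> b)"
  using assms by (simp_all add: scale_def scal_lcomm[OF assms] m_assoc)

lemma scale_scale: "a \<in> carrier R \<Longrightarrow> c \<bullet> d \<bullet> a = (c * d) \<bullet> a"
  by (simp add: scale_def scal_mult m_assoc)

lemma scale_add_right:
  "a \<in> carrier R \<Longrightarrow> b \<in> carrier R \<Longrightarrow> c \<bullet> (a \<oplus> b) = c \<bullet> a \<oplus> c \<bullet> b"
  by (simp add: scale_def r_distr)

lemma scale_add_left: "a \<in> carrier R \<Longrightarrow> (c + d) \<bullet> a = c \<bullet> a \<oplus> d \<bullet> a"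
  by (simp add: scale_def l_distr scal_add)

lemmas scale_assoc = scale_mult scale_scale
lemmas scale_distrib = scale_add_right scale_add_left

lemma scale_one_zero_neg:
  assumes "a \<in> carrier R" shows "1 \<bullet> a = a" "0 \<bullet> a = \<zero>" "(- c) \<bullet> a = \<ominus> (c \<bullet> a)"
  using assms by (simp_all add: scale_def scal_one scal_zero scal_minus l_minus)

lemma scale_zero [simp]: "c \<bullet> \<zero> = \<zero>"
  by (simp add: scale_def)

lemma scale_minus: "a \<in> carrier R \<Longrightarrow> c \<bullet> (\<ominus> a) = \<ominus> (c \<bullet> a)"
  by (simp add: scale_def r_minus)

lemma skew_commute_pow_right:
  assumes "a \<otimes> b = c \<bullet> (b \<otimes> a)" "a \<in> carrier R" "b \<in> carrier R"
  shows "a \<otimes> b [^] (n::nat) = (c ^ n) \<bullet> (b [^] n \<otimes> a)"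
proof (induction n)
  case (Suc n)
  have "a \<otimes> b [^] Suc n = (a \<otimes> b [^] n) \<otimes> b"
    using assms by (simp add: m_assoc)
  also have "\<dots> = (c ^ n) \<bullet> (b [^] n \<otimes> (a \<otimes> b))"
    using Suc assms(2,3) by (simp add: scale_assoc m_assoc)
  also have "\<dots> = (c ^ Suc n) \<bullet> (b [^] Suc n \<otimes> a)"
    using assms by (simp add: scale_assoc m_assoc mult.commute)
  finally show ?case .
qed (simp add: assms scale_one_zero_neg)

lemma skew_commute_pow_left:
  assumes "a \<otimes> b = c \<bullet> (b \<otimes> a)" "a \<in> carrier R" "b \<in> carrier R"
  shows "a [^] (n::nat) \<otimes> b = (c ^ n) \<bullet> (b \<otimes> a [^] n)"
proof (induction n)
  case (Suc n)
  have "a [^] Suc n \<otimes> b = a [^] n \<otimes> (a \<otimes> b)"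
    using assms by (simp add: m_assoc)
  also have "\<dots> = c \<bullet> ((a [^] n \<otimes> b) \<otimes> a)"
    using assms by (simp add: scale_assoc m_assoc)
  also have "\<dots> = (c ^ Suc n) \<bullet> (b \<otimes> a [^] Suc n)"
    using Suc assms(2,3) by (simp add: scale_assoc m_assoc)
  finally show ?case .
qed (simp add: assms scale_one_zero_neg)

lemma int_pow_units_of:
  assumes "b \<in> Units R" shows "b [^] (i::int) = b [^]\<^bsub>units_of R\<^esub> i"
proof -
  have "b [^] n \<in> Units R" for n :: nat using assms by (rule Units_pow_closed)
  then show ?thesis
    unfolding int_pow_def2 by (simp only: units_of_pow[OF assms] units_of_inv)
qed

lemma unit_int_pow_closed:
  assumes "b \<in> Units R" shows "b [^] (i::int) \<in> carrier R"
  using group.int_pow_closed[OF units_group, of b i] assms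
  unfolding int_pow_units_of[OF assms] units_of_carrier by (auto intro: Units_closed)

lemma unit_int_pow_add:
  assumes "b \<in> Units R" shows "b [^] (i + j :: int) = b [^] i \<otimes> b [^] j"
  unfolding int_pow_units_of[OF assms] using group.int_pow_mult[OF units_group, of b i j] assms
  by (simp only: units_of_carrier units_of_mult)

lemma unit_int_pow_1:
  assumes "b \<in> Units R" shows "b [^] (1::int) = b" "b [^] (-1::int) = inv b"
  using assms by (simp_all add: int_pow_def2 Units_closed)

lemma skew_commute_int_pow:
  assumes ab: "a \<otimes> b = c \<bullet> (b \<otimes> a)" and a: "a \<in> carrier R" and b: "b \<in> Units R" and c: "c \<noteq> 0"
  shows "a \<otimes> b [^] (i::int) = (c powi i) \<bullet> (b [^] i \<otimes> a)"
proof (induction i rule: int_induct[where k = 0])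
  case base
  then show ?case using a by (simp add: scale_one_zero_neg)
next
  case (step1 i)
  note [simp] = a Units_closed[OF b] unit_int_pow_closed[OF b]
  have "a \<otimes> b [^] (i + 1) = (a \<otimes> b [^] i) \<otimes> b"
    by (simp add: unit_int_pow_add[OF b] unit_int_pow_1[OF b] m_assoc)
  also have "\<dots> = (c powi i) \<bullet> (b [^] i \<otimes> (a \<otimes> b))"
    by (simp add: step1 scale_assoc m_assoc)
  also have "\<dots> = (c powi (i + 1)) \<bullet> (b [^] (i + 1) \<otimes> a)"
    using c
    by (simp add: ab scale_assoc m_assoc unit_int_pow_add[OF b] unit_int_pow_1[OF b] power_int_add)
  finally show ?case .
next
  case (step2 i)
  note [simp] = a Units_closed[OF b] Units_inv_closed[OF b] unit_int_pow_closed[OF b]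
    Units_l_inv[OF b] Units_r_inv[OF b]
  have inv_b: "a \<otimes> inv b = inverse c \<bullet> (inv b \<otimes> a)"
  proof -
    have "c \<bullet> (a \<otimes> inv b) = inv b \<otimes> (c \<bullet> (b \<otimes> a)) \<otimes> inv b"
      by (simp add: scale_assoc flip: m_assoc)
    also have "\<dots> = inv b \<otimes> a"
      unfolding ab[symmetric] by (simp add: m_assoc)
    finally have "inverse c \<bullet> c \<bullet> (a \<otimes> inv b) = inverse c \<bullet> (inv b \<otimes> a)" by simp
    then show ?thesis using c by (simp add: scale_assoc scale_one_zero_neg)
  qed
  have b_pow: "b [^] (i - 1) = b [^] i \<otimes> inv b"
    using unit_int_pow_add[OF b, of i "- 1"] by (simp add: unit_int_pow_1[OF b])
  have "a \<otimes> b [^] (i - 1) = (a \<otimes> b [^] i) \<otimes> inv b"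
    by (simp add: b_pow m_assoc)
  also have "\<dots> = (c powi i) \<bullet> (b [^] i \<otimes> (a \<otimes> inv b))"
    by (simp add: step2 scale_assoc m_assoc)
  also have "\<dots> = (c powi (i - 1)) \<bullet> (b [^] (i - 1) \<otimes> a)"
    using c by (simp add: inv_b b_pow scale_assoc m_assoc power_int_diff divide_inverse)
  finally show ?case .
qed

lemma subring_centralizer:
  assumes "u \<in> carrier R"
  shows "subring {r \<in> carrier R. r \<otimes> u = u \<otimes> r} R"
proof (rule subringI)
  fix r r' assume "r \<in> {r \<in> carrier R. r \<otimes> u = u \<otimes> r}" "r' \<in> {r \<in> carrier R. r \<otimes> u = u \<otimes> r}"
  then have r: "r \<in> carrier R" "r' \<in> carrier R" "r \<otimes> u = u \<otimes> r" "r' \<otimes> u = u \<otimes> r'" by auto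
  have "r \<otimes> r' \<otimes> u = r \<otimes> (u \<otimes> r')" using r assms by (simp add: m_assoc)
  also have "\<dots> = (u \<otimes> r) \<otimes> r'" using r(1,2) assms by (simp add: r(3) flip: m_assoc)
  finally show "r \<otimes> r' \<in> {r \<in> carrier R. r \<otimes> u = u \<otimes> r}"
    using r assms by (simp add: m_assoc)
qed (use assms in \<open>auto simp: l_minus r_minus l_distr r_distr\<close>)

end

section \<open>The algebra \<open>H\<close>\<close>

text \<open>
  Elements of an arbitrary algebra that satisfy the relations of \<open>H\<close>: this applies both to the
  generators of \<open>H\<close> and to their images in \<open>Q\<close>.
\<close>

locale H_triple = central_algebra R \<kappa> for R (structure) and \<kappa> :: "'k::field \<Rightarrow> 'a" +
  fixes p q :: 'k and x y z :: 'a
  assumes p: "p \<noteq> 0" and q: "q \<noteq> 0"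
    and xyz [simp]: "x \<in> carrier R" "y \<in> carrier R" "z \<in> carrier R"
    and zx: "z \<otimes> x = inverse p \<bullet> (x \<otimes> z)"
    and zy: "z \<otimes> y = p \<bullet> (y \<otimes> z)"
    and yx: "y \<otimes> x = q \<bullet> (x \<otimes> y) \<oplus> z"
begin

text \<open>The coefficients \<open>(q\<^sup>n - p\<^sup>-\<^sup>n) / (q - p\<^sup>-\<^sup>1)\<close> in the form in which they arise.\<close>

fun qnum :: "nat \<Rightarrow> 'k" where
  "qnum 0 = 0"
| "qnum (Suc n) = q ^ n + inverse p * qnum n"

lemma qnum_closed_form: "qnum n * (q - inverse p) = q ^ n - inverse p ^ n"
proof (induction n)
  case (Suc n)
  have "qnum (Suc n) * (q - inverse p) =
      q ^ n * (q - inverse p) + inverse p * (qnum n * (q - inverse p))"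
    by (simp add: algebra_simps)
  also have "\<dots> = q ^ Suc n - inverse p ^ Suc n"
    unfolding Suc by (simp add: algebra_simps)
  finally show ?case .
qed simp

lemma yx_pow: "y \<otimes> x [^] n = (q ^ n) \<bullet> (x [^] n \<otimes> y) \<oplus> qnum n \<bullet> (x [^] (n - 1) \<otimes> z)"
proof (induction n)
  case (Suc n)
  have "y \<otimes> x [^] Suc n = (y \<otimes> x [^] n) \<otimes> x" by (simp add: m_assoc)
  also have "\<dots> = (q ^ n) \<bullet> (x [^] n \<otimes> (y \<otimes> x)) \<oplus> qnum n \<bullet> (x [^] (n - 1) \<otimes> (z \<otimes> x))"
    by (simp add: Suc l_distr scale_assoc m_assoc)
  also have "qnum n \<bullet> (x [^] (n - 1) \<otimes> (z \<otimes> x)) = (inverse p * qnum n) \<bullet> (x [^] n \<otimes> z)"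
    by (cases n) (simp_all add: zx scale_assoc scale_one_zero_neg m_assoc mult.commute)
  also have "x [^] n \<otimes> (y \<otimes> x) = q \<bullet> (x [^] Suc n \<otimes> y) \<oplus> x [^] n \<otimes> z"
    by (simp add: yx r_distr scale_assoc m_assoc)
  finally show ?case
    by (simp add: scale_distrib scale_assoc mult.commute a_assoc)
qed (simp add: scale_one_zero_neg)

lemma y_pow_x: "y [^] n \<otimes> x = (q ^ n) \<bullet> (x \<otimes> y [^] n) \<oplus> qnum n \<bullet> (z \<otimes> y [^] (n - 1))"
proof (induction n)
  case (Suc n)
  have comm: "y [^] Suc n = y \<otimes> y [^] n" by (rule nat_pow_Suc2) simp
  have yz: "y \<otimes> z = inverse p \<bullet> (z \<otimes> y)"
    using p by (simp add: zy scale_assoc scale_one_zero_neg)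
  have yz': "y \<otimes> (z \<otimes> y [^] k) = inverse p \<bullet> (z \<otimes> y [^] Suc k)" for k
  proof -
    have "y \<otimes> (z \<otimes> y [^] k) = (y \<otimes> z) \<otimes> y [^] k" by (simp add: m_assoc)
    also have "\<dots> = inverse p \<bullet> (z \<otimes> y [^] Suc k)"
      unfolding yz nat_pow_Suc2[OF xyz(2)] by (simp add: scale_assoc m_assoc)
    finally show ?thesis .
  qed
  have "y [^] Suc n \<otimes> x = y \<otimes> (y [^] n \<otimes> x)" unfolding comm by (simp add: m_assoc)
  also have "\<dots> = (q ^ n) \<bullet> ((y \<otimes> x) \<otimes> y [^] n) \<oplus> qnum n \<bullet> (y \<otimes> (z \<otimes> y [^] (n - 1)))"
    by (simp add: Suc r_distr scale_assoc m_assoc)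
  also have "qnum n \<bullet> (y \<otimes> (z \<otimes> y [^] (n - 1))) = (inverse p * qnum n) \<bullet> (z \<otimes> y [^] n)"
    by (cases n) (simp_all add: yz' scale_assoc scale_one_zero_neg mult.commute)
  also have "(y \<otimes> x) \<otimes> y [^] n = q \<bullet> (x \<otimes> y [^] Suc n) \<oplus> z \<otimes> y [^] n"
    unfolding comm by (simp add: yx l_distr scale_assoc m_assoc)
  finally show ?case
    by (simp add: scale_distrib scale_assoc mult.commute a_assoc)
qed (simp add: scale_one_zero_neg)

definition generated :: bool where
  "generated \<longleftrightarrow> (\<forall>T. subring T R \<longrightarrow> range \<kappa> \<union> {x, y, z} \<subseteq> T \<longrightarrow> carrier R \<subseteq> T)"

lemma central_if_commutes_with_generators:
  assumes generated "u \<in> carrier R" "x \<otimes> u = u \<otimes> x" "y \<otimes> u = u \<otimes> y" "z \<otimes> u = u \<otimes> z"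
    and "r \<in> carrier R"
  shows "r \<otimes> u = u \<otimes> r"
proof -
  have "range \<kappa> \<union> {x, y, z} \<subseteq> {r \<in> carrier R. r \<otimes> u = u \<otimes> r}"
    using assms(2-5) by (auto simp: scal_central)
  then show ?thesis
    using assms(1,6) subring_centralizer[OF assms(2)] unfolding generated_def by blast
qed

text \<open>
  With \<open>p\<^sup>N = q\<^sup>N = 1\<close> the coefficient \<open>(q\<^sup>N - p\<^sup>-\<^sup>N) / (q - p\<^sup>-\<^sup>1)\<close> in the formulas for \<open>y x\<^sup>N\<close>
  and \<open>y\<^sup>N x\<close> vanishes, and \<open>x\<^sup>N\<close>, \<open>y\<^sup>N\<close>, \<open>z\<^sup>N\<close> become central. The span of the monomials \<open>x\<^sup>i y\<^sup>j
  z\<^sup>k\<close> with exponents below \<open>N\<close> is then stable under left multiplication by \<open>x\<close>, \<open>y\<close> and \<open>z\<close>.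
\<close>

lemma finite_over_center_at_roots_of_unity:
  assumes gen: generated and N: "N > 0" "p ^ N = 1" "q ^ N = 1" and pq: "p * q \<noteq> 1"
  defines "Z \<equiv> range \<kappa> \<union> {x [^] N, y [^] N, z [^] N}"
    and "E \<equiv> (\<lambda>(i, j, k). x [^] i \<otimes> (y [^] j \<otimes> z [^] k)) ` ({..<N} \<times> {..<N} \<times> {..<N})"
  shows "\<And>u r. u \<in> Z \<Longrightarrow> r \<in> carrier R \<Longrightarrow> r \<otimes> u = u \<otimes> r"
    and "carrier R \<subseteq> additive_span R Z E"
proof -
  have pN: "inverse p ^ N = 1" using N(2) by (simp add: power_inverse)
  have "q \<noteq> inverse p" using pq p by auto
  then have qN: "qnum N = 0" using qnum_closed_form[of N] N(3) pN by simp
  have zxN: "z \<otimes> x [^] N = x [^] N \<otimes> z"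
    using skew_commute_pow_right[OF zx, of N] by (simp add: pN scale_one_zero_neg)
  have zyN: "z \<otimes> y [^] N = y [^] N \<otimes> z"
    using skew_commute_pow_right[OF zy, of N] by (simp add: N scale_one_zero_neg)
  have zNx: "x \<otimes> z [^] N = z [^] N \<otimes> x"
    using skew_commute_pow_left[OF zx, of N] by (simp add: pN scale_one_zero_neg)
  have zNy: "y \<otimes> z [^] N = z [^] N \<otimes> y"
    using skew_commute_pow_left[OF zy, of N] by (simp add: N scale_one_zero_neg)
  have yxN: "y \<otimes> x [^] N = x [^] N \<otimes> y"
    using yx_pow[of N] by (simp add: qN N scale_one_zero_neg)
  have yNx: "x \<otimes> y [^] N = y [^] N \<otimes> x"
    using y_pow_x[of N] by (simp add: qN N scale_one_zero_neg)
  have self: "a \<otimes> a [^] N = a [^] N \<otimes> a" if "a \<in> carrier R" for a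
    using nat_pow_comm[of a 1 N] that by simp
  show Z: "r \<otimes> u = u \<otimes> r" if "u \<in> Z" "r \<in> carrier R" for u r
  proof -
    from that(1) consider "u \<in> range \<kappa>" | "u = x [^] N" | "u = y [^] N" | "u = z [^] N"
      unfolding Z_def by blast
    then show ?thesis
    proof cases
      case 1 then show ?thesis using that(2) by (auto simp: scal_central)
    next
      case 2 show ?thesis unfolding 2
        by (rule central_if_commutes_with_generators[OF gen _ _ _ _ that(2)])
           (simp_all only: self xyz yxN zxN nat_pow_closed)
    next
      case 3 show ?thesis unfolding 3
        by (rule central_if_commutes_with_generators[OF gen _ _ _ _ that(2)])
           (simp_all only: self xyz yNx zyN nat_pow_closed)
    next
      case 4 show ?thesis unfolding 4
        by (rule central_if_commutes_with_generators[OF gen _ _ _ _ that(2)])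
           (simp_all only: self xyz zNx zNy nat_pow_closed)
    qed
  qed
  let ?W = "additive_span R Z E"
  let ?m = "\<lambda>(i::nat) (j::nat) (k::nat). x [^] i \<otimes> (y [^] j \<otimes> z [^] k)"
  have Zc: "Z \<subseteq> carrier R" by (auto simp: Z_def)
  have E_sub: "E \<subseteq> carrier R" by (auto simp: E_def)
  have Wc: "w \<in> carrier R" if "w \<in> ?W" for w
    using that by induction (use E_sub Zc in auto)
  have scale: "c \<bullet> w \<in> ?W" if "w \<in> ?W" for c w
    unfolding scale_def by (rule additive_span.smult[OF _ that]) (simp add: Z_def)
  have minus: "\<ominus> w \<in> ?W" if "w \<in> ?W" for w
    using scale[OF that, of "- 1"] Wc[OF that] by (simp add: scale_one_zero_neg)
  have reduce: "a [^] n = a [^] N \<otimes> a [^] (n - N)" if "n \<ge> N" "a \<in> carrier R" for a and n :: nat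
    using that by (simp add: nat_pow_mult)
  have mono: "?m i j k \<in> ?W" for i j k :: nat
  proof (induction "i + j + k" arbitrary: i j k rule: less_induct)
    case less
    consider "i < N" "j < N" "k < N" | "i \<ge> N" | "j \<ge> N" | "k \<ge> N" by linarith
    then show ?case
    proof cases
      case 1
      then have "?m i j k \<in> E" unfolding E_def by (intro image_eqI[of _ _ "(i, j, k)"]) auto
      then show ?thesis by (rule additive_span.base)
    next
      case 2
      then have "?m i j k = x [^] N \<otimes> ?m (i - N) j k"
        by (simp add: reduce[of i] m_assoc)
      also have "\<dots> \<in> ?W"
        using 2 N by (intro additive_span.smult less) (auto simp: Z_def)
      finally show ?thesis .
    next
      case 3
      have "x [^] i \<otimes> y [^] N = y [^] N \<otimes> x [^] i" by (rule Z) (auto simp: Z_def)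
      then have "?m i j k = y [^] N \<otimes> ?m i (j - N) k"
        using 3 by (simp add: reduce[of j] flip: m_assoc)
      also have "\<dots> \<in> ?W"
        using 3 N by (intro additive_span.smult less) (auto simp: Z_def)
      finally show ?thesis .
    next
      case 4
      have "(x [^] i \<otimes> y [^] j) \<otimes> z [^] N = z [^] N \<otimes> (x [^] i \<otimes> y [^] j)"
        by (rule Z) (auto simp: Z_def)
      then have "?m i j k = z [^] N \<otimes> ?m i j (k - N)"
        using 4 by (simp add: reduce[of k] flip: m_assoc)
      also have "\<dots> \<in> ?W"
        using 4 N by (intro additive_span.smult less) (auto simp: Z_def)
      finally show ?thesis .
    qed
  qed
  have x_mono: "x \<otimes> ?m i j k = ?m (Suc i) j k" for i j k
    unfolding nat_pow_Suc2[OF xyz(1)] by (simp add: m_assoc)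
  have z_y: "z \<otimes> (y [^] j \<otimes> z [^] k) = (p ^ j) \<bullet> (y [^] j \<otimes> z [^] Suc k)" for j k
  proof -
    have "z \<otimes> (y [^] j \<otimes> z [^] k) = (z \<otimes> y [^] j) \<otimes> z [^] k" by (simp add: m_assoc)
    also have "\<dots> = (p ^ j) \<bullet> (y [^] j \<otimes> z [^] Suc k)"
      unfolding skew_commute_pow_right[OF zy xyz(3,2)] nat_pow_Suc2[OF xyz(3)]
      by (simp add: scale_assoc m_assoc)
    finally show ?thesis .
  qed
  have z_mono: "z \<otimes> ?m i j k = (inverse p ^ i * p ^ j) \<bullet> ?m i j (Suc k)" for i j k
  proof -
    have "z \<otimes> ?m i j k = (z \<otimes> x [^] i) \<otimes> (y [^] j \<otimes> z [^] k)" by (simp add: m_assoc)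
    also have "\<dots> = (inverse p ^ i) \<bullet> (x [^] i \<otimes> (z \<otimes> (y [^] j \<otimes> z [^] k)))"
      by (simp add: skew_commute_pow_right[OF zx] scale_assoc m_assoc)
    finally show ?thesis by (simp add: z_y scale_assoc)
  qed
  have y_mono: "y \<otimes> ?m i j k = (q ^ i) \<bullet> ?m i (Suc j) k \<oplus> (qnum i * p ^ j) \<bullet> ?m (i - 1) j (Suc k)"
    for i j k
  proof -
    have "y \<otimes> ?m i j k = (y \<otimes> x [^] i) \<otimes> (y [^] j \<otimes> z [^] k)" by (simp add: m_assoc)
    also have "\<dots> = (q ^ i) \<bullet> (x [^] i \<otimes> (y \<otimes> (y [^] j \<otimes> z [^] k))) \<oplus>
        qnum i \<bullet> (x [^] (i - 1) \<otimes> (z \<otimes> (y [^] j \<otimes> z [^] k)))"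
      by (simp add: yx_pow l_distr scale_assoc m_assoc)
    also have "y \<otimes> (y [^] j \<otimes> z [^] k) = y [^] Suc j \<otimes> z [^] k"
      unfolding nat_pow_Suc2[OF xyz(2)] by (simp add: m_assoc)
    finally show ?thesis by (simp add: z_y scale_assoc)
  qed
  have left: "g \<otimes> w \<in> ?W"
    if g: "g \<in> carrier R" "\<And>i j k. g \<otimes> ?m i j k \<in> ?W" and "w \<in> ?W" for g w
    using that(3)
  proof induction
    case (base e)
    then show ?case using g(2) by (auto simp: E_def)
  next
    case (add a b)
    then show ?case using g(1) by (simp add: r_distr Wc additive_span.add)
  next
    case (smult u a)
    have "g \<otimes> (u \<otimes> a) = u \<otimes> (g \<otimes> a)"
      using Z[OF smult(1) g(1)] smult(1,2) g(1) Wc Zc by (simp add: subset_eq flip: m_assoc)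
    then show ?case using smult by (simp add: additive_span.smult)
  qed
  have xyzW: "x \<otimes> w \<in> ?W" "y \<otimes> w \<in> ?W" "z \<otimes> w \<in> ?W" if "w \<in> ?W" for w
  proof -
    show "x \<otimes> w \<in> ?W"
      by (rule left[OF xyz(1) _ that]) (simp only: x_mono mono)
    show "y \<otimes> w \<in> ?W"
      by (rule left[OF xyz(2) _ that]) (unfold y_mono, intro additive_span.add scale mono)
    show "z \<otimes> w \<in> ?W"
      by (rule left[OF xyz(3) _ that]) (unfold z_mono, intro scale mono)
  qed
  let ?T = "{r \<in> carrier R. \<forall>w\<in>?W. r \<otimes> w \<in> ?W}"
  have "subring ?T R"
    by (rule subringI) (auto simp: Wc minus l_minus l_distr m_assoc intro: additive_span.add)
  moreover have "range \<kappa> \<union> {x, y, z} \<subseteq> ?T"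
    using xyzW scale by (auto simp: scale_def)
  ultimately have "carrier R \<subseteq> ?T"
    using gen unfolding generated_def by blast
  moreover have "\<one> \<in> ?W" using mono[of 0 0 0] by simp
  ultimately show "carrier R \<subseteq> ?W" by fastforce
qed

text \<open>
  This is \<open>\<omega>\<inverse>\<close> in \<open>\<A>\<^bsub>p,q\<^esub>\<close>, and \<open>\<Omega>\<close> is the product of its \<open>r\<close>-th power with \<open>z\<^sup>s\<close>.
\<close>

definition commutator_element :: 'a where
  "commutator_element = y \<otimes> x \<ominus> inverse p \<bullet> (x \<otimes> y)"

lemma commutator_element_closed [simp]: "commutator_element \<in> carrier R"
  by (simp add: commutator_element_def)

lemma commutator_element_eq: "commutator_element = (q - inverse p) \<bullet> (x \<otimes> y) \<oplus> z"
proof -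
  have "commutator_element = (q \<bullet> (x \<otimes> y) \<oplus> z) \<oplus> (- inverse p) \<bullet> (x \<otimes> y)"
    by (simp add: commutator_element_def a_minus_def yx scale_one_zero_neg)
  also have "\<dots> = (q \<bullet> (x \<otimes> y) \<oplus> (- inverse p) \<bullet> (x \<otimes> y)) \<oplus> z"
    by (simp add: a_ac)
  finally show ?thesis by (simp flip: scale_distrib)
qed

lemma commutator_element_x: "commutator_element \<otimes> x = q \<bullet> (x \<otimes> commutator_element)"
proof -
  let ?d = "q - inverse p"
  have "commutator_element \<otimes> x = ?d \<bullet> (x \<otimes> (y \<otimes> x)) \<oplus> z \<otimes> x"
    by (simp add: commutator_element_eq l_distr scale_assoc m_assoc)
  also have "\<dots> = (q * ?d) \<bullet> (x \<otimes> (x \<otimes> y)) \<oplus> (?d \<bullet> (x \<otimes> z) \<oplus> inverse p \<bullet> (x \<otimes> z))"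
    by (simp add: yx zx r_distr scale_assoc scale_distrib a_assoc mult.commute)
  also have "?d \<bullet> (x \<otimes> z) \<oplus> inverse p \<bullet> (x \<otimes> z) = q \<bullet> (x \<otimes> z)"
    by (simp flip: scale_distrib)
  finally show ?thesis
    by (simp add: commutator_element_eq r_distr scale_assoc scale_distrib)
qed

lemma commutator_element_y: "commutator_element \<otimes> y = inverse q \<bullet> (y \<otimes> commutator_element)"
proof -
  let ?d = "q - inverse p"
  have yz: "y \<otimes> z = inverse p \<bullet> (z \<otimes> y)"
    using p by (simp add: zy scale_assoc scale_one_zero_neg)
  have "y \<otimes> commutator_element = ?d \<bullet> ((y \<otimes> x) \<otimes> y) \<oplus> y \<otimes> z"
    by (simp add: commutator_element_eq r_distr scale_assoc m_assoc)
  also have "\<dots> = (q * ?d) \<bullet> (x \<otimes> (y \<otimes> y)) \<oplus> (?d \<bullet> (z \<otimes> y) \<oplus> inverse p \<bullet> (z \<otimes> y))"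
    by (simp add: yx yz l_distr scale_assoc scale_distrib a_assoc m_assoc mult.commute)
  also have "?d \<bullet> (z \<otimes> y) \<oplus> inverse p \<bullet> (z \<otimes> y) = q \<bullet> (z \<otimes> y)"
    by (simp flip: scale_distrib)
  finally have "y \<otimes> commutator_element = q \<bullet> (commutator_element \<otimes> y)"
    by (simp add: commutator_element_eq l_distr scale_assoc scale_distrib m_assoc)
  then show ?thesis using q by (simp add: scale_assoc scale_one_zero_neg)
qed

lemma commutator_element_z: "commutator_element \<otimes> z = z \<otimes> commutator_element"
proof -
  have "z \<otimes> (x \<otimes> y) = (z \<otimes> x) \<otimes> y"
    by (simp add: m_assoc)
  also have "\<dots> = inverse p \<bullet> (x \<otimes> (z \<otimes> y))"
    unfolding zx by (simp add: scale_assoc m_assoc)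
  also have "\<dots> = x \<otimes> (y \<otimes> z)"
    using p by (simp add: zy scale_assoc scale_one_zero_neg)
  finally show ?thesis
    by (simp add: commutator_element_eq l_distr r_distr scale_assoc m_assoc)
qed

text \<open>
  Moving \<open>x\<close> through \<open>\<Omega>\<close> costs the factor \<open>q\<^sup>r p\<^sup>-\<^sup>s\<close>, and moving \<open>y\<close> costs its inverse.
\<close>

lemma Omega_central:
  assumes gen: generated and rs: "q ^ r = p ^ s" and "a \<in> carrier R"
  shows "a \<otimes> (commutator_element [^] r \<otimes> z [^] s) = (commutator_element [^] r \<otimes> z [^] s) \<otimes> a"
proof -
  let ?v = "commutator_element"
  have *: "(?v [^] r \<otimes> z [^] s) \<otimes> b = (c ^ r * d ^ s) \<bullet> (b \<otimes> (?v [^] r \<otimes> z [^] s))"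
    if "b \<in> carrier R" "?v \<otimes> b = c \<bullet> (b \<otimes> ?v)" "z \<otimes> b = d \<bullet> (b \<otimes> z)" for b c d
  proof -
    have "(?v [^] r \<otimes> z [^] s) \<otimes> b = ?v [^] r \<otimes> (z [^] s \<otimes> b)"
      using that(1) by (simp add: m_assoc)
    also have "\<dots> = d ^ s \<bullet> ((?v [^] r \<otimes> b) \<otimes> z [^] s)"
      unfolding skew_commute_pow_left[OF that(3) xyz(3) that(1)]
      using that(1) by (simp add: m_assoc scale_assoc)
    also have "\<dots> = (c ^ r * d ^ s) \<bullet> (b \<otimes> (?v [^] r \<otimes> z [^] s))"
      unfolding skew_commute_pow_left[OF that(2) commutator_element_closed that(1)]
      using that(1) by (simp add: m_assoc scale_assoc mult.commute)
    finally show ?thesis .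
  qed
  let ?O = "?v [^] r \<otimes> z [^] s"
  have coeff: "q ^ r * inverse p ^ s = 1" "inverse q ^ r * p ^ s = 1"
    using p q rs by (simp_all add: power_inverse)
  have O: "?O \<in> carrier R" by simp
  have z1: "?v \<otimes> z = 1 \<bullet> (z \<otimes> ?v)" "z \<otimes> z = 1 \<bullet> (z \<otimes> z)"
    by (simp_all add: scale_one_zero_neg commutator_element_z)
  have "x \<otimes> ?O = ?O \<otimes> x"
    unfolding *[OF xyz(1) commutator_element_x zx] coeff using O by (simp add: scale_one_zero_neg)
  moreover have "y \<otimes> ?O = ?O \<otimes> y"
    unfolding *[OF xyz(2) commutator_element_y zy] coeff using O by (simp add: scale_one_zero_neg)
  moreover have "z \<otimes> ?O = ?O \<otimes> z"
    unfolding *[OF xyz(3) z1] using O by (simp add: scale_one_zero_neg)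
  ultimately show ?thesis
    by (intro central_if_commutes_with_generators[OF gen O _ _ _ assms(3)])
qed

end

section \<open>The two families of algebras and their quotient division rings\<close>

lemma central_algebra_free:
  "central_algebra ring_of_type_algebra (scal :: 'k::field \<Rightarrow> ('g, 'k) free_algebra)"
  unfolding central_algebra_def central_algebra_axioms_def ring_of_type_algebra_simps
  by (intro conjI allI impI ring_type_algebra UNIV_I scal_simps scal_times scal_commutes[symmetric])

lemma central_algebra_surj:
  assumes "central_algebra R \<kappa>" and S: "ring S" and \<theta>: "\<theta> \<in> ring_hom R S"
    and surj: "carrier S = \<theta> ` carrier R"
  shows "central_algebra S (\<lambda>c. \<theta> (\<kappa> c))"
proof -
  interpret R: central_algebra R \<kappa> by fact
  note hom = ring_hom_closed[OF \<theta>] ring_hom_add[OF \<theta>, symmetric]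
    ring_hom_mult[OF \<theta>, symmetric] ring_hom_one[OF \<theta>]
  have central: "r \<otimes>\<^bsub>S\<^esub> \<theta> (\<kappa> c) = \<theta> (\<kappa> c) \<otimes>\<^bsub>S\<^esub> r" if "r \<in> carrier S" for r c
  proof -
    obtain a where a: "a \<in> carrier R" "r = \<theta> a" using \<open>r \<in> carrier S\<close> surj by auto
    then show ?thesis by (simp add: hom R.scal_central[OF a(1)])
  qed
  show ?thesis
    unfolding central_algebra_def central_algebra_axioms_def
    by (intro conjI S allI impI central) (simp_all add: hom R.scal_add R.scal_mult R.scal_one)
qed

lemma central_algebra_presented:
  "central_algebra (presented_algebra S)
    (\<lambda>c. presented_class S (scal c :: ('g, 'k::field) free_algebra))"
  by (rule central_algebra_surj[OF central_algebra_free ring_presented_algebra presented_class_hom])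
     (simp add: carrier_presented_algebra ring_of_type_algebra_simps)

lemma (in ring) inv_commutes:
  assumes "s \<in> Units R" "c \<in> carrier R" "s \<otimes> c = c \<otimes> s"
  shows "inv s \<otimes> c = c \<otimes> inv s"
proof -
  note s = Units_closed[OF assms(1)] Units_inv_closed[OF assms(1)]
  have "inv s \<otimes> c = inv s \<otimes> (c \<otimes> s) \<otimes> inv s"
    using assms s by (simp add: m_assoc)
  also have "\<dots> = inv s \<otimes> s \<otimes> c \<otimes> inv s"
    using assms(2) s by (simp add: m_assoc flip: assms(3))
  also have "\<dots> = c \<otimes> inv s" using assms by simp
  finally show ?thesis .
qed

text \<open>
  Scalars stay central in the quotient division ring because every element of it is a fraction.
\<close>

lemma central_algebra_quotient_division_ring:
  assumes "central_algebra A \<kappa>" and Q: "quotient_division_ring A Q \<iota>"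
  shows "central_algebra Q (\<lambda>c. \<iota> (\<kappa> c))"
proof -
  interpret A: central_algebra A \<kappa> by fact
  interpret Q: ring Q using Q by (simp add: quotient_division_ring_def is_division_ring_def)
  have \<iota>: "\<iota> \<in> ring_hom A Q" and inj: "inj_on \<iota> (carrier A)"
    and units: "Units Q = carrier Q - {\<zero>\<^bsub>Q\<^esub>}"
    using Q by (simp_all add: quotient_division_ring_def is_division_ring_def)
  note hom = ring_hom_closed[OF \<iota>] ring_hom_add[OF \<iota>, symmetric]
    ring_hom_mult[OF \<iota>, symmetric] ring_hom_one[OF \<iota>]
  have zero: "\<iota> \<zero>\<^bsub>A\<^esub> = \<zero>\<^bsub>Q\<^esub>"
    using ring_hom_zero[OF \<iota> A.ring_axioms Q.ring_axioms] .
  have central: "r \<otimes>\<^bsub>Q\<^esub> \<iota> (\<kappa> c) = \<iota> (\<kappa> c) \<otimes>\<^bsub>Q\<^esub> r" if r: "r \<in> carrier Q" for r c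
  proof -
    obtain a s where as: "a \<in> carrier A" "s \<in> carrier A - {\<zero>\<^bsub>A\<^esub>}"
      "r = \<iota> a \<otimes>\<^bsub>Q\<^esub> inv\<^bsub>Q\<^esub> (\<iota> s)"
      using Q r unfolding quotient_division_ring_def by meson
    let ?c = "\<iota> (\<kappa> c)"
    have comm: "\<iota> b \<otimes>\<^bsub>Q\<^esub> ?c = ?c \<otimes>\<^bsub>Q\<^esub> \<iota> b" if "b \<in> carrier A" for b
      using that by (simp add: hom A.scal_central)
    have "\<iota> s \<noteq> \<zero>\<^bsub>Q\<^esub>"
      using inj as(2) zero A.zero_closed by (metis DiffD1 DiffD2 inj_onD insertI1)
    then have s: "\<iota> s \<in> Units Q" using as(2) by (simp add: units hom)
    have "r \<otimes>\<^bsub>Q\<^esub> ?c = \<iota> a \<otimes>\<^bsub>Q\<^esub> (inv\<^bsub>Q\<^esub> (\<iota> s) \<otimes>\<^bsub>Q\<^esub> ?c)"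
      using as s by (simp add: Q.m_assoc ring_hom_closed[OF \<iota>])
    also have "\<dots> = \<iota> a \<otimes>\<^bsub>Q\<^esub> ?c \<otimes>\<^bsub>Q\<^esub> inv\<^bsub>Q\<^esub> (\<iota> s)"
      using Q.inv_commutes[OF s _ comm] as s by (simp add: Q.m_assoc ring_hom_closed[OF \<iota>])
    also have "\<dots> = ?c \<otimes>\<^bsub>Q\<^esub> r"
      unfolding comm[OF as(1)] using as s by (simp add: Q.m_assoc ring_hom_closed[OF \<iota>])
    finally show ?thesis .
  qed
  show ?thesis
    unfolding central_algebra_def central_algebra_axioms_def
    by (intro conjI Q.ring_axioms allI impI central)
       (simp_all add: hom A.scal_add A.scal_mult A.scal_one)
qed

context
  fixes R (structure) and \<kappa> and \<theta> :: "('g, 'k::field) free_algebra \<Rightarrow> 'a"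
  assumes R: "central_algebra R \<kappa>" and \<theta>: "\<theta> \<in> ring_hom ring_of_type_algebra R"
    and \<kappa>: "\<kappa> = (\<lambda>c. \<theta> (scal c))"
begin

interpretation central_algebra R \<kappa> by (rule R)

lemma free_hom_simps:
  "\<theta> f \<in> carrier R" "\<theta> (f + g) = \<theta> f \<oplus> \<theta> g" "\<theta> (f * g) = \<theta> f \<otimes> \<theta> g" "\<theta> 1 = \<one>"
  "\<theta> (scal c) = \<kappa> c"
  using ring_hom_closed[OF \<theta>, of f] ring_hom_add[OF \<theta>, of f g] ring_hom_mult[OF \<theta>, of f g]
    ring_hom_one[OF \<theta>]
  by (simp_all only: ring_of_type_algebra_simps UNIV_I \<kappa>)

lemma free_hom_diff: "\<theta> (f - g) = \<theta> f \<ominus> \<theta> g"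
proof -
  have "\<theta> f = \<theta> (f - g) \<oplus> \<theta> g" by (simp flip: free_hom_simps)
  then show ?thesis
    by (simp add: a_minus_def a_assoc free_hom_simps r_neg)
qed

lemma free_hom_power: "\<theta> (f ^ n) = \<theta> f [^] n"
  by (induction n) (simp_all add: free_hom_simps power_Suc2 del: power_Suc)

lemma free_hom_relation: "\<theta> (f - g) = \<zero> \<Longrightarrow> \<theta> f = \<theta> g"
  by (simp add: free_hom_diff free_hom_simps)

lemma H_triple_of_relations:
  assumes "p \<noteq> 0" "q \<noteq> 0"
    and "\<theta> (h * f - scal (inverse p) * f * h) = \<zero>"
    and "\<theta> (h * g - scal p * g * h) = \<zero>"
    and "\<theta> (g * f - scal q * f * g - h) = \<zero>"
  shows "H_triple R \<kappa> p q (\<theta> f) (\<theta> g) (\<theta> h)"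
proof -
  have "\<theta> (g * f - (scal q * f * g + h)) = \<zero>" using assms(5) by (simp add: diff_diff_add)
  from free_hom_relation[OF assms(3)] free_hom_relation[OF assms(4)] free_hom_relation[OF this]
  show ?thesis
    by unfold_locales (simp_all add: assms(1,2) free_hom_simps scale_def m_assoc)
qed

lemma commutator_element_image:
  assumes "H_triple R \<kappa> p q (\<theta> f) (\<theta> g) (\<theta> h)"
  shows "H_triple.commutator_element R \<kappa> p (\<theta> f) (\<theta> g) =
    \<theta> (g * f - scal (inverse p) * f * g)"
proof -
  interpret H_triple R \<kappa> p q "\<theta> f" "\<theta> g" "\<theta> h" by fact
  show ?thesis
    by (simp add: commutator_element_def free_hom_diff free_hom_simps scale_def m_assoc)
qed

end

lemma ideal_central_multiples:
  fixes R (structure)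
  assumes "ring R" "c \<in> carrier R" and central: "\<And>r. r \<in> carrier R \<Longrightarrow> r \<otimes> c = c \<otimes> r"
  shows "ideal (c <# carrier R) R"
proof -
  interpret ring R by fact
  have set: "c <# carrier R = (\<lambda>h. c \<otimes> h) ` carrier R" by (auto simp: l_coset_def)
  show ?thesis
  proof (rule idealI)
    show "subgroup (c <# carrier R) (add_monoid R)"
    proof (rule add.subgroupI)
      show "c <# carrier R \<subseteq> carrier R" "c <# carrier R \<noteq> {}"
        using assms(2) zero_closed by (auto simp: set)
      show "\<ominus> a \<in> c <# carrier R" if "a \<in> c <# carrier R" for a
        using that assms(2) unfolding set by (auto simp: image_iff) (metis a_inv_closed r_minus)
      show "a \<oplus> b \<in> c <# carrier R" if "a \<in> c <# carrier R" "b \<in> c <# carrier R" for a b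
        using that assms(2) unfolding set by (auto simp: image_iff) (metis add.m_closed r_distr)
    qed
    fix a r assume "a \<in> c <# carrier R" and r: "r \<in> carrier R"
    then obtain h where h: "h \<in> carrier R" "a = c \<otimes> h" by (auto simp: set)
    have "r \<otimes> a = c \<otimes> (r \<otimes> h)"
      using h r assms(2) by (simp add: central flip: m_assoc)
    then show "r \<otimes> a \<in> c <# carrier R" using h r by (auto simp: set)
    have "a \<otimes> r = c \<otimes> (h \<otimes> r)" using h r assms(2) by (simp add: m_assoc)
    then show "a \<otimes> r \<in> c <# carrier R" using h r by (auto simp: set)
  qed (rule assms(1))
qed

lemma
  assumes "p \<noteq> 0" "q \<noteq> 0"
  shows H_triple_H_alg: "H_triple (H_alg p q) (\<lambda>c. H_class p q (scal c)) p q
      (H_class p q (gen HX)) (H_class p q (gen HY)) (H_class p q (gen HZ))"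
    and generated_H_alg: "H_triple.generated (H_alg p q) (\<lambda>c. H_class p q (scal c))
      (H_class p q (gen HX)) (H_class p q (gen HY)) (H_class p q (gen HZ))"
proof -
  note hom = presented_class_hom[of "H_rels p q", folded H_alg_def H_class_def]
  have rel: "H_class p q r = \<zero>\<^bsub>H_alg p q\<^esub>" if "r \<in> H_rels p q" for r
    using presented_class_relation[OF that] by (simp add: H_alg_def H_class_def)
  have central: "central_algebra (H_alg p q) (\<lambda>c. H_class p q (scal c))"
    using central_algebra_presented[of "H_rels p q"] by (simp add: H_alg_def H_class_def)
  show *: "H_triple (H_alg p q) (\<lambda>c. H_class p q (scal c)) p q
      (H_class p q (gen HX)) (H_class p q (gen HY)) (H_class p q (gen HZ))"
    by (rule H_triple_of_relations[OF central hom refl assms]; rule rel; simp add: H_rels_def)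
  interpret H_triple "H_alg p q" "\<lambda>c. H_class p q (scal c)" p q
    "H_class p q (gen HX)" "H_class p q (gen HY)" "H_class p q (gen HZ)" by (rule *)
  have "carrier (H_alg p q) \<subseteq> T"
    if "subring T (H_alg p q)" "range (\<lambda>c. H_class p q (scal c)) \<union>
      {H_class p q (gen HX), H_class p q (gen HY), H_class p q (gen HZ)} \<subseteq> T" for T
  proof -
    have gens: "H_class p q (gen g) \<in> T" for g using that(2) by (cases g) auto
    have "H_class p q f \<in> T" for f
      by (rule free_algebra_hom_in_subring[OF hom that(1)]) (use that(2) gens in auto)
    then show ?thesis
      by (auto simp: H_alg_def H_class_def carrier_presented_algebra)
  qed
  then show generated unfolding generated_def by blast
qed

lemma H_alg_PI_at_roots_of_unity:
  fixes p q :: "'k::field_char_0"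
  assumes pq: "p \<noteq> 0" "q \<noteq> 0" and "N > 0" "p ^ N = 1" "q ^ N = 1" "p * q \<noteq> 1"
  shows "is_PI_algebra (H_alg p q) (\<lambda>c. H_class p q (scal c))"
proof -
  interpret H: H_triple "H_alg p q" "\<lambda>c. H_class p q (scal c)" p q
    "H_class p q (gen HX)" "H_class p q (gen HY)" "H_class p q (gen HZ)"
    by (rule H_triple_H_alg[OF pq])
  note * = H.finite_over_center_at_roots_of_unity[OF generated_H_alg[OF pq] assms(3-)]
  show ?thesis
    by (rule is_PI_algebra_if_finite_over_center[OF H.central_algebra_axioms _ _ _ *(1) *(2)]) auto
qed

text \<open>
  If \<open>(pq)\<^sup>n = 1\<close> and \<open>q\<^sup>r = p\<^sup>s\<close>, then \<open>p\<close> and \<open>q\<close> are roots of unity: \<open>p\<^bsup>n(r+s)\<^esup> = (pq)\<^bsup>nr\<^esup> =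
  1\<close>, and likewise for \<open>q\<close>. In that case \<open>H\<close> satisfies a polynomial identity.
\<close>

lemma product_not_root_of_unity:
  fixes p q :: "'k::field_char_0"
  assumes "p \<noteq> 0" "q \<noteq> 0"
    and "independent_case p q Q \<kappa> x y z \<or> dependent_case p q Q \<kappa> x y z" and "n > 0"
  shows "(p * q) ^ n \<noteq> 1"
proof
  assume n: "(p * q) ^ n = 1"
  from assms(3) show False
  proof
    assume "independent_case p q Q \<kappa> x y z"
    then have ind: "q powi a \<noteq> p powi b" if "(a, b) \<noteq> (0, 0)" for a b
      using that by (simp add: independent_case_def)
    have "q ^ n = inverse (p ^ n)"
      using n assms(1) by (simp add: power_mult_distrib field_simps)
    then have "q powi int n = p powi (- int n)"
      by (simp add: power_int_minus)
    then show False using ind[of "int n" "- int n"] assms(4) by simp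
  next
    assume "dependent_case p q Q \<kappa> x y z"
    then obtain r s where rs: "r > 0" "q ^ r = p ^ s" "p * q \<noteq> 1"
      and not_PI: "\<not> is_PI_algebra (H_alg p q) (\<lambda>c. H_class p q (scal c))"
      unfolding dependent_case_def by blast
    have "p ^ (n * (r + s)) = (p ^ n) ^ r * (p ^ s) ^ n"
      by (simp add: power_add power_mult[symmetric] algebra_simps)
    also have "\<dots> = ((p * q) ^ n) ^ r"
      by (simp add: power_mult_distrib power_mult[symmetric] mult.commute flip: rs(2))
    finally have p: "p ^ (n * (r + s)) = 1" by (simp add: n)
    have "q ^ (n * (r + s)) = (q ^ r) ^ n * (q ^ n) ^ s"
      by (simp add: power_add power_mult[symmetric] algebra_simps)
    also have "\<dots> = ((p * q) ^ n) ^ s"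
      by (simp add: power_mult_distrib power_mult[symmetric] mult.commute rs(2))
    finally have q: "q ^ (n * (r + s)) = 1" by (simp add: n)
    show False
      using H_alg_PI_at_roots_of_unity[OF assms(1,2) _ p q rs(3)] not_PI rs(1) assms(4) by simp
  qed
qed

text \<open>
  Here \<open>z\<close> and \<open>yx - p\<inverse>xy = \<omega>\<inverse>\<close> are units of \<open>\<A>\<^bsub>p,q\<^esub>\<close>.
\<close>

lemma
  assumes pq: "p \<noteq> 0" "q \<noteq> 0" and indep: "independent_case p q Q \<kappa> x y z"
  shows independent_case_division: "is_division_ring Q"
    and independent_case_triple: "H_triple Q \<kappa> p q x y z"
    and independent_case_nonzero: "z \<noteq> \<zero>\<^bsub>Q\<^esub>" "H_triple.commutator_element Q \<kappa> p x y \<noteq> \<zero>\<^bsub>Q\<^esub>"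
proof -
  from indep obtain \<iota> where \<iota>: "quotient_division_ring (A_alg p q) Q \<iota>"
    and \<kappa>: "\<kappa> = (\<lambda>c. \<iota> (A_class p q (scal c)))"
    and xyz: "x = \<iota> (A_class p q (gen AX))" "y = \<iota> (A_class p q (gen AY))"
      "z = \<iota> (A_class p q (gen AZ))"
    unfolding independent_case_def by blast
  define \<theta> where "\<theta> = \<iota> \<circ> A_class p q"
  note A_hom = presented_class_hom[of "A_rels p q", folded A_alg_def A_class_def]
  have hom: "\<theta> \<in> ring_hom ring_of_type_algebra Q"
    unfolding \<theta>_def by (rule ring_hom_trans[OF A_hom]) (use \<iota> in \<open>simp add: quotient_division_ring_def\<close>)
  have central: "central_algebra Q \<kappa>"
    unfolding \<kappa> by (rule central_algebra_quotient_division_ring[OF _ \<iota>])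
      (use central_algebra_presented[of "A_rels p q"] in \<open>simp add: A_alg_def A_class_def\<close>)
  have \<kappa>\<theta>: "\<kappa> = (\<lambda>c. \<theta> (scal c))" by (simp add: \<kappa> \<theta>_def)
  show div: "is_division_ring Q" using \<iota> by (simp add: quotient_division_ring_def)
  interpret Q: central_algebra Q \<kappa> by (rule central)
  have "\<iota> \<zero>\<^bsub>A_alg p q\<^esub> = \<zero>\<^bsub>Q\<^esub>"
    using \<iota> by (intro ring_hom_zero Q.ring_axioms) (auto simp: quotient_division_ring_def)
  then have rel: "\<theta> r = \<zero>\<^bsub>Q\<^esub>" if "r \<in> A_rels p q" for r
    using presented_class_relation[OF that] by (simp add: \<theta>_def A_alg_def A_class_def)
  have xyz': "x = \<theta> (gen AX)" "y = \<theta> (gen AY)" "z = \<theta> (gen AZ)"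
    by (simp_all add: xyz \<theta>_def)
  show triple: "H_triple Q \<kappa> p q x y z"
    unfolding xyz' by (rule H_triple_of_relations[OF central hom \<kappa>\<theta> pq]) (simp_all add: rel A_rels_def)
  note simps = free_hom_simps[OF central hom \<kappa>\<theta>] and eqI = free_hom_relation[OF central hom \<kappa>\<theta>]
  have one: "\<one>\<^bsub>Q\<^esub> \<noteq> \<zero>\<^bsub>Q\<^esub>"
    using div Q.Units_one_closed by (auto simp: is_division_ring_def)
  have "\<theta> (gen AZ * gen AZinv) = \<theta> 1" "\<theta> (gen AW * gen AWinv) = \<theta> 1"
    by (rule eqI, simp add: rel A_rels_def)+
  then have inv: "\<theta> (gen AZ) \<otimes>\<^bsub>Q\<^esub> \<theta> (gen AZinv) = \<one>\<^bsub>Q\<^esub>" "\<theta> (gen AW) \<otimes>\<^bsub>Q\<^esub> \<theta> (gen AWinv) = \<one>\<^bsub>Q\<^esub>"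
    by (simp_all add: simps)
  show "z \<noteq> \<zero>\<^bsub>Q\<^esub>"
    using inv(1) one by (auto simp: xyz' simps)
  have "\<theta> (gen AY * gen AX - scal (inverse p) * gen AX * gen AY) = \<theta> (gen AWinv)"
    by (rule eqI) (simp add: rel A_rels_def)
  then show "H_triple.commutator_element Q \<kappa> p x y \<noteq> \<zero>\<^bsub>Q\<^esub>"
    using inv(2) one commutator_element_image[OF central hom \<kappa>\<theta>] triple
    by (auto simp: xyz' simps)
qed

text \<open>
  Centrality of \<open>\<Omega>\<close> makes \<open>(\<Omega> - 1)H\<close> a two-sided ideal, so that \<open>A\<^sub>p(r,s)\<close> is a ring and \<open>H\<close> maps
  to it. There \<open>(yx - p\<inverse>xy)\<^sup>r z\<^sup>s = 1\<close> with positive exponents, hence neither factor vanishes.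
\<close>

lemma
  assumes pq: "p \<noteq> 0" "q \<noteq> 0" and dep: "dependent_case p q Q \<kappa> x y z"
  shows dependent_case_division: "is_division_ring Q"
    and dependent_case_triple: "H_triple Q \<kappa> p q x y z"
    and dependent_case_nonzero: "z \<noteq> \<zero>\<^bsub>Q\<^esub>" "H_triple.commutator_element Q \<kappa> p x y \<noteq> \<zero>\<^bsub>Q\<^esub>"
proof -
  from dep obtain r s \<iota> where rs: "r > 0" "s > 0" "q ^ r = p ^ s"
    and \<iota>: "quotient_division_ring (Ars_alg p q r s) Q \<iota>"
    and \<kappa>: "\<kappa> = (\<lambda>c. \<iota> (Ars_class p q r s (scal c)))"
    and xyz: "x = \<iota> (Ars_class p q r s (gen HX))" "y = \<iota> (Ars_class p q r s (gen HY))"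
      "z = \<iota> (Ars_class p q r s (gen HZ))"
    unfolding dependent_case_def by blast
  let ?H = "H_alg p q" and ?J = "Omega_ideal p q r s"
  let ?h = "H_class p q"
  interpret H: H_triple ?H "\<lambda>c. ?h (scal c)" p q "?h (gen HX)" "?h (gen HY)" "?h (gen HZ)"
    by (rule H_triple_H_alg[OF pq])
  note H_hom = presented_class_hom[of "H_rels p q", folded H_alg_def H_class_def]
  let ?V = "gen HY * gen HX - scal (inverse p) * gen HX * gen HY"
  have Omega: "Omega p q r s = H.commutator_element [^]\<^bsub>?H\<^esub> r \<otimes>\<^bsub>?H\<^esub> ?h (gen HZ) [^]\<^bsub>?H\<^esub> s"
    unfolding Omega_def
    by (simp add: commutator_element_image[OF H.central_algebra_axioms H_hom refl H.H_triple_axioms]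
        free_hom_power[OF H.central_algebra_axioms H_hom refl]
        free_hom_simps(1-4)[OF H.central_algebra_axioms H_hom refl])
  have Omega_closed: "Omega p q r s \<in> carrier ?H" by (simp add: Omega)
  have ideal: "ideal ?J ?H"
    unfolding Omega_ideal_def
  proof (rule ideal_central_multiples[OF H.ring_axioms])
    fix a assume "a \<in> carrier ?H"
    then show "a \<otimes>\<^bsub>?H\<^esub> (Omega p q r s \<ominus>\<^bsub>?H\<^esub> \<one>\<^bsub>?H\<^esub>) = (Omega p q r s \<ominus>\<^bsub>?H\<^esub> \<one>\<^bsub>?H\<^esub>) \<otimes>\<^bsub>?H\<^esub> a"
      using H.Omega_central[OF generated_H_alg[OF pq] rs(3), of a] Omega_closed
      by (simp add: a_minus_def H.l_distr H.r_distr H.l_minus H.r_minus flip: Omega)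
  qed (simp add: Omega_closed)
  have J_hom: "(+>\<^bsub>?H\<^esub>) ?J \<in> ring_hom ?H (Ars_alg p q r s)"
    unfolding Ars_alg_def by (rule ideal.rcos_ring_hom[OF ideal])
  have \<iota>_hom: "\<iota> \<in> ring_hom (Ars_alg p q r s) Q"
    using \<iota> by (simp add: quotient_division_ring_def)
  have ring_Ars: "ring (Ars_alg p q r s)"
    unfolding Ars_alg_def by (rule ideal.quotient_is_ring[OF ideal])
  have central: "central_algebra Q \<kappa>"
    unfolding \<kappa> Ars_class_def
    by (rule central_algebra_quotient_division_ring[OF
          central_algebra_surj[OF H.central_algebra_axioms ring_Ars J_hom] \<iota>])
       (auto simp: Ars_alg_def FactRing_def A_RCOSETS_def')
  interpret Q: central_algebra Q \<kappa> by (rule central)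
  define \<psi> where "\<psi> = \<iota> \<circ> (+>\<^bsub>?H\<^esub>) ?J"
  have \<psi>: "\<psi> \<in> ring_hom ?H Q"
    unfolding \<psi>_def by (rule ring_hom_trans[OF J_hom \<iota>_hom])
  define \<theta> where "\<theta> = \<psi> \<circ> ?h"
  have hom: "\<theta> \<in> ring_hom ring_of_type_algebra Q"
    unfolding \<theta>_def by (rule ring_hom_trans[OF H_hom \<psi>])
  have \<kappa>\<theta>: "\<kappa> = (\<lambda>c. \<theta> (scal c))" by (simp add: \<kappa> \<theta>_def \<psi>_def Ars_class_def)
  have xyz': "x = \<theta> (gen HX)" "y = \<theta> (gen HY)" "z = \<theta> (gen HZ)"
    by (simp_all add: xyz \<theta>_def \<psi>_def Ars_class_def)
  have \<psi>_zero: "\<psi> \<zero>\<^bsub>?H\<^esub> = \<zero>\<^bsub>Q\<^esub>"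
    by (rule ring_hom_zero[OF \<psi> H.ring_axioms Q.ring_axioms])
  have rel: "\<theta> f = \<zero>\<^bsub>Q\<^esub>" if "f \<in> H_rels p q" for f
    using presented_class_relation[OF that] \<psi>_zero by (simp add: \<theta>_def H_alg_def H_class_def)
  show div: "is_division_ring Q" using \<iota> by (simp add: quotient_division_ring_def)
  show triple: "H_triple Q \<kappa> p q x y z"
    unfolding xyz' by (rule H_triple_of_relations[OF central hom \<kappa>\<theta> pq]) (simp_all add: rel H_rels_def)
  interpret T: H_triple Q \<kappa> p q x y z by (rule triple)
  have "Omega p q r s \<ominus>\<^bsub>?H\<^esub> \<one>\<^bsub>?H\<^esub> \<in> ?J"
    unfolding Omega_ideal_def l_coset_def using Omega_closed
    by (auto intro!: bexI[of _ "\<one>\<^bsub>?H\<^esub>"])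
  then have "?J +>\<^bsub>?H\<^esub> Omega p q r s = ?J +>\<^bsub>?H\<^esub> \<one>\<^bsub>?H\<^esub>"
    using ring.quotient_eq_iff_same_a_r_cos[OF H.ring_axioms ideal Omega_closed H.one_closed] by simp
  then have "\<psi> (Omega p q r s) = \<one>\<^bsub>Q\<^esub>"
    using ring_hom_one[OF \<psi>] by (simp add: \<psi>_def)
  moreover have "\<psi> (Omega p q r s) = \<theta> (?V ^ r * gen HZ ^ s)" by (simp add: \<theta>_def Omega_def)
  ultimately have one: "T.commutator_element [^]\<^bsub>Q\<^esub> r \<otimes>\<^bsub>Q\<^esub> z [^]\<^bsub>Q\<^esub> s = \<one>\<^bsub>Q\<^esub>"
    using commutator_element_image[OF central hom \<kappa>\<theta> triple[unfolded xyz']]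
    by (simp add: xyz' free_hom_power[OF central hom \<kappa>\<theta>] free_hom_simps[OF central hom \<kappa>\<theta>])
  have nontrivial: "\<one>\<^bsub>Q\<^esub> \<noteq> \<zero>\<^bsub>Q\<^esub>"
    using div Q.Units_one_closed by (auto simp: is_division_ring_def)
  have zero_pow: "\<zero>\<^bsub>Q\<^esub> [^]\<^bsub>Q\<^esub> n = \<zero>\<^bsub>Q\<^esub>" if "n > 0" for n :: nat
    using that Q.nat_pow_zero by simp
  show "z \<noteq> \<zero>\<^bsub>Q\<^esub>"
  proof
    assume "z = \<zero>\<^bsub>Q\<^esub>"
    then show False using one nontrivial zero_pow[OF rs(2)] T.commutator_element_closed by simp
  qed
  show "T.commutator_element \<noteq> \<zero>\<^bsub>Q\<^esub>"
  proof
    assume "T.commutator_element = \<zero>\<^bsub>Q\<^esub>"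
    then show False using one nontrivial zero_pow[OF rs(1)] by simp
  qed
qed

section \<open>Polynomials in one element of an algebra\<close>

context central_algebra
begin

text \<open>
  Evaluation by Horner's scheme. In the ring generated by a single element over central scalars
  the order of the factors is immaterial, so this is a ring homomorphism although \<open>R\<close> is not
  commutative.
\<close>

definition poly_value :: "'a \<Rightarrow> 'k poly \<Rightarrow> 'a" where
  "poly_value w f = fold_coeffs (\<lambda>c r. \<kappa> c \<oplus> w \<otimes> r) f \<zero>"

context
  fixes w assumes w [simp]: "w \<in> carrier R"
begin

lemma poly_value_0 [simp]: "poly_value w 0 = \<zero>"
  by (simp add: poly_value_def)

lemma poly_value_pCons: "poly_value w (pCons c f) = \<kappa> c \<oplus> w \<otimes> poly_value w f"
  by (cases "c = 0 \<and> f = 0") (auto simp: poly_value_def scal_zero)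

lemma poly_value_closed [simp]: "poly_value w f \<in> carrier R"
  by (induction f) (simp_all add: poly_value_pCons)

lemma poly_value_const: "poly_value w [:c:] = \<kappa> c"
  by (simp add: poly_value_pCons)

lemma poly_value_add: "poly_value w (f + g) = poly_value w f \<oplus> poly_value w g"
  by (induction f g rule: poly_induct2)
     (simp_all add: poly_value_pCons scal_add r_distr a_ac)

lemma poly_value_smult: "poly_value w (smult c f) = c \<bullet> poly_value w f"
proof (induction f)
  case (pCons a f)
  have "c \<bullet> \<kappa> a = \<kappa> (c * a)" by (simp add: scale_def scal_mult)
  with pCons show ?case by (simp add: poly_value_pCons scale_assoc scale_distrib)
qed simp

lemma poly_value_minus: "poly_value w (- f) = \<ominus> poly_value w f"
  using poly_value_smult[of "- 1" f] by (simp add: scale_one_zero_neg)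

lemma poly_value_mult: "poly_value w (f * g) = poly_value w f \<otimes> poly_value w g"
proof (induction f)
  case (pCons c f)
  then show ?case
    by (simp add: poly_value_pCons poly_value_add poly_value_smult scal_zero l_distr m_assoc scale_def)
qed simp

lemma poly_value_commutes: "w \<otimes> poly_value w f = poly_value w f \<otimes> w"
proof -
  have "poly_value w ([:0, 1:] * f) = poly_value w (f * [:0, 1:])" by (simp only: mult.commute)
  then show ?thesis
    unfolding poly_value_mult by (simp add: poly_value_pCons scal_zero scal_one)
qed

lemma poly_value_in_subring:
  assumes "subring T R" "range \<kappa> \<subseteq> T" "w \<in> T"
  shows "poly_value w f \<in> T"
proof (induction f)
  case 0
  then show ?case using subringE(2)[OF assms(1)] by simp
next
  case (pCons c f)
  have "\<kappa> c \<in> T" using assms(2) by auto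
  then show ?case
    using subringE(6,7)[OF assms(1)] assms(3) pCons.IH by (simp add: poly_value_pCons)
qed

lemma skew_commute_poly_value:
  assumes "w \<otimes> a = c \<bullet> (a \<otimes> w)" "a \<in> carrier R"
  shows "poly_value w f \<otimes> a = a \<otimes> poly_value w (pcompose f [:0, c:])"
proof (induction f)
  case (pCons d f)
  let ?g = "poly_value w (pcompose f [:0, c:])"
  have "poly_value w (pCons d f) \<otimes> a = \<kappa> d \<otimes> a \<oplus> w \<otimes> (poly_value w f \<otimes> a)"
    using assms(2) by (simp add: poly_value_pCons l_distr m_assoc)
  also have "w \<otimes> (poly_value w f \<otimes> a) = (w \<otimes> a) \<otimes> ?g"
    using assms(2) by (simp add: pCons m_assoc)
  also have "\<dots> = a \<otimes> (c \<bullet> (w \<otimes> ?g))"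
    using assms(2) unfolding assms(1) by (simp add: scale_assoc m_assoc)
  also have "\<kappa> d \<otimes> a = a \<otimes> \<kappa> d" using assms(2) by (simp add: scal_central)
  also have "a \<otimes> \<kappa> d \<oplus> a \<otimes> (c \<bullet> (w \<otimes> ?g)) = a \<otimes> poly_value w (pcompose (pCons d f) [:0, c:])"
    using assms(2)
    by (simp add: pcompose_pCons poly_value_add poly_value_pCons poly_value_smult poly_value_mult
        r_distr scal_zero scale_assoc)
  finally show ?case .
qed (simp add: assms)

text \<open>
  Over an algebraically closed field every non-zero polynomial splits into linear factors, so in a
  domain its value at a non-scalar is non-zero.
\<close>

lemma poly_value_nonzero:
  assumes closed: "\<And>f :: 'k poly. degree f > 0 \<Longrightarrow> \<exists>c. poly f c = 0"
    and domain: "\<And>a b. a \<in> carrier R \<Longrightarrow> b \<in> carrier R \<Longrightarrow> a \<otimes> b = \<zero> \<Longrightarrow> a = \<zero> \<or> b = \<zero>"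
    and "\<zero> \<noteq> \<one>" and nonscalar: "w \<notin> range \<kappa>" and "f \<noteq> 0"
  shows "poly_value w f \<noteq> \<zero>"
  using \<open>f \<noteq> 0\<close>
proof (induction "degree f" arbitrary: f)
  case 0
  then obtain c where "f = [:c:]" using degree_eq_zeroE by metis
  then show ?case using 0 scal_inj[OF assms(3)] by (simp add: poly_value_const)
next
  case (Suc n)
  then obtain c where "poly f c = 0" using closed[of f] by auto
  then obtain g where g: "f = [:- c, 1:] * g" by (auto simp: poly_eq_0_iff_dvd)
  have "g \<noteq> 0" using g Suc by auto
  then have "degree f = Suc (degree g)" unfolding g by (subst degree_mult_eq) auto
  then have "poly_value w g \<noteq> \<zero>" using Suc \<open>g \<noteq> 0\<close> by auto
  moreover have "poly_value w [:- c, 1:] \<noteq> \<zero>"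
  proof
    assume "poly_value w [:- c, 1:] = \<zero>"
    then have "\<ominus> \<kappa> c \<oplus> w = \<zero>" by (simp add: poly_value_pCons scal_minus scal_one)
    then have "w = \<kappa> c"
      by (metis a_comm a_inv_closed minus_equality minus_minus scal_closed w)
    then show False using nonscalar by blast
  qed
  ultimately show ?case
    unfolding g poly_value_mult using domain poly_value_closed by blast
qed

end

section \<open>Separating eigenvectors\<close>

lemma difference_cancel:
  assumes "a \<in> carrier R" "b \<in> carrier R" "c \<in> carrier R"
  shows "(a \<ominus> c) \<ominus> (b \<ominus> c) = a \<ominus> b" "(a \<oplus> b) \<ominus> a = b" "a \<ominus> (a \<ominus> b) = b"
proof -
  have "(a \<ominus> c) \<ominus> (b \<ominus> c) = (a \<ominus> b) \<oplus> (c \<oplus> \<ominus> c)"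
    using assms by (simp add: a_minus_def minus_add a_ac)
  then show "(a \<ominus> c) \<ominus> (b \<ominus> c) = a \<ominus> b" using assms by (simp add: r_neg)
  have "(a \<oplus> b) \<ominus> a = b \<oplus> (a \<oplus> \<ominus> a)"
    using assms by (simp add: a_minus_def a_ac)
  then show "(a \<oplus> b) \<ominus> a = b" using assms by (simp add: r_neg)
  have "a \<ominus> (a \<ominus> b) = b \<oplus> (a \<oplus> \<ominus> a)"
    using assms by (simp add: a_minus_def minus_add a_ac)
  then show "a \<ominus> (a \<ominus> b) = b" using assms by (simp add: r_neg)
qed

lemma finsum_in_additive_subgroup:
  assumes "additive_subgroup N R" "finite F" "\<And>i. i \<in> F \<Longrightarrow> v i \<in> N"
  shows "(\<Oplus>i\<in>F. v i) \<in> N"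
proof -
  interpret additive_subgroup N R by fact
  from assms(2,3) show ?thesis
  proof induction
    case (insert i F)
    then have "v \<in> F \<rightarrow> carrier R" "v i \<in> carrier R" using a_subset by auto
    then show ?case using insert by (simp add: a_closed)
  qed simp
qed

text \<open>
  The usual argument that eigenvectors for distinct eigenvalues are independent, applied to the
  operator \<open>v \<mapsto> w v s\<close> on the quotient by \<open>N\<close>; the two uses are \<open>s = w\<inverse>\<close> and \<open>s = 1\<close>.
\<close>

lemma eigencomponents_in_subspace:
  assumes N: "additive_subgroup N R" and scale_N: "\<And>c n. n \<in> N \<Longrightarrow> c \<bullet> n \<in> N"
    and w: "w \<in> carrier R" "s \<in> carrier R" "\<And>n. n \<in> N \<Longrightarrow> w \<otimes> n \<otimes> s \<in> N"
    and F: "finite F" "inj_on \<mu> F"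
    and v: "\<And>i. i \<in> F \<Longrightarrow> v i \<in> carrier R"
    and eigen: "\<And>i. i \<in> F \<Longrightarrow> w \<otimes> v i \<otimes> s \<ominus> \<mu> i \<bullet> v i \<in> N"
    and sum: "(\<Oplus>i\<in>F. v i) \<in> N"
  shows "\<forall>i\<in>F. v i \<in> N"
proof -
  interpret N: additive_subgroup N R by fact
  have diff: "a \<ominus> b \<in> N" if "a \<in> N" "b \<in> N" for a b
    using that by (simp add: a_minus_def)
  from F v eigen sum show ?thesis
  proof (induction F arbitrary: v)
    case (insert j F)
    let ?T = "\<lambda>a. w \<otimes> a \<otimes> s \<ominus> \<mu> j \<bullet> a"
    let ?d = "\<lambda>i. \<mu> i - \<mu> j"
    note insert_prems_eigen = insert.prems(3)
    have vc: "v j \<in> carrier R" "v \<in> F \<rightarrow> carrier R" "\<And>i. i \<in> F \<Longrightarrow> v i \<in> carrier R"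
      using insert.prems(2) by auto
    have T_add: "?T (a \<oplus> b) = ?T a \<oplus> ?T b" if "a \<in> carrier R" "b \<in> carrier R" for a b
      using that w by (simp add: a_minus_def l_distr r_distr scale_distrib minus_add a_ac)
    have approx: "?T (\<Oplus>i\<in>G. v i) \<ominus> (\<Oplus>i\<in>G. ?d i \<bullet> v i) \<in> N" if "G \<subseteq> F" for G
      using finite_subset[OF that insert.hyps(1)] that
    proof induction
      case empty
      then show ?case using w by (simp add: a_minus_def)
    next
      case (insert i G)
      have c: "v i \<in> carrier R" "v \<in> G \<rightarrow> carrier R" "(\<lambda>i. ?d i \<bullet> v i) \<in> G \<rightarrow> carrier R"
        using insert.prems vc by auto
      then have S: "(\<Oplus>i\<in>G. v i) \<in> carrier R" "(\<Oplus>i\<in>G. ?d i \<bullet> v i) \<in> carrier R" by simp_all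
      \<comment> \<open>\<open>T\<close> kills the \<open>j\<close>-th component modulo \<open>N\<close> and scales the others by the non-zero \<open>\<mu>\<^sub>i - \<mu>\<^sub>j\<close>.\<close>
      have "?T (v i) \<ominus> ?d i \<bullet> v i = w \<otimes> v i \<otimes> s \<ominus> \<mu> i \<bullet> v i"
      proof -
        have d: "?d i \<bullet> v i = \<mu> i \<bullet> v i \<ominus> \<mu> j \<bullet> v i"
          using c(1) scale_add_left[of "v i" "\<mu> i" "- \<mu> j"] by (simp add: scale_one_zero_neg a_minus_def)
        show ?thesis
          unfolding d using c(1) w by (intro difference_cancel(1)) simp_all
      qed
      then have 1: "?T (v i) \<ominus> ?d i \<bullet> v i \<in> N"
        using \<open>insert i G \<subseteq> F\<close> insert_prems_eigen by simp
      have 2: "?T (\<Oplus>i\<in>G. v i) \<ominus> (\<Oplus>i\<in>G. ?d i \<bullet> v i) \<in> N"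
        using insert by simp
      have "?T (\<Oplus>i\<in>insert i G. v i) \<ominus> (\<Oplus>i\<in>insert i G. ?d i \<bullet> v i) =
          ?T (v i \<oplus> (\<Oplus>i\<in>G. v i)) \<ominus> (?d i \<bullet> v i \<oplus> (\<Oplus>i\<in>G. ?d i \<bullet> v i))"
        using insert.hyps c by simp
      also have "\<dots> = (?T (v i) \<ominus> ?d i \<bullet> v i) \<oplus> (?T (\<Oplus>i\<in>G. v i) \<ominus> (\<Oplus>i\<in>G. ?d i \<bullet> v i))"
        unfolding T_add[OF c(1) S(1)] using c(1) S w
        by (simp add: a_minus_def minus_add a_ac)
      finally show ?case using 1 2 by simp
    qed
    let ?S = "\<Oplus>i\<in>F. v i" and ?D = "\<Oplus>i\<in>F. ?d i \<bullet> v i"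
    have S: "?S \<in> carrier R" "?D \<in> carrier R" using vc by auto
    have sum: "(\<Oplus>i\<in>insert j F. v i) = v j \<oplus> ?S"
      using insert.hyps vc by simp
    have "?T (v j \<oplus> ?S) \<in> N"
      using insert.prems(4) unfolding sum by (intro diff w scale_N)
    then have "?T (v j) \<oplus> ?T ?S \<in> N" by (simp only: T_add[OF vc(1) S(1)])
    moreover have "?T (v j) \<in> N" using insert.prems(3) by simp
    ultimately have "(?T (v j) \<oplus> ?T ?S) \<ominus> ?T (v j) \<in> N" by (rule diff)
    also have "(?T (v j) \<oplus> ?T ?S) \<ominus> ?T (v j) = ?T ?S"
      using vc(1) S(1) w by (intro difference_cancel(2)[of _ _ \<zero>]) simp_all
    finally have "?T ?S \<ominus> (?T ?S \<ominus> ?D) \<in> N" using approx[OF subset_refl] by (rule diff)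
    also have "?T ?S \<ominus> (?T ?S \<ominus> ?D) = ?D"
      using S w by (intro difference_cancel(3)[of _ _ \<zero>]) simp_all
    finally have D: "?D \<in> N" .
    have "\<forall>i\<in>F. ?d i \<bullet> v i \<in> N"
    proof (rule insert.IH[OF _ _ _ D])
      show "inj_on \<mu> F" using insert.prems(1) by simp
      show "?d i \<bullet> v i \<in> carrier R" if "i \<in> F" for i using vc that by simp
      show "w \<otimes> (?d i \<bullet> v i) \<otimes> s \<ominus> \<mu> i \<bullet> ?d i \<bullet> v i \<in> N" if "i \<in> F" for i
      proof -
        have "w \<otimes> (?d i \<bullet> v i) \<otimes> s \<ominus> \<mu> i \<bullet> ?d i \<bullet> v i = ?d i \<bullet> (w \<otimes> v i \<otimes> s \<ominus> \<mu> i \<bullet> v i)"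
          using vc(3)[OF that] w
          by (simp add: a_minus_def scale_assoc scale_distrib scale_minus mult.commute)
        then show ?thesis using insert.prems(3) that scale_N by simp
      qed
    qed
    moreover have "v i \<in> N" if "?d i \<bullet> v i \<in> N" "i \<in> F" for i
    proof -
      have "?d i \<noteq> 0" using insert.prems(1) insert.hyps(2) that(2) by (auto simp: inj_on_def)
      then have "inverse (?d i) \<bullet> ?d i \<bullet> v i = v i"
        using vc(3)[OF that(2)] by (simp add: scale_assoc scale_one_zero_neg)
      then show ?thesis using scale_N[OF that(1)] by metis
    qed
    ultimately have F: "\<forall>i\<in>F. v i \<in> N" by blast
    then have "?S \<in> N"
      using insert.hyps(1) by (intro finsum_in_additive_subgroup[OF N]) auto
    then have "(v j \<oplus> ?S) \<ominus> ?S \<in> N" using insert.prems(4) unfolding sum by (intro diff)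
    moreover have "(v j \<oplus> ?S) \<ominus> ?S = v j" using vc S by (simp add: a_minus_def a_assoc r_neg)
    ultimately show ?case using F by simp
  qed simp
qed

end

section \<open>The localized quantum Weyl algebra\<close>

text \<open>
  The situation of the theorem, with \<open>t = pq\<close> and \<open>u = z\<inverse>y\<close>.
\<close>

locale localized_weyl = central_algebra R \<kappa>
  for R (structure) and \<kappa> :: "'k::alg_closed_field \<Rightarrow> 'a" +
  fixes t :: 'k and x u :: 'a
  assumes division: "Units R = carrier R - {\<zero>}"
    and xu [simp]: "x \<in> carrier R" "u \<in> carrier R"
    and x_nonzero: "x \<noteq> \<zero>"
    and ux: "u \<otimes> x = t \<bullet> (x \<otimes> u) \<oplus> \<one>"
    and noncommuting: "u \<otimes> x \<noteq> x \<otimes> u"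
    and t_nonzero: "t \<noteq> 0"
    and t_not_root: "n > 0 \<Longrightarrow> t ^ n \<noteq> 1"
begin

lemma t_power_int: "t powi i = 1 \<longleftrightarrow> i = 0"
proof
  assume i: "t powi i = 1"
  show "i = 0"
  proof (rule ccontr)
    assume "i \<noteq> 0"
    then have "t ^ nat \<bar>i\<bar> \<noteq> 1" by (intro t_not_root) simp
    then show False using i by (auto simp: power_int_def abs_if power_inverse split: if_splits)
  qed
qed simp

lemma t_power_int_inj: "inj (\<lambda>i. t powi i)"
proof (rule injI)
  fix i j assume "t powi i = t powi j"
  then have "t powi (i - j) = 1" using t_nonzero by (simp add: power_int_diff)
  then show "i = j" by (simp add: t_power_int)
qed

lemma t_not_1: "t \<noteq> 1"
  using t_not_root[of 1] by simp

lemma one_neq_zero: "\<zero> \<noteq> \<one>"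
  using division Units_one_closed by auto

lemma domain:
  assumes "a \<in> carrier R" "b \<in> carrier R" "a \<otimes> b = \<zero>" shows "a = \<zero> \<or> b = \<zero>"
proof (cases "a = \<zero>")
  case False
  then have a: "a \<in> Units R" using division assms(1) by simp
  have "b = inv a \<otimes> a \<otimes> b" using a assms(2) by simp
  also have "\<dots> = inv a \<otimes> (a \<otimes> b)" using a assms(1,2) by (intro m_assoc) simp_all
  also have "\<dots> = \<zero>" using a by (simp add: assms(3))
  finally show ?thesis ..
qed simp

lemma x_unit [simp]: "x \<in> Units R"
  using x_nonzero by (simp add: division)

lemmas x_pow_closed [simp] = unit_int_pow_closed[OF x_unit]
lemmas x_pow_add = unit_int_pow_add[OF x_unit]
lemmas x_pow_1 = unit_int_pow_1(1)[OF x_unit]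
lemmas x_pow_minus_1 = unit_int_pow_1(2)[OF x_unit]

text \<open>
  The element whose commutation with \<open>x\<close> is diagonal; it replaces \<open>u\<close> as a generator.
\<close>

definition w :: 'a where "w = u \<otimes> x \<ominus> x \<otimes> u"

lemma w_eq: "w = (t - 1) \<bullet> (x \<otimes> u) \<oplus> \<one>"
proof -
  have "w = (t \<bullet> (x \<otimes> u) \<oplus> (- 1) \<bullet> (x \<otimes> u)) \<oplus> \<one>"
    by (simp add: w_def ux a_minus_def scale_one_zero_neg a_ac)
  then show ?thesis by (simp flip: scale_add_left)
qed

lemma w_closed [simp]: "w \<in> carrier R"
  by (simp add: w_def)

lemma w_minus_1: "w \<ominus> \<one> = (t - 1) \<bullet> (x \<otimes> u)"
  by (simp add: w_eq a_minus_def a_assoc r_neg)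

lemma u_eq: "u = inverse (t - 1) \<bullet> (inv x \<otimes> (w \<ominus> \<one>))"
  using t_not_1 by (simp add: w_minus_1 scale_assoc scale_one_zero_neg flip: m_assoc)

lemma w_x: "w \<otimes> x = t \<bullet> (x \<otimes> w)"
proof -
  have "w \<otimes> x = (t - 1) \<bullet> (x \<otimes> (u \<otimes> x)) \<oplus> x"
    by (simp add: w_eq l_distr scale_assoc m_assoc)
  also have "\<dots> = (t * (t - 1)) \<bullet> (x \<otimes> (x \<otimes> u)) \<oplus> ((t - 1) \<bullet> x \<oplus> 1 \<bullet> x)"
    by (simp add: ux r_distr scale_assoc scale_add_right a_assoc mult.commute scale_one_zero_neg)
  also have "(t - 1) \<bullet> x \<oplus> 1 \<bullet> x = t \<bullet> x"
    by (simp flip: scale_add_left)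
  finally show ?thesis
    by (simp add: w_eq r_distr scale_assoc scale_add_right)
qed

lemma w_nonzero: "w \<noteq> \<zero>"
  using noncommuting by (simp add: w_def)

lemma w_unit [simp]: "w \<in> Units R"
  using w_nonzero by (simp add: division)

text \<open>
  A scalar would commute with \<open>x\<close>, but \<open>wx = t xw\<close> and \<open>t \<noteq> 1\<close>.
\<close>

lemma w_not_scalar: "w \<notin> range \<kappa>"
proof
  assume "w \<in> range \<kappa>"
  then have "w \<otimes> x = x \<otimes> w" by (auto simp: scal_central)
  then have "t \<bullet> (x \<otimes> w) \<oplus> (- 1) \<bullet> (x \<otimes> w) = \<zero>"
    by (simp add: w_x scale_one_zero_neg r_neg)
  then have "(t - 1) \<bullet> (x \<otimes> w) = \<zero>" by (simp flip: scale_add_left)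
  then have "\<kappa> (t - 1) = \<zero> \<or> x \<otimes> w = \<zero>" by (intro domain) (simp_all add: scale_def)
  then show False
    using domain[of x w] t_not_1 x_nonzero w_nonzero scal_inj[OF one_neq_zero, of "t - 1"] by simp
qed

lemmas w_x_pow = skew_commute_int_pow[OF w_x w_closed x_unit t_nonzero]

lemma poly_value_w_nonzero: "f \<noteq> 0 \<Longrightarrow> poly_value w f \<noteq> \<zero>"
  by (rule poly_value_nonzero[OF w_closed _ domain one_neq_zero w_not_scalar])
     (rule alg_closed_imp_poly_has_root)

text \<open>
  The nested form reflects that \<open>x\<inverse>\<close> is adjoined to the algebra \<open>B'\<close> generated by \<open>x\<close> and \<open>u\<close>.
\<close>

definition weyl_ring :: "'a set" where
  "weyl_ring = generate_ring R (generate_ring R (range \<kappa> \<union> {x, u}) \<union> {inv x})"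

lemma weyl_generators: "range \<kappa> \<union> {x, u} \<subseteq> carrier R"
  by auto

lemma subring_weyl_ring: "subring weyl_ring R"
  unfolding weyl_ring_def
  by (rule generate_ring_is_subring) (use generate_ring_incl[OF weyl_generators] in auto)

lemmas weyl_ring_closed = subringE(2,3,5-7)[OF subring_weyl_ring]
lemmas weyl_ring_carrier = subsetD[OF subringE(1)[OF subring_weyl_ring]]

lemma weyl_ring_incl: "range \<kappa> \<union> {x, u, inv x} \<subseteq> weyl_ring"
  unfolding weyl_ring_def by (auto intro!: generate_ring.incl)

lemma weyl_ring_gens [simp]: "\<kappa> c \<in> weyl_ring" "x \<in> weyl_ring" "u \<in> weyl_ring" "inv x \<in> weyl_ring"
  using weyl_ring_incl by auto

lemma weyl_ring_minimal:
  assumes "subring T R" "range \<kappa> \<union> {x, u, inv x} \<subseteq> T"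
  shows "weyl_ring \<subseteq> T"
  unfolding weyl_ring_def
proof (rule generate_ring_min_subring1[OF _ assms(1)])
  show "generate_ring R (range \<kappa> \<union> {x, u}) \<union> {inv x} \<subseteq> carrier R"
    using generate_ring_incl[OF weyl_generators] by auto
  show "generate_ring R (range \<kappa> \<union> {x, u}) \<union> {inv x} \<subseteq> T"
    using generate_ring_min_subring1[OF weyl_generators assms(1)] assms(2) by auto
qed

lemma weyl_ring_scale: "a \<in> weyl_ring \<Longrightarrow> c \<bullet> a \<in> weyl_ring"
  by (simp add: scale_def weyl_ring_closed)

lemma weyl_ring_diff: "a \<in> weyl_ring \<Longrightarrow> b \<in> weyl_ring \<Longrightarrow> a \<ominus> b \<in> weyl_ring"
  by (simp add: a_minus_def weyl_ring_closed)

lemma weyl_ring_x_pow [simp]: "x [^] (i::int) \<in> weyl_ring"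
proof (induction i rule: int_induct[where k = 0])
  case (step2 i)
  then show ?case
    using x_pow_add[of i "- 1"] by (simp add: x_pow_minus_1 weyl_ring_closed)
qed (simp_all add: weyl_ring_closed x_pow_add x_pow_1)

lemma weyl_ring_w [simp]: "w \<in> weyl_ring"
  by (simp add: w_def weyl_ring_diff weyl_ring_closed)

lemma weyl_ring_poly_value [simp]: "poly_value w f \<in> weyl_ring"
  by (rule poly_value_in_subring[OF w_closed subring_weyl_ring]) auto

text \<open>
  Expansions \<open>\<Sum>\<^sub>i x\<^sup>i f\<^sub>i(w)\<close> with polynomials \<open>f\<^sub>i\<close>.  The coefficients are zero outside the index set so
  that the index set can be enlarged and expansions can be added.
\<close>

definition expansion :: "int set \<Rightarrow> (int \<Rightarrow> 'k poly) \<Rightarrow> 'a \<Rightarrow> bool" where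
  "expansion F f a \<longleftrightarrow> finite F \<and> (\<forall>i. i \<notin> F \<longrightarrow> f i = 0) \<and>
     a = (\<Oplus>i\<in>F. x [^] i \<otimes> poly_value w (f i))"

lemma expansion_superset:
  assumes "expansion F f a" "F \<subseteq> G" "finite G"
  shows "expansion G f a"
  using assms unfolding expansion_def
  by (auto intro!: add.finprod_mono_neutral_cong_left)

lemma expansion_term: "expansion {i} (\<lambda>j. if j = i then f else 0) (x [^] i \<otimes> poly_value w f)"
  by (simp add: expansion_def)

lemma expansion_add:
  assumes "expansion F f a" "expansion G g b"
  shows "expansion (F \<union> G) (\<lambda>i. f i + g i) (a \<oplus> b)"
proof -
  have "finite (F \<union> G)" using assms by (simp add: expansion_def)
  then have "expansion (F \<union> G) f a" "expansion (F \<union> G) g b"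
    using expansion_superset assms by blast+
  then show ?thesis
    by (simp add: expansion_def poly_value_add r_distr finsum_addf Pi_def)
qed

lemma expansion_mult_right:
  assumes "expansion F f a"
  shows "expansion F (\<lambda>i. f i * g) (a \<otimes> poly_value w g)"
  using assms
  by (auto simp: expansion_def finsum_ldistr poly_value_mult m_assoc Pi_def)

lemma term_mult:
  "(x [^] (i::int) \<otimes> poly_value w f) \<otimes> (x [^] (j::int) \<otimes> poly_value w g) =
   x [^] (i + j) \<otimes> poly_value w (pcompose f [:0, t powi j:] * g)"
proof -
  have "(x [^] i \<otimes> poly_value w f) \<otimes> (x [^] j \<otimes> poly_value w g) =
      x [^] i \<otimes> (poly_value w f \<otimes> x [^] j) \<otimes> poly_value w g"
    by (simp add: m_assoc)
  also have "\<dots> = x [^] (i + j) \<otimes> poly_value w (pcompose f [:0, t powi j:] * g)"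
    unfolding skew_commute_poly_value[OF w_closed w_x_pow x_pow_closed]
    by (simp add: m_assoc x_pow_add poly_value_mult)
  finally show ?thesis .
qed

definition weyl_terms :: "'a set" where
  "weyl_terms = {x [^] i \<otimes> poly_value w f | (i::int) f. True}"

lemma weyl_terms_carrier: "weyl_terms \<subseteq> carrier R"
  by (auto simp: weyl_terms_def)

lemma weyl_span_carrier: "a \<in> additive_span R {} weyl_terms \<Longrightarrow> a \<in> carrier R"
  by (induction rule: additive_span.induct) (use weyl_terms_carrier in auto)

text \<open>
  The span of the terms \<open>x\<^sup>i f(w)\<close> is closed under products because \<open>f(w) x\<^sup>j = x\<^sup>j f(t\<^sup>j w)\<close>, and
  it contains \<open>u = (t - 1)\<inverse> x\<inverse> (w - 1)\<close>.
\<close>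

lemma weyl_ring_span: "weyl_ring \<subseteq> additive_span R {} weyl_terms"
proof (rule weyl_ring_minimal)
  let ?D = "additive_span R {} weyl_terms"
  have terms: "x [^] (i::int) \<otimes> poly_value w f \<in> ?D" for i f
    by (rule additive_span.base) (auto simp: weyl_terms_def)
  note closed = weyl_span_carrier
  show "subring ?D R"
  proof (rule subringI)
    show "?D \<subseteq> carrier R" using closed by blast
    show "\<one> \<in> ?D" using terms[of 0 "[:1:]"] by (simp add: poly_value_const scal_one)
    show "\<ominus> a \<in> ?D" if "a \<in> ?D" for a
      using that
    proof induction
      case (base e)
      then obtain i :: int and f where "e = x [^] i \<otimes> poly_value w f" by (auto simp: weyl_terms_def)
      then have "\<ominus> e = x [^] i \<otimes> poly_value w (- f)" by (simp add: poly_value_minus r_minus)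
      then show ?case using terms by simp
    next
      case (add a b)
      then show ?case by (simp add: minus_add closed additive_span.add)
    qed simp
    show "a \<oplus> b \<in> ?D" if "a \<in> ?D" "b \<in> ?D" for a b
      using that by (rule additive_span.add)
    show "a \<otimes> b \<in> ?D" if "a \<in> ?D" "b \<in> ?D" for a b
      using that(1)
    proof induction
      case (base e)
      then obtain i :: int and f where e: "e = x [^] i \<otimes> poly_value w f" by (auto simp: weyl_terms_def)
      from that(2) show ?case
      proof induction
        case (base e')
        then obtain j :: int and g where "e' = x [^] j \<otimes> poly_value w g" by (auto simp: weyl_terms_def)
        then show ?case unfolding e using term_mult terms by metis
      next
        case (add a b)
        then show ?case using e by (simp add: r_distr closed additive_span.add)
      qed simp
    next
      case (add a a')
      then show ?case using that(2) by (simp add: l_distr closed additive_span.add)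
    qed simp
  qed
  have "\<kappa> c \<in> ?D" for c using terms[of 0 "[:c:]"] by (simp add: poly_value_const)
  moreover have "x \<in> ?D" "inv x \<in> ?D"
    using terms[of 1 "[:1:]"] terms[of "-1" "[:1:]"]
    by (simp_all add: poly_value_const scal_one x_pow_1 x_pow_minus_1)
  moreover have "u \<in> ?D"
  proof -
    have "u = x [^] (-1::int) \<otimes> poly_value w (smult (inverse (t - 1)) [:- 1, 1:])"
      unfolding poly_value_smult[OF w_closed]
      by (subst u_eq) (simp add: x_pow_minus_1 poly_value_pCons scal_minus scal_one scale_assoc
          a_minus_def a_comm)
    then show ?thesis using terms by metis
  qed
  ultimately show "range \<kappa> \<union> {x, u, inv x} \<subseteq> ?D" by auto
qed

lemma expansion_exists:
  assumes "a \<in> weyl_ring" shows "\<exists>F f. expansion F f a"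
proof -
  have "a \<in> additive_span R {} weyl_terms" using assms weyl_ring_span by blast
  then show ?thesis
  proof induction
    case (base e)
    then show ?case using expansion_term by (auto simp: weyl_terms_def)
  next
    case (add a b)
    then show ?case using expansion_add by blast
  qed simp
qed

section \<open>The left ideal generated by the \<open>q\<close>-derivation\<close>

definition I :: "'a set" where "I = (\<lambda>b. b \<otimes> u) ` weyl_ring"

lemma I_weyl_ring: "I \<subseteq> weyl_ring"
  by (auto simp: I_def weyl_ring_closed)

lemma I_carrier: "a \<in> I \<Longrightarrow> a \<in> carrier R"
  using I_weyl_ring weyl_ring_carrier by blast

lemma I_left: "b \<in> weyl_ring \<Longrightarrow> a \<in> I \<Longrightarrow> b \<otimes> a \<in> I"
  unfolding I_def using weyl_ring_closed weyl_ring_carrier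
  by (auto simp: m_assoc[symmetric])

lemma additive_subgroup_I: "additive_subgroup I R"
proof (rule additive_subgroupI, rule add.subgroupI)
  show "I \<subseteq> carrier R" "I \<noteq> {}" using I_carrier weyl_ring_closed by (auto simp: I_def)
  show "\<ominus> a \<in> I" if "a \<in> I" for a
  proof -
    have "\<ominus> \<one> \<otimes> a \<in> I" by (rule I_left) (simp_all add: weyl_ring_closed that)
    then show ?thesis using I_carrier[OF that] by (simp add: l_minus)
  qed
  show "a \<oplus> b \<in> I" if ab: "a \<in> I" "b \<in> I" for a b
  proof -
    obtain c d where cd: "c \<in> weyl_ring" "a = c \<otimes> u" "d \<in> weyl_ring" "b = d \<otimes> u"
      using ab by (auto simp: I_def)
    then have "a \<oplus> b = (c \<oplus> d) \<otimes> u" by (simp add: l_distr weyl_ring_carrier)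
    then show ?thesis using cd by (auto simp: I_def weyl_ring_closed)
  qed
qed

lemma I_scale: "a \<in> I \<Longrightarrow> c \<bullet> a \<in> I"
  by (simp add: scale_def I_left)

lemma w_minus_1_in_I: "w \<ominus> \<one> \<in> I"
proof -
  have "w \<ominus> \<one> = ((t - 1) \<bullet> x) \<otimes> u" by (simp add: w_minus_1 scale_assoc)
  then show ?thesis by (auto simp: I_def weyl_ring_scale)
qed

lemma I_as_multiples_of_w_minus_1:
  assumes "a \<in> I" obtains b where "b \<in> weyl_ring" "a = b \<otimes> (w \<ominus> \<one>)"
proof -
  obtain c where c: "c \<in> weyl_ring" "a = c \<otimes> u" using assms by (auto simp: I_def)
  have "a = (inverse (t - 1) \<bullet> (c \<otimes> inv x)) \<otimes> (w \<ominus> \<one>)"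
    using c weyl_ring_carrier[OF c(1)] by (subst (asm) u_eq) (simp add: scale_assoc m_assoc)
  then show thesis using c by (intro that) (auto simp: weyl_ring_scale weyl_ring_closed)
qed

lemma w_minus_1_poly_value: "w \<ominus> \<one> = poly_value w [:- 1, 1:]"
  by (simp add: poly_value_pCons scal_minus scal_one a_minus_def a_comm)

text \<open>
  Modulo \<open>I\<close> the element \<open>w\<close> is \<open>1\<close>, so \<open>f(w)\<close> is the scalar \<open>f(1)\<close>.
\<close>

lemma poly_value_mod_I: "poly_value w f \<ominus> \<kappa> (poly f 1) \<in> I"
proof -
  let ?g = "synthetic_div f 1"
  have "f - [:poly f 1:] = ?g * [:- 1, 1:]"
    using synthetic_div_correct'[of 1 f] by (metis add_diff_cancel_right' mult.commute)
  then have "poly_value w (f + - [:poly f 1:]) = poly_value w ?g \<otimes> (w \<ominus> \<one>)"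
    by (simp only: poly_value_mult w_minus_1_poly_value w_closed diff_conv_add_uminus)
  then have "poly_value w f \<ominus> \<kappa> (poly f 1) = poly_value w ?g \<otimes> (w \<ominus> \<one>)"
    unfolding poly_value_add[OF w_closed] poly_value_minus[OF w_closed]
    by (simp add: poly_value_const a_minus_def)
  then show ?thesis by (simp add: I_left w_minus_1_in_I)
qed

text \<open>
  Conjugation by \<open>w\<close> multiplies \<open>x\<^sup>i f(w)\<close> by \<open>t\<^sup>i\<close>, so the expansion of zero is zero.
\<close>

lemma expansion_zero:
  assumes "expansion F f \<zero>" shows "f i = 0"
proof (cases "i \<in> F")
  case True
  have F: "finite F" "(\<Oplus>i\<in>F. x [^] i \<otimes> poly_value w (f i)) = \<zero>"
    using assms by (simp_all add: expansion_def)
  have "\<forall>i\<in>F. x [^] i \<otimes> poly_value w (f i) \<in> {\<zero>}"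
  proof (rule eigencomponents_in_subspace[where w = w and s = "inv w" and \<mu> = "\<lambda>i. t powi i"])
    show "additive_subgroup {\<zero>} R"
      by (rule additive_subgroupI) (rule add.triv_subgroup)
    show "inj_on (\<lambda>i. t powi i) F" using t_power_int_inj by (rule inj_on_subset) simp
    show "w \<otimes> (x [^] i \<otimes> poly_value w (f i)) \<otimes> inv w \<ominus>
        (t powi i) \<bullet> (x [^] i \<otimes> poly_value w (f i)) \<in> {\<zero>}" for i
    proof -
      have "w \<otimes> (x [^] i \<otimes> poly_value w (f i)) \<otimes> inv w = (w \<otimes> x [^] i) \<otimes> poly_value w (f i) \<otimes> inv w"
        by (simp add: m_assoc)
      also have "\<dots> = (t powi i) \<bullet> (x [^] i \<otimes> (w \<otimes> poly_value w (f i)) \<otimes> inv w)"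
        unfolding w_x_pow by (simp add: scale_assoc m_assoc)
      also have "\<dots> = (t powi i) \<bullet> (x [^] i \<otimes> poly_value w (f i))"
        unfolding poly_value_commutes[OF w_closed] by (simp add: m_assoc)
      finally show ?thesis by (simp add: a_minus_def r_neg)
    qed
  qed (use F in auto)
  then have "x [^] i \<otimes> poly_value w (f i) = \<zero>" using True by blast
  moreover have "x [^] i \<noteq> \<zero>"
    using x_pow_add[of i "- i"] one_neq_zero by auto
  ultimately have "poly_value w (f i) = \<zero>" using domain by (metis poly_value_closed w_closed x_pow_closed)
  then show ?thesis using poly_value_w_nonzero by blast
qed (use assms in \<open>simp add: expansion_def\<close>)

text \<open>
  From \<open>1 = b(w - 1)\<close> with \<open>b = \<Sum>\<^sub>i x\<^sup>i f\<^sub>i(w)\<close> the component of degree zero yields \<open>f\<^sub>0 (X - 1) =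
  1\<close>, which is absurd at \<open>X = 1\<close>.
\<close>

lemma one_not_in_I: "\<one> \<notin> I"
proof
  assume "\<one> \<in> I"
  then obtain b where b: "b \<in> weyl_ring" "\<one> = b \<otimes> (w \<ominus> \<one>)"
    using I_as_multiples_of_w_minus_1 by metis
  obtain F f where "expansion F f b" using expansion_exists[OF b(1)] by blast
  then have "expansion F (\<lambda>i. f i * [:- 1, 1:]) \<one>"
    using expansion_mult_right[of F f b "[:- 1, 1:]"] b(2) by (simp add: w_minus_1_poly_value)
  moreover have "expansion {0} (\<lambda>j. if j = 0 then [:- 1:] else 0) (\<ominus> \<one>)"
    using expansion_term[of 0 "[:- 1:]"] by (simp add: poly_value_const scal_minus scal_one)
  ultimately have "expansion (F \<union> {0})
      (\<lambda>i. f i * [:- 1, 1:] + (if i = 0 then [:- 1:] else 0)) (\<one> \<oplus> \<ominus> \<one>)"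
    by (rule expansion_add)
  from expansion_zero[OF this[unfolded r_neg[OF one_closed]], of 0]
  have "f 0 * [:- 1, 1:] + [:- 1:] = 0" by simp
  then have "poly (f 0 * [:- 1, 1:] + [:- 1:]) 1 = 0" by simp
  then show False by simp
qed

text \<open>
  Multiplication by \<open>w\<close> acts on \<open>x\<^sup>i f(w)\<close> as \<open>t\<^sup>i\<close> modulo \<open>I\<close>, because \<open>w \<equiv> 1\<close> there.
\<close>

lemma expansion_components_in:
  assumes N: "additive_subgroup N R" "I \<subseteq> N" "\<And>c n. n \<in> N \<Longrightarrow> c \<bullet> n \<in> N"
      "\<And>n. n \<in> N \<Longrightarrow> w \<otimes> n \<in> N"
    and a: "expansion F f a" "a \<in> N" and "i \<in> F"
  shows "x [^] i \<otimes> poly_value w (f i) \<in> N"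
proof -
  have Nc: "N \<subseteq> carrier R" using additive_subgroup.a_subset[OF N(1)] .
  have "\<forall>i\<in>F. x [^] i \<otimes> poly_value w (f i) \<in> N"
  proof (rule eigencomponents_in_subspace[where w = w and s = \<one> and \<mu> = "\<lambda>i. t powi i"])
    show "inj_on (\<lambda>i. t powi i) F" using t_power_int_inj by (rule inj_on_subset) simp
    show "w \<otimes> n \<otimes> \<one> \<in> N" if "n \<in> N" for n using N(4)[OF that] Nc by (simp add: subset_eq)
    show "w \<otimes> (x [^] i \<otimes> poly_value w (f i)) \<otimes> \<one> \<ominus>
        (t powi i) \<bullet> (x [^] i \<otimes> poly_value w (f i)) \<in> N" for i
    proof -
      let ?v = "x [^] i \<otimes> poly_value w (f i)"
      have "w \<otimes> ?v = (w \<otimes> x [^] i) \<otimes> poly_value w (f i)" by (simp add: m_assoc)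
      also have "\<dots> = (t powi i) \<bullet> (x [^] i \<otimes> (w \<otimes> poly_value w (f i)))"
        unfolding w_x_pow by (simp add: scale_assoc m_assoc)
      also have "\<dots> = (t powi i) \<bullet> (?v \<otimes> w)"
        unfolding poly_value_commutes[OF w_closed] by (simp add: m_assoc)
      finally have "w \<otimes> ?v \<otimes> \<one> \<ominus> (t powi i) \<bullet> ?v = (t powi i) \<bullet> (?v \<otimes> (w \<ominus> \<one>))"
        by (simp add: a_minus_def r_distr scale_add_right scale_minus r_minus)
      also have "\<dots> \<in> I"
        by (intro I_scale I_left w_minus_1_in_I weyl_ring_closed) simp_all
      finally show ?thesis using N(2) by blast
    qed
  qed (use assms in \<open>auto simp: expansion_def\<close>)
  then show ?thesis using \<open>i \<in> F\<close> by blast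
qed

text \<open>
  Modulo \<open>I\<close> an element is a Laurent polynomial \<open>\<Sum>\<^sub>i f\<^sub>i(1) x\<^sup>i\<close>, all of whose terms again belong
  to \<open>N\<close>. Either it is constant or some power \<open>x\<^sup>i\<close> with \<open>i \<noteq> 0\<close> occurs in it.
\<close>

lemma subspace_dichotomy:
  assumes N: "additive_subgroup N R" "I \<subseteq> N" "\<And>c n. n \<in> N \<Longrightarrow> c \<bullet> n \<in> N"
      "\<And>n. n \<in> N \<Longrightarrow> w \<otimes> n \<in> N"
    and a: "a \<in> N" "a \<in> weyl_ring"
  shows "(\<exists>c. a \<ominus> \<kappa> c \<in> I) \<or> (\<exists>i::int. i \<noteq> 0 \<and> x [^] i \<in> N)"
proof -
  interpret N: additive_subgroup N R by (rule N(1))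
  interpret I: additive_subgroup I R by (rule additive_subgroup_I)
  obtain F f where f: "expansion F f a" using expansion_exists[OF a(2)] by blast
  let ?v = "\<lambda>i. x [^] i \<otimes> poly_value w (f i)"
  have mod_I: "?v i \<ominus> poly (f i) 1 \<bullet> x [^] i \<in> I" for i
  proof -
    have "?v i \<ominus> poly (f i) 1 \<bullet> x [^] i = x [^] i \<otimes> (poly_value w (f i) \<ominus> \<kappa> (poly (f i) 1))"
      by (simp add: a_minus_def r_distr r_minus scale_def scal_central)
    then show ?thesis by (simp add: I_left poly_value_mod_I)
  qed
  show ?thesis
  proof (cases "\<exists>i\<in>F. i \<noteq> 0 \<and> poly (f i) 1 \<noteq> 0")
    case True
    then obtain i where i: "i \<in> F" "i \<noteq> 0" "poly (f i) 1 \<noteq> 0" by blast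
    let ?c = "poly (f i) 1"
    have "?v i \<in> N" by (rule expansion_components_in[OF N f a(1) i(1)])
    then have "?v i \<ominus> (?v i \<ominus> ?c \<bullet> x [^] i) \<in> N"
      using mod_I[of i] N(2) by (auto simp: a_minus_def)
    then have "?c \<bullet> x [^] i \<in> N" using difference_cancel(3)[of "?v i" "?c \<bullet> x [^] i" \<zero>] by simp
    then have "inverse ?c \<bullet> ?c \<bullet> x [^] i \<in> N" by (rule N(3))
    then have "x [^] i \<in> N" using i(3) by (simp add: scale_assoc scale_one_zero_neg)
    then show ?thesis using i(2) by blast
  next
    case False
    have small: "?v i \<in> I" if "i \<in> F - {0}" for i
      using mod_I[of i] False that by (auto simp: scale_one_zero_neg a_minus_def)
    have f0: "expansion (insert 0 F) f a"
      using f by (intro expansion_superset[OF f]) (auto simp: expansion_def)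
    have "a = (\<Oplus>i\<in>insert 0 (F - {0}). ?v i)"
      using f0 by (simp add: expansion_def)
    also have "\<dots> = ?v 0 \<oplus> (\<Oplus>i\<in>F - {0}. ?v i)"
      using f by (subst finsum_insert) (auto simp: expansion_def)
    finally have a: "a = ?v 0 \<oplus> (\<Oplus>i\<in>F - {0}. ?v i)" .
    have S: "(\<Oplus>i\<in>F - {0}. ?v i) \<in> I"
      using f small
      by (intro finsum_in_additive_subgroup[OF additive_subgroup_I]) (auto simp: expansion_def)
    have "(?v 0 \<ominus> \<kappa> (poly (f 0) 1)) \<in> I"
      using poly_value_mod_I[of "f 0"] by simp
    then have "(?v 0 \<ominus> \<kappa> (poly (f 0) 1)) \<oplus> (\<Oplus>i\<in>F - {0}. ?v i) \<in> I"
      using S by (rule I.a_closed)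
    moreover have "(?v 0 \<ominus> \<kappa> (poly (f 0) 1)) \<oplus> (\<Oplus>i\<in>F - {0}. ?v i) = a \<ominus> \<kappa> (poly (f 0) 1)"
      using I_carrier[OF S] unfolding a by (simp add: a_minus_def a_ac)
    ultimately show ?thesis by metis
  qed
qed

lemma subspace_containing_x_pows:
  assumes N: "additive_subgroup N R" "I \<subseteq> N" "\<And>c n. n \<in> N \<Longrightarrow> c \<bullet> n \<in> N"
    and x: "\<And>i::int. x [^] i \<in> N"
  shows "weyl_ring \<subseteq> N"
proof
  interpret N: additive_subgroup N R by (rule N(1))
  fix a assume "a \<in> weyl_ring"
  then obtain F f where f: "expansion F f a" using expansion_exists by blast
  have "x [^] i \<otimes> poly_value w (f i) \<in> N" for i
  proof -
    have "x [^] i \<otimes> (poly_value w (f i) \<ominus> \<kappa> (poly (f i) 1)) \<in> N"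
      using N(2) I_left[OF weyl_ring_x_pow poly_value_mod_I] by blast
    then have "x [^] i \<otimes> (poly_value w (f i) \<ominus> \<kappa> (poly (f i) 1)) \<oplus> poly (f i) 1 \<bullet> x [^] i \<in> N"
      using N(3)[OF x] by (rule N.a_closed)
    moreover have "x [^] i \<otimes> (poly_value w (f i) \<ominus> \<kappa> (poly (f i) 1)) \<oplus> poly (f i) 1 \<bullet> x [^] i =
        x [^] i \<otimes> poly_value w (f i)"
      by (simp add: a_minus_def r_distr r_minus scale_def scal_central a_assoc l_neg)
    ultimately show ?thesis by simp
  qed
  then have "(\<Oplus>i\<in>F. x [^] i \<otimes> poly_value w (f i)) \<in> N"
    using f by (intro finsum_in_additive_subgroup[OF N(1)]) (simp_all add: expansion_def)
  then show "a \<in> N" using f by (simp add: expansion_def)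
qed

text \<open>
  A left ideal that contains a non-zero scalar or a power of the unit \<open>x\<close> is everything.
\<close>

lemma I_maximal:
  assumes N: "additive_subgroup N R" "I \<subseteq> N" "N \<subseteq> weyl_ring"
    and left: "\<And>b n. b \<in> weyl_ring \<Longrightarrow> n \<in> N \<Longrightarrow> b \<otimes> n \<in> N"
  shows "N = I \<or> N = weyl_ring"
proof (cases "N \<subseteq> I")
  case False
  interpret N: additive_subgroup N R by (rule N(1))
  interpret I: additive_subgroup I R by (rule additive_subgroup_I)
  have scale: "c \<bullet> n \<in> N" if "n \<in> N" for c n using that by (simp add: scale_def left)
  obtain a where a: "a \<in> N" "a \<notin> I" using False by blast
  have ac: "a \<in> carrier R" using a(1) N(3) weyl_ring_carrier by blast
  have aw: "a \<in> weyl_ring" using a(1) N(3) by blast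
  have "(\<exists>c. a \<ominus> \<kappa> c \<in> I) \<or> (\<exists>i::int. i \<noteq> 0 \<and> x [^] i \<in> N)"
    by (rule subspace_dichotomy[OF N(1,2) _ _ a(1) aw]) (simp_all add: scale left)
  then have "\<one> \<in> N"
  proof (elim disjE exE conjE)
    fix c assume c: "a \<ominus> \<kappa> c \<in> I"
    then have "a \<ominus> (a \<ominus> \<kappa> c) \<in> N" using a(1) N(2) by (auto simp: a_minus_def)
    then have "\<kappa> c \<in> N" using difference_cancel(3)[of a "\<kappa> c" \<zero>] ac by simp
    moreover have "c \<noteq> 0" using c a(2) ac by (auto simp: scal_zero a_minus_def)
    ultimately show ?thesis
      using scale[of "\<kappa> c" "inverse c"] by (simp add: scale_def scal_one flip: scal_mult)
  next
    fix i :: int assume "x [^] i \<in> N"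
    then have "x [^] (- i) \<otimes> x [^] i \<in> N" by (simp add: left)
    then show ?thesis by (simp flip: x_pow_add)
  qed
  then have "b \<in> N" if "b \<in> weyl_ring" for b
    using left[OF that] weyl_ring_carrier[OF that] by (metis r_one)
  then show ?thesis using N(3) by blast
qed (use N in blast)

text \<open>
  The subspace \<open>V + I\<close> of the theorem.
\<close>

definition scalars_plus_I :: "'a set" where
  "scalars_plus_I = {\<kappa> c \<oplus> a | c a. a \<in> I}"

lemma mod_scalars: "a \<in> carrier R \<Longrightarrow> a \<ominus> \<kappa> c \<in> I \<Longrightarrow> a \<in> scalars_plus_I"
proof -
  assume a: "a \<in> carrier R" "a \<ominus> \<kappa> c \<in> I"
  have "a = \<kappa> c \<oplus> (a \<ominus> \<kappa> c)" using a(1) by (simp add: a_minus_def a_lcomm r_neg)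
  then show ?thesis using a(2) by (auto simp: scalars_plus_I_def)
qed

text \<open>
  Once \<open>x\<^sup>i\<close> with \<open>i \<noteq> 0\<close> is in \<open>N\<close>, so is \<open>x\<^bsup>j-i\<^esup>(w - 1)x\<^sup>i \<equiv> (t\<^sup>i - 1)x\<^sup>j\<close> modulo \<open>I\<close>, for every
  \<open>j\<close>; and \<open>t\<^sup>i \<noteq> 1\<close>.
\<close>

lemma scalars_plus_I_maximal:
  assumes N: "additive_subgroup N R" "scalars_plus_I \<subseteq> N" "N \<subseteq> weyl_ring"
    and scale: "\<And>c n. n \<in> N \<Longrightarrow> c \<bullet> n \<in> N"
    and L: "\<And>(i::int) n. n \<in> N \<Longrightarrow> (x [^] i \<otimes> u) \<otimes> n \<in> N"
  shows "N = scalars_plus_I \<or> N = weyl_ring"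
proof (cases "N \<subseteq> scalars_plus_I")
  case False
  interpret N: additive_subgroup N R by (rule N(1))
  have I_N: "I \<subseteq> N"
  proof
    fix a assume "a \<in> I"
    then have "\<kappa> 0 \<oplus> a \<in> scalars_plus_I" unfolding scalars_plus_I_def by blast
    then show "a \<in> N" using N(2) I_carrier[OF \<open>a \<in> I\<close>] by (auto simp: scal_zero)
  qed
  have w: "w \<otimes> n \<in> N" if "n \<in> N" for n
  proof -
    have n: "n \<in> carrier R" using N(3) that weyl_ring_carrier by blast
    have "w \<otimes> n = (t - 1) \<bullet> ((x [^] (1::int) \<otimes> u) \<otimes> n) \<oplus> n"
      using n by (simp add: w_eq l_distr scale_assoc x_pow_1)
    then show ?thesis using L[OF that, of 1] scale that by simp
  qed
  obtain a where a: "a \<in> N" "a \<notin> scalars_plus_I" using False by blast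
  then have "a \<in> weyl_ring" using N(3) by blast
  then have "(\<exists>c. a \<ominus> \<kappa> c \<in> I) \<or> (\<exists>i::int. i \<noteq> 0 \<and> x [^] i \<in> N)"
    by (intro subspace_dichotomy[OF N(1) I_N _ _ a(1)] scale w)
  then obtain i :: int where i: "i \<noteq> 0" "x [^] i \<in> N"
    using a(2) mod_scalars[OF weyl_ring_carrier[OF \<open>a \<in> weyl_ring\<close>]] by blast
  have "x [^] j \<in> N" for j :: int
  proof -
    let ?m = "x [^] (j - i) \<otimes> ((w \<ominus> \<one>) \<otimes> x [^] i)"
    have "?m = (t - 1) \<bullet> ((x [^] (j - i + 1) \<otimes> u) \<otimes> x [^] i)"
      by (simp add: w_minus_1 scale_assoc m_assoc x_pow_add[of "j - i" 1] x_pow_1)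
    then have m: "?m \<in> N" using L[OF i(2)] scale by simp
    have "(w \<ominus> \<one>) \<otimes> x [^] i = (t powi i) \<bullet> (x [^] i \<otimes> w) \<ominus> x [^] i"
      by (simp add: a_minus_def l_distr l_minus w_x_pow)
    also have "\<dots> = (t powi i) \<bullet> (x [^] i \<otimes> (w \<ominus> \<one>)) \<oplus> (t powi i - 1) \<bullet> x [^] i"
    proof -
      have "(t powi i) \<bullet> (x [^] i \<otimes> (w \<ominus> \<one>)) = (t powi i) \<bullet> (x [^] i \<otimes> w) \<ominus> (t powi i) \<bullet> x [^] i"
        by (simp add: a_minus_def r_distr r_minus scale_add_right scale_minus)
      moreover have "(t powi i - 1) \<bullet> x [^] i = (t powi i) \<bullet> x [^] i \<ominus> x [^] i"
        using scale_add_left[of "x [^] i" "t powi i" "- 1"] by (simp add: scale_one_zero_neg a_minus_def)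
      ultimately show ?thesis
        by (simp add: a_minus_def a_assoc r_neg1 r_neg2)
    qed
    finally have eq: "?m = (t powi i) \<bullet> (x [^] j \<otimes> (w \<ominus> \<one>)) \<oplus> (t powi i - 1) \<bullet> x [^] j"
      using x_pow_add[of "j - i" i] by (simp add: r_distr scale_assoc m_assoc)
    have e: "(t powi i) \<bullet> (x [^] j \<otimes> (w \<ominus> \<one>)) \<in> N"
      using I_N I_scale[OF I_left[OF weyl_ring_x_pow w_minus_1_in_I]] by blast
    have "?m \<ominus> (t powi i) \<bullet> (x [^] j \<otimes> (w \<ominus> \<one>)) \<in> N"
      using m e by (simp add: a_minus_def)
    then have "(t powi i - 1) \<bullet> x [^] j \<in> N"
      unfolding eq
      using difference_cancel(2)[of "(t powi i) \<bullet> (x [^] j \<otimes> (w \<ominus> \<one>))" "(t powi i - 1) \<bullet> x [^] j" \<zero>]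
      by simp
    then have "inverse (t powi i - 1) \<bullet> (t powi i - 1) \<bullet> x [^] j \<in> N" by (rule scale)
    then show ?thesis
      using t_power_int[of i] i(1) by (simp add: scale_assoc scale_one_zero_neg)
  qed
  then have "weyl_ring \<subseteq> N" by (intro subspace_containing_x_pows N(1) I_N scale)
  then show ?thesis using N(3) by blast
qed (use N in blast)

lemma x_not_in_scalars_plus_I: "x \<notin> scalars_plus_I"
proof
  interpret I: additive_subgroup I R by (rule additive_subgroup_I)
  assume "x \<in> scalars_plus_I"
  then obtain c a where ca: "x = \<kappa> c \<oplus> a" "a \<in> I" by (auto simp: scalars_plus_I_def)
  let ?f = "\<lambda>i::int. (if i = 1 then [:1:] else 0) + (if i = 0 then [:- c:] else 0)"
  have "expansion ({1} \<union> {0}) ?f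
      (x [^] (1::int) \<otimes> poly_value w [:1:] \<oplus> x [^] (0::int) \<otimes> poly_value w [:- c:])"
    by (rule expansion_add[OF expansion_term expansion_term])
  moreover have "x [^] (1::int) \<otimes> poly_value w [:1:] \<oplus> x [^] (0::int) \<otimes> poly_value w [:- c:] =
      x \<ominus> \<kappa> c"
    by (simp add: poly_value_const x_pow_1 scal_one scal_minus a_minus_def)
  moreover have "x \<ominus> \<kappa> c = a"
    using difference_cancel(2)[of "\<kappa> c" a \<zero>] I_carrier[OF ca(2)] by (simp flip: ca(1))
  ultimately have exp: "expansion ({1} \<union> {0}) ?f a" by simp
  have "x [^] (1::int) \<otimes> poly_value w (?f 1) \<in> I"
    by (rule expansion_components_in[OF additive_subgroup_I subset_refl I_scale _ exp ca(2)])
       (auto simp: I_left)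
  then have "x \<in> I" by (simp add: poly_value_const x_pow_1 scal_one)
  then have "inv x \<otimes> x \<in> I" by (rule I_left[rotated]) simp
  then show False using one_not_in_I by simp
qed

lemma subring_scalars_plus_I: "subring scalars_plus_I R"
proof (rule subringI)
  interpret I: additive_subgroup I R by (rule additive_subgroup_I)
  have mem: "\<kappa> c \<oplus> i \<in> scalars_plus_I" if "i \<in> I" for c i
    using that unfolding scalars_plus_I_def by blast
  show "scalars_plus_I \<subseteq> carrier R" by (auto simp: scalars_plus_I_def I_carrier)
  show "\<one> \<in> scalars_plus_I" using mem[of \<zero> 1] by (simp add: scal_one)
  show "\<ominus> a \<in> scalars_plus_I" if a: "a \<in> scalars_plus_I" for a
  proof -
    obtain c i where ci: "a = \<kappa> c \<oplus> i" "i \<in> I" using a by (auto simp: scalars_plus_I_def)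
    then have "\<ominus> a = \<kappa> (- c) \<oplus> \<ominus> i" by (simp add: minus_add scal_minus I_carrier)
    then show ?thesis using mem ci(2) by simp
  qed
  fix a b assume "a \<in> scalars_plus_I" "b \<in> scalars_plus_I"
  then obtain c i d j where ab: "a = \<kappa> c \<oplus> i" "i \<in> I" "b = \<kappa> d \<oplus> j" "j \<in> I"
    by (auto simp: scalars_plus_I_def)
  note [simp] = I_carrier[OF ab(2)] I_carrier[OF ab(4)]
  have "a \<oplus> b = \<kappa> (c + d) \<oplus> (i \<oplus> j)" by (simp add: ab(1,3) scal_add a_ac)
  then show "a \<oplus> b \<in> scalars_plus_I" using mem ab(2,4) by simp
  have "a \<otimes> b = (\<kappa> c \<otimes> \<kappa> d \<oplus> i \<otimes> \<kappa> d) \<oplus> (\<kappa> c \<otimes> j \<oplus> i \<otimes> j)"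
    by (simp add: ab(1,3) l_distr r_distr)
  also have "i \<otimes> \<kappa> d = \<kappa> d \<otimes> i" by (rule scal_central) simp
  finally have "a \<otimes> b = \<kappa> (c * d) \<oplus> (\<kappa> d \<otimes> i \<oplus> (\<kappa> c \<otimes> j \<oplus> i \<otimes> j))"
    by (simp add: scal_mult a_assoc)
  moreover have "\<kappa> d \<otimes> i \<oplus> (\<kappa> c \<otimes> j \<oplus> i \<otimes> j) \<in> I"
    using ab(2,4) I_weyl_ring by (intro I.a_closed I_left) auto
  ultimately show "a \<otimes> b \<in> scalars_plus_I" using mem by simp
qed

text \<open>
  The identity \<open>x\<^sup>i f(w) u = (x\<^sup>i u) f(t\<inverse>w)\<close> expresses \<open>Bu\<close> through the elements \<open>x\<^sup>i u\<close> and \<open>w =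
  (t - 1)xu + 1\<close>.
\<close>

lemma I_in_subring:
  assumes T: "subring T R" "range \<kappa> \<subseteq> T" "\<And>i::int. x [^] i \<otimes> u \<in> T"
  shows "I \<subseteq> T"
proof
  note TE = subringE[OF T(1)]
  have scale: "c \<bullet> a \<in> T" if "a \<in> T" for c a
    using that T(2) TE(6) by (auto simp: scale_def)
  have "w = (t - 1) \<bullet> (x [^] (1::int) \<otimes> u) \<oplus> \<one>" by (simp add: w_eq x_pow_1)
  then have w: "w \<in> T" using scale T(3) TE(3,7) by simp
  have u_poly: "poly_value w f \<otimes> u = u \<otimes> poly_value w (pcompose f [:0, inverse t:])" for f
  proof (rule skew_commute_poly_value)
    have "x [^] (-1::int) \<otimes> w = t \<bullet> (w \<otimes> x [^] (-1::int))"
      using t_nonzero by (simp add: w_x_pow scale_assoc scale_one_zero_neg power_int_minus)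
    then have winv: "w \<otimes> inv x = inverse t \<bullet> (inv x \<otimes> w)"
      using t_nonzero by (simp add: x_pow_minus_1 scale_assoc scale_one_zero_neg)
    have comm: "w \<otimes> (w \<ominus> \<one>) = (w \<ominus> \<one>) \<otimes> w"
      unfolding w_minus_1_poly_value by (rule poly_value_commutes) simp
    let ?c = "inverse (t - 1)"
    have "w \<otimes> u = ?c \<bullet> ((w \<otimes> inv x) \<otimes> (w \<ominus> \<one>))"
      by (subst u_eq) (simp add: scale_assoc m_assoc)
    also have "\<dots> = inverse t \<bullet> ?c \<bullet> (inv x \<otimes> (w \<otimes> (w \<ominus> \<one>)))"
      unfolding winv by (simp add: scale_assoc m_assoc mult.commute)
    also have "\<dots> = inverse t \<bullet> (?c \<bullet> (inv x \<otimes> (w \<ominus> \<one>)) \<otimes> w)"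
      unfolding comm by (simp add: scale_assoc m_assoc)
    also have "\<dots> = inverse t \<bullet> (u \<otimes> w)" by (subst u_eq[symmetric]) simp
    finally show "w \<otimes> u = inverse t \<bullet> (u \<otimes> w)" .
  qed simp_all
  have "b \<otimes> u \<in> T" if "b \<in> additive_span R {} weyl_terms" for b
    using that
  proof induction
    case (base e)
    then obtain i :: int and f where "e = x [^] i \<otimes> poly_value w f" by (auto simp: weyl_terms_def)
    then have "e \<otimes> u = (x [^] i \<otimes> u) \<otimes> poly_value w (pcompose f [:0, inverse t:])"
      by (simp add: m_assoc u_poly)
    then show ?case
      using poly_value_in_subring[OF w_closed T(1,2) w] T(3) TE(6) by simp
  next
    case (add a b)
    then show ?case using TE(7) by (simp add: l_distr weyl_span_carrier)
  qed simp
  then show "a \<in> T" if "a \<in> I" for a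
    using that weyl_ring_span by (auto simp: I_def)
qed

end

section \<open>The Virasoro generators\<close>

text \<open>
  The universal property of a presentation, for the map that evaluates representatives.
\<close>

lemma presented_eval_hom:
  fixes \<theta> :: "('g, 'k::ring_1) free_algebra \<Rightarrow> 'a"
  assumes \<theta>: "\<theta> \<in> ring_hom ring_of_type_algebra R" and R: "ring R"
    and rels: "\<And>r. r \<in> S \<Longrightarrow> \<theta> r = \<zero>\<^bsub>R\<^esub>"
  shows "(\<lambda>C. the_elem (\<theta> ` C)) \<in> ring_hom (presented_algebra S) R"
proof -
  note hom = presented_class_hom[of S]
  note eval = presented_class_eval[OF \<theta> R rels]
  have add: "presented_class S f \<oplus>\<^bsub>presented_algebra S\<^esub> presented_class S g =
      presented_class S (f + g)"
    and mult: "presented_class S f \<otimes>\<^bsub>presented_algebra S\<^esub> presented_class S g =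
      presented_class S (f * g)"
    for f g
    using ring_hom_add[OF hom, of f g] ring_hom_mult[OF hom, of f g]
    by (simp_all add: ring_of_type_algebra_simps)
  have one: "\<one>\<^bsub>presented_algebra S\<^esub> = presented_class S 1"
    using ring_hom_one[OF hom] by (simp add: ring_of_type_algebra_simps)
  show ?thesis
    using ring_hom_closed[OF \<theta>] ring_hom_add[OF \<theta>] ring_hom_mult[OF \<theta>] ring_hom_one[OF \<theta>]
    by (intro ring_hom_memI)
       (auto simp: carrier_presented_algebra add mult one eval ring_of_type_algebra_simps)
qed

text \<open>
  Multiplying \<open>yx = q xy + z\<close> by \<open>z\<inverse>\<close> and using \<open>z\<inverse>x = p xz\<inverse>\<close> gives the relation of \<open>u = z\<inverse>y\<close> with
  \<open>x\<close>. If \<open>u\<close> and \<open>x\<close> commuted, then \<open>yx - p\<inverse>xy\<close> would vanish.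
\<close>

lemma localized_weyl_of_H_triple:
  fixes R (structure) and \<kappa> :: "'k::alg_closed_field \<Rightarrow> 'a"
  assumes "H_triple R \<kappa> p q x y z" and div: "is_division_ring R" and z: "z \<noteq> \<zero>"
    and comm: "H_triple.commutator_element R \<kappa> p x y \<noteq> \<zero>"
    and root: "\<And>n. n > 0 \<Longrightarrow> (p * q) ^ n \<noteq> 1"
  shows "localized_weyl R \<kappa> (p * q) x (inv z \<otimes> y)"
    and "L_elem R x y z n =
      central_algebra.scale R \<kappa> (p powi (n + 1)) (x [^] (n + 1) \<otimes> (inv z \<otimes> y))"
proof -
  interpret H_triple R \<kappa> p q x y z by fact
  have units: "Units R = carrier R - {\<zero>}" using div by (simp add: is_division_ring_def)
  have zu: "z \<in> Units R" using z by (simp add: units)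
  have zi [simp]: "inv z \<in> carrier R" using zu by simp
  have x: "x \<noteq> \<zero>"
  proof
    assume "x = \<zero>"
    then show False using yx z by simp
  qed
  then have xu: "x \<in> Units R" by (simp add: units)
  have zx_inv: "inv z \<otimes> x = p \<bullet> (x \<otimes> inv z)"
  proof -
    have "x \<otimes> z = p \<bullet> (z \<otimes> x)" using p by (simp add: zx scale_assoc scale_one_zero_neg)
    then have "inv z \<otimes> (x \<otimes> z) \<otimes> inv z = p \<bullet> ((inv z \<otimes> z) \<otimes> x \<otimes> inv z)"
      by (simp add: scale_assoc m_assoc)
    moreover have "inv z \<otimes> (x \<otimes> z) \<otimes> inv z = inv z \<otimes> x"
      using zu by (simp add: m_assoc)
    ultimately show ?thesis using zu by simp
  qed
  have ux: "(inv z \<otimes> y) \<otimes> x = (p * q) \<bullet> (x \<otimes> (inv z \<otimes> y)) \<oplus> \<one>"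
  proof -
    have "(inv z \<otimes> y) \<otimes> x = q \<bullet> ((inv z \<otimes> x) \<otimes> y) \<oplus> inv z \<otimes> z"
      by (simp add: m_assoc yx r_distr scale_assoc)
    then show ?thesis
      unfolding zx_inv using zu by (simp add: scale_assoc m_assoc mult.commute)
  qed
  have "(inv z \<otimes> y) \<otimes> x \<noteq> x \<otimes> (inv z \<otimes> y)"
  proof
    assume eq: "(inv z \<otimes> y) \<otimes> x = x \<otimes> (inv z \<otimes> y)"
    have "x \<otimes> inv z = inverse p \<bullet> (inv z \<otimes> x)"
      using p by (simp add: zx_inv scale_assoc scale_one_zero_neg)
    then have "x \<otimes> (inv z \<otimes> y) = inv z \<otimes> (inverse p \<bullet> (x \<otimes> y))"
      by (simp add: scale_assoc m_assoc flip: m_assoc[of x "inv z" y])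
    then have "inv z \<otimes> (y \<otimes> x) = inv z \<otimes> (inverse p \<bullet> (x \<otimes> y))"
      using eq by (simp add: m_assoc)
    then have "y \<otimes> x = inverse p \<bullet> (x \<otimes> y)"
      using Units_l_cancel[OF Units_inv_Units[OF zu]] by simp
    then show False using comm by (simp add: commutator_element_def a_minus_def r_neg)
  qed
  then show "localized_weyl R \<kappa> (p * q) x (inv z \<otimes> y)"
    by unfold_locales (simp_all add: units x ux p q root del: m_assoc)
  show "L_elem R x y z n = (p powi (n + 1)) \<bullet> (x [^] (n + 1) \<otimes> (inv z \<otimes> y))"
    unfolding L_elem_def skew_commute_int_pow[OF zx_inv zi xu p]
    using unit_int_pow_closed[OF xu] by (simp add: scale_assoc m_assoc)
qed

lemma B_alg_eq:
  assumes "localized_weyl Q \<kappa> t x (inv\<^bsub>Q\<^esub> z \<otimes>\<^bsub>Q\<^esub> y)"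
  shows "B_alg Q \<kappa> x y z =
    Q\<lparr>carrier := localized_weyl.weyl_ring Q \<kappa> x (inv\<^bsub>Q\<^esub> z \<otimes>\<^bsub>Q\<^esub> y)\<rparr>"
  unfolding B_alg_def B'_set_def subalgebra_generated_def localized_weyl.weyl_ring_def[OF assms] ..

context localized_weyl
begin

text \<open>
  In terms of \<open>w\<close> the generators are \<open>x\<^sup>n (w - 1)\<close> up to a scalar, and the Virasoro relations
  become identities between quadratic polynomials in \<open>w\<close>.
\<close>

lemma x_pow_u: "x [^] (n + 1 :: int) \<otimes> u = inverse (t - 1) \<bullet> (x [^] n \<otimes> poly_value w [:- 1, 1:])"
proof -
  have "x [^] n = x [^] (n + 1) \<otimes> inv x"
    using x_pow_add[of "n + 1" "- 1"] by (simp add: x_pow_minus_1)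
  then show ?thesis
    unfolding w_minus_1_poly_value[symmetric] by (subst u_eq) (simp add: scale_assoc m_assoc)
qed

lemma Virasoro_relation:
  assumes t: "t = p * q" and p: "p \<noteq> 0" and q: "q \<noteq> 0"
    and L: "\<And>n::int. L n = (p powi (n + 1)) \<bullet> (x [^] (n + 1) \<otimes> u)"
  shows "(p powi (n - m)) \<bullet> (L n \<otimes> L m) \<ominus> (q powi (m - n)) \<bullet> (L m \<otimes> L n)
      \<ominus> pq_bracket p q (m - n) \<bullet> L (m + n) = \<zero>"
proof -
  define c where "c = inverse (t - 1)"
  let ?g = "[:- 1, 1:]"
  have L': "L n = (p powi (n + 1) * c) \<bullet> (x [^] n \<otimes> poly_value w ?g)" for n
    unfolding L x_pow_u by (simp add: scale_assoc c_def)
  have LL: "L n \<otimes> L m = (p powi (n + 1) * p powi (m + 1) * c ^ 2) \<bullet>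
      (x [^] (n + m) \<otimes> poly_value w ([:- 1, t powi m:] * ?g))" for n m
  proof -
    have "L n \<otimes> L m = (p powi (n + 1) * c * (p powi (m + 1) * c)) \<bullet>
        ((x [^] n \<otimes> poly_value w ?g) \<otimes> (x [^] m \<otimes> poly_value w ?g))"
      unfolding L' by (simp add: scale_assoc mult.commute)
    also have "pcompose ?g [:0, t powi m:] = [:- 1, t powi m:]" by (simp add: pcompose_pCons)
    then have "(x [^] n \<otimes> poly_value w ?g) \<otimes> (x [^] m \<otimes> poly_value w ?g) =
        x [^] (n + m) \<otimes> poly_value w ([:- 1, t powi m:] * ?g)"
      unfolding term_mult by (simp only:)
    finally show ?thesis by (simp only: power2_eq_square mult_ac)
  qed
  define P where "P = p powi (n + 1) * p powi (m + 1) * c ^ 2"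
  define A where "A = p powi (n - m) * P"
  define B where "B = q powi (m - n) * P"
  define C where "C = pq_bracket p q (m - n) * (p powi (m + n + 1) * c)"
  have pq: "p * q \<noteq> 1" using t t_not_1 by simp
  have bracket: "pq_bracket p q (m - n) = (q powi (m - n) - p powi (n - m)) * (p * c)"
  proof -
    have "q - inverse p = (p * q - 1) / p" using p by (simp add: field_simps)
    then show ?thesis
      using p pq by (simp add: pq_bracket_def c_def t field_simps)
  qed
  have "A * t powi m = B * t powi n"
    using p q by (simp add: A_def B_def t power_int_mult_distrib power_int_diff)
  moreover have "B - A = C"
    using p q by (simp add: A_def B_def C_def P_def bracket power_int_add power2_eq_square algebra_simps)
  ultimately have "smult A [:- 1, t powi m:] - smult B [:- 1, t powi n:] - [:C:] = 0"
    by simp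
  then have "(smult A [:- 1, t powi m:] - smult B [:- 1, t powi n:] - [:C:]) * ?g = 0"
    by (simp only: mult_zero_left)
  then have poly:
    "smult A ([:- 1, t powi m:] * ?g) + - smult B ([:- 1, t powi n:] * ?g) + - smult C ?g = 0"
    by (simp add: algebra_simps)
  have "(p powi (n - m)) \<bullet> (L n \<otimes> L m) =
      x [^] (n + m) \<otimes> poly_value w (smult A ([:- 1, t powi m:] * ?g))"
    unfolding LL poly_value_smult[OF w_closed]
    by (simp only: scale_assoc A_def P_def x_pow_closed poly_value_closed w_closed m_closed)
  moreover have "(q powi (m - n)) \<bullet> (L m \<otimes> L n) =
      x [^] (n + m) \<otimes> poly_value w (smult B ([:- 1, t powi n:] * ?g))"
    unfolding LL poly_value_smult[OF w_closed]
    by (simp only: scale_assoc B_def P_def x_pow_closed poly_value_closed w_closed m_closed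
        add.commute[of m n] mult.commute[of "p powi (m + 1)"])
  moreover have "pq_bracket p q (m - n) \<bullet> L (m + n) = x [^] (n + m) \<otimes> poly_value w (smult C ?g)"
    unfolding L' poly_value_smult[OF w_closed]
    by (simp only: scale_assoc C_def x_pow_closed poly_value_closed w_closed m_closed
        add.commute[of m n])
  ultimately have "(p powi (n - m)) \<bullet> (L n \<otimes> L m) \<ominus> (q powi (m - n)) \<bullet> (L m \<otimes> L n)
      \<ominus> pq_bracket p q (m - n) \<bullet> L (m + n) =
    x [^] (n + m) \<otimes> poly_value w
      (smult A ([:- 1, t powi m:] * ?g) + - smult B ([:- 1, t powi n:] * ?g) + - smult C ?g)"
    unfolding poly_value_add[OF w_closed] poly_value_minus[OF w_closed]
    by (simp only: a_minus_def r_distr r_minus x_pow_closed poly_value_closed w_closed m_closed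
        a_inv_closed a_closed)
  then show ?thesis unfolding poly by simp
qed

end

section \<open>Restricting modules to the subalgebra generated by the derivations\<close>

context localized_weyl
begin

abbreviation weyl_alg where "weyl_alg \<equiv> R\<lparr>carrier := weyl_ring\<rparr>"
abbreviation weyl_mod where "weyl_mod \<equiv> regular_module weyl_alg"

lemma ring_weyl_alg: "ring weyl_alg"
  by (rule subring_is_ring[OF subring_weyl_ring])

lemma central_algebra_weyl_alg: "central_algebra weyl_alg \<kappa>"
  unfolding central_algebra_def central_algebra_axioms_def
proof (intro conjI allI impI ring_weyl_alg)
  fix c r assume "r \<in> carrier weyl_alg"
  then have "r \<in> carrier R" using weyl_ring_carrier by simp
  from scal_central[OF this] show "r \<otimes>\<^bsub>weyl_alg\<^esub> \<kappa> c = \<kappa> c \<otimes>\<^bsub>weyl_alg\<^esub> r" by simp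
qed (simp_all add: scal_one scal_add scal_mult)

lemma weyl_mod_simps:
  "carrier weyl_mod = weyl_ring" "\<zero>\<^bsub>weyl_mod\<^esub> = \<zero>" "a \<oplus>\<^bsub>weyl_mod\<^esub> b = a \<oplus> b" "a \<odot>\<^bsub>weyl_mod\<^esub> b = a \<otimes> b"
  by (simp_all add: regular_module_def)

lemma additive_subgroupI_scale:
  assumes "P \<subseteq> carrier R" "\<zero> \<in> P" "\<And>a b. a \<in> P \<Longrightarrow> b \<in> P \<Longrightarrow> a \<oplus> b \<in> P"
    and scale: "\<And>c a. a \<in> P \<Longrightarrow> \<kappa> c \<otimes> a \<in> P"
  shows "additive_subgroup P R"
proof (rule additive_subgroupI, rule add.subgroupI)
  show "\<ominus> a \<in> P" if "a \<in> P" for a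
    using scale[OF that, of "- 1"] assms(1) that by (auto simp: scal_minus scal_one l_minus)
qed (use assms in auto)

sublocale weyl_mod: plain_left_module weyl_alg weyl_mod
  by (simp add: plain_left_module_def left_module_regular ring_weyl_alg)

lemma submodule_I: "submodule I weyl_alg weyl_mod"
proof -
  interpret I: additive_subgroup I R by (rule additive_subgroup_I)
  show ?thesis
    by (rule weyl_mod.submoduleI) (use I_weyl_ring I_left in \<open>auto simp: weyl_mod_simps\<close>)
qed

lemma scalars_plus_I_weyl_ring: "scalars_plus_I \<subseteq> weyl_ring"
  using I_weyl_ring weyl_ring_closed(5) by (auto simp: scalars_plus_I_def)

lemma u_in_I: "u \<in> I"
  unfolding I_def using weyl_ring_closed(2) by (intro image_eqI[of _ _ \<one>]) simp_all

lemma I_maximal_submodule: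
  assumes P: "submodule P weyl_alg weyl_mod" "I \<subseteq> P"
  shows "P = I \<or> P = carrier weyl_alg"
proof -
  note PE = submoduleE[OF P(1), unfolded weyl_mod_simps partial_object.simps]
  have "additive_subgroup P R"
    by (rule additive_subgroupI_scale) (use PE weyl_ring_carrier in auto)
  then show ?thesis
    using I_maximal[of P] P(2) PE(1,5) by auto
qed

text \<open>
  A subgroup \<open>N\<close> stable under \<open>B u\<close> contains \<open>B u n\<close> for every \<open>n \<in> N\<close>.  In a simple module either
  some \<open>B u n\<close> is everything, or \<open>u\<close> kills \<open>N\<close>, and a non-zero vector of \<open>N\<close> then generates a copy of
  \<open>B / B u\<close>.
\<close>

theorem simple_restrict_scalars:
  assumes S: "ring S" and \<phi>: "\<phi> \<in> ring_hom S weyl_alg" and I: "I \<subseteq> \<phi> ` carrier S"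
    and M: "simple_left_module weyl_alg M"
    and not_iso: "\<not> left_module_iso weyl_alg M (quotient_module weyl_mod I)"
  shows "simple_left_module S (restrict_scalars \<phi> M)"
  unfolding simple_left_module_def
proof (intro conjI allI impI)
  interpret M: plain_left_module weyl_alg M
    using M by (simp add: simple_left_module_def plain_left_module_def)
  let ?M = "restrict_scalars \<phi> M"
  have M_simps: "carrier ?M = carrier M" "\<zero>\<^bsub>?M\<^esub> = \<zero>\<^bsub>M\<^esub>" "a \<oplus>\<^bsub>?M\<^esub> b = a \<oplus>\<^bsub>M\<^esub> b"
    "s \<odot>\<^bsub>?M\<^esub> a = \<phi> s \<odot>\<^bsub>M\<^esub> a" for a b s
    by (simp_all add: restrict_scalars_def)
  show "left_module S ?M"
    by (rule left_module_restrict_scalars[OF S \<phi> M.left_module_axioms])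
  show "carrier ?M \<noteq> {\<zero>\<^bsub>?M\<^esub>}"
    using M unfolding simple_left_module_def M_simps by blast
  fix N assume "submodule N S ?M"
  note NE = submoduleE[OF this, unfolded M_simps]
  have stable: "a \<odot>\<^bsub>M\<^esub> n \<in> N" if "a \<in> I" "n \<in> N" for a n
    using I NE(5) that by blast
  \<comment> \<open>the largest \<open>B\<close>-submodule contained in \<open>N\<close>\<close>
  define N0 where "N0 = {n \<in> N. \<forall>b\<in>weyl_ring. b \<odot>\<^bsub>M\<^esub> n \<in> N}"
  have N0_carrier: "n \<in> carrier M" if "n \<in> N0" for n
    using that NE(1) by (auto simp: N0_def)
  have "submodule N0 weyl_alg M"
  proof (rule M.submoduleI)
    show "N0 \<subseteq> carrier M" using N0_carrier by blast
    show "\<zero>\<^bsub>M\<^esub> \<in> N0" using NE(2) M.smult_zero by (simp add: N0_def)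
    show "a \<oplus>\<^bsub>M\<^esub> b \<in> N0" if "a \<in> N0" "b \<in> N0" for a b
      using that N0_carrier NE(3) by (simp add: N0_def M.smult_r_distr)
    show "r \<odot>\<^bsub>M\<^esub> a \<in> N0" if ra: "r \<in> carrier weyl_alg" "a \<in> N0" for r a
    proof -
      have "b \<odot>\<^bsub>M\<^esub> (r \<odot>\<^bsub>M\<^esub> a) = (b \<otimes> r) \<odot>\<^bsub>M\<^esub> a" if "b \<in> weyl_ring" for b
        using M.smult_assoc[of b r a] ra N0_carrier that by simp
      then show ?thesis using ra by (simp add: N0_def weyl_ring_closed)
    qed
  qed
  then consider "N0 = {\<zero>\<^bsub>M\<^esub>}" | "N0 = carrier M"
    using M unfolding simple_left_module_def by blast
  then show "N = {\<zero>\<^bsub>?M\<^esub>} \<or> N = carrier ?M"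
  proof cases
    case 1
    have kill: "u \<odot>\<^bsub>M\<^esub> n = \<zero>\<^bsub>M\<^esub>" if n: "n \<in> N" for n
    proof -
      have nc: "n \<in> carrier M" using n NE(1) by blast
      have "b \<odot>\<^bsub>M\<^esub> (u \<odot>\<^bsub>M\<^esub> n) \<in> N" if b: "b \<in> weyl_ring" for b
        using stable[OF I_left[OF b u_in_I] n] M.smult_assoc[of b u n] nc b by simp
      moreover have "u \<odot>\<^bsub>M\<^esub> n \<in> N"
        by (rule stable[OF u_in_I n])
      ultimately have "u \<odot>\<^bsub>M\<^esub> n \<in> N0" by (simp add: N0_def)
      then show ?thesis using 1 by simp
    qed
    have "n = \<zero>\<^bsub>M\<^esub>" if n: "n \<in> N" for n
    proof (rule ccontr)
      assume nz: "n \<noteq> \<zero>\<^bsub>M\<^esub>"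
      have nc: "n \<in> carrier M" using n NE(1) by blast
      have "left_module_iso weyl_alg M (quotient_module weyl_mod I)"
      proof (rule M.simple_module_iso_quotient[OF M submodule_I _ nc nz])
        show "P = I \<or> P = carrier weyl_alg" if "submodule P weyl_alg weyl_mod" "I \<subseteq> P" for P
          using that by (rule I_maximal_submodule)
        fix a assume "a \<in> I"
        then obtain b where b: "b \<in> weyl_ring" "a = b \<otimes> u" by (auto simp: I_def)
        then have "a \<odot>\<^bsub>M\<^esub> n = b \<odot>\<^bsub>M\<^esub> (u \<odot>\<^bsub>M\<^esub> n)"
          using M.smult_assoc[of b u n] nc by simp
        also have "\<dots> = \<zero>\<^bsub>M\<^esub>"
          unfolding kill[OF n] by (rule M.smult_zero) (simp add: b)
        finally show "a \<odot>\<^bsub>M\<^esub> n = \<zero>\<^bsub>M\<^esub>" .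
      qed
      then show False using not_iso by blast
    qed
    then have "N = {\<zero>\<^bsub>M\<^esub>}" using NE(2) by blast
    then show ?thesis by (simp add: M_simps)
  next
    case 2
    then have "N = carrier M" using NE(1) by (auto simp: N0_def)
    then show ?thesis by (simp add: M_simps)
  qed
qed

text \<open>
  The scalars and the elements \<open>x\<^sup>i u\<close> in the image of \<open>\<phi>\<close> suffice to make \<open>B / (k + I)\<close> simple,
  while \<open>(k + I) / I\<close> is one-dimensional over \<open>k\<close>.
\<close>

theorem composition_series_restrict_scalars:
  assumes S: "ring S" and \<phi>: "\<phi> \<in> ring_hom S weyl_alg"
    and image: "range \<kappa> \<subseteq> \<phi> ` carrier S" "\<And>i::int. x [^] i \<otimes> u \<in> \<phi> ` carrier S"
      "\<phi> ` carrier S \<subseteq> scalars_plus_I"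
  shows "composition_series S (restrict_scalars \<phi> (quotient_module weyl_mod I))
    [carrier (quotient_module weyl_mod I), (\<lambda>b. I +>\<^bsub>weyl_mod\<^esub> b) ` scalars_plus_I, {I}]"
proof -
  interpret I: additive_subgroup I R by (rule additive_subgroup_I)
  let ?M = "restrict_scalars \<phi> weyl_mod"
  have cosets: "I +>\<^bsub>?M\<^esub> b = I +>\<^bsub>weyl_mod\<^esub> b" for b
    by (simp add: a_r_coset_def' restrict_scalars_def)
  have quotient: "restrict_scalars \<phi> (quotient_module weyl_mod I) = quotient_module ?M I"
    by (simp add: restrict_scalars_def quotient_module_def A_RCOSETS_def'
        a_r_coset_def' set_add_def' fun_eq_iff)
  have M_simps: "carrier ?M = weyl_ring" "\<zero>\<^bsub>?M\<^esub> = \<zero>" "a \<oplus>\<^bsub>?M\<^esub> b = a \<oplus> b" "s \<odot>\<^bsub>?M\<^esub> a = \<phi> s \<otimes> a" for a b s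
    by (simp_all add: restrict_scalars_def weyl_mod_simps)
  interpret M: plain_left_module S ?M
    unfolding plain_left_module_def
    by (rule left_module_restrict_scalars[OF S \<phi> weyl_mod.left_module_axioms])
  have \<phi>_weyl: "\<phi> s \<in> weyl_ring" if "s \<in> carrier S" for s
    using ring_hom_closed[OF \<phi> that] by simp
  have \<phi>_scalars: "\<phi> s \<in> scalars_plus_I" if "s \<in> carrier S" for s
    using image(3) that by blast
  have submodule_facts: "additive_subgroup P R" "P \<subseteq> weyl_ring" "\<And>c a. a \<in> P \<Longrightarrow> c \<bullet> a \<in> P"
    "\<And>(i::int) a. a \<in> P \<Longrightarrow> (x [^] i \<otimes> u) \<otimes> a \<in> P" if P: "submodule P S ?M" for P
  proof -
    note PE = submoduleE[OF P, unfolded M_simps]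
    have mult: "b \<otimes> a \<in> P" if "a \<in> P" "b \<in> \<phi> ` carrier S" for a b
      using that PE(5) by blast
    show sub: "P \<subseteq> weyl_ring" by (rule PE(1))
    have scalars: "\<kappa> c \<otimes> a \<in> P" if "a \<in> P" for c a
      by (rule mult[OF that]) (use image(1) in blast)
    then show "c \<bullet> a \<in> P" if "a \<in> P" for c a
      using that by (simp only: scale_def)
    show "additive_subgroup P R"
    proof (rule additive_subgroupI_scale)
      show "P \<subseteq> carrier R" using sub weyl_ring_carrier by blast
    qed (fact PE(2), fact PE(3), fact scalars)
    show "(x [^] i \<otimes> u) \<otimes> a \<in> P" if "a \<in> P" for i :: int and a
      using mult[OF that image(2)] .
  qed
  note K = subringE[OF subring_scalars_plus_I]
  have K_mem: "\<kappa> c \<oplus> a \<in> scalars_plus_I" if "a \<in> I" for c a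
    using that unfolding scalars_plus_I_def by blast
  have I_K: "I \<subseteq> scalars_plus_I"
    using K_mem[of _ 0] by (auto simp: scal_zero I_carrier)
  note K_weyl = scalars_plus_I_weyl_ring
  have sub_I: "submodule I S ?M"
    by (rule M.submoduleI) (use I_weyl_ring I_left \<phi>_weyl in \<open>auto simp: M_simps\<close>)
  have sub_K: "submodule scalars_plus_I S ?M"
    by (rule M.submoduleI) (use K_weyl K(2,6,7) \<phi>_scalars in \<open>auto simp: M_simps\<close>)
  have "composition_series S (quotient_module ?M I)
    [carrier (quotient_module ?M I), (\<lambda>b. I +>\<^bsub>?M\<^esub> b) ` scalars_plus_I, {I}]"
  proof (rule M.composition_series_quotient[OF sub_I sub_K])
    show "I \<subset> scalars_plus_I"
      using I_K one_not_in_I K(3) by blast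
    show "scalars_plus_I \<subset> carrier ?M"
      unfolding M_simps using K_weyl x_not_in_scalars_plus_I weyl_ring_gens(2) by blast
    fix P assume P: "submodule P S ?M"
    note facts = submodule_facts[OF P]
    show "P = scalars_plus_I \<or> P = carrier ?M" if "scalars_plus_I \<subseteq> P"
      unfolding M_simps by (rule scalars_plus_I_maximal[OF facts(1) that facts(2-4)])
    show "P = I \<or> P = scalars_plus_I" if P: "I \<subseteq> P" "P \<subseteq> scalars_plus_I"
    proof (cases "P \<subseteq> I")
      case False
      interpret P: additive_subgroup P R by (rule facts(1))
      obtain a where a: "a \<in> P" "a \<notin> I" using False by blast
      then obtain c i where ci: "a = \<kappa> c \<oplus> i" "i \<in> I" using P(2) by (auto simp: scalars_plus_I_def)
      then have "\<ominus> i \<in> P" using P(1) by auto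
      then have "a \<oplus> \<ominus> i \<in> P" using a(1) by simp
      then have c: "\<kappa> c \<in> P" using ci I_carrier[OF ci(2)] by (simp add: a_assoc r_neg)
      have "c \<noteq> 0" using a(2) ci I_carrier[OF ci(2)] by (auto simp: scal_zero)
      then have "\<kappa> d \<in> P" for d
        using facts(3)[OF c, of "d / c"] by (simp add: scale_def flip: scal_mult)
      then have "scalars_plus_I \<subseteq> P" using P(1) by (auto simp: scalars_plus_I_def)
      then show ?thesis using P(2) by blast
    qed (use P in blast)
  qed
  then show ?thesis
    unfolding quotient by (simp add: cosets quotient[symmetric]) (simp add: restrict_scalars_def)
qed

end

theorem proposition7p5:
  fixes p q :: "'k :: {alg_closed_field, field_char_0}"
    and Q :: "'q ring" and \<kappa> :: "'k \<Rightarrow> 'q" and x y z :: 'q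
    and M :: "('q, 'm) module"
  defines "B \<equiv> B_alg Q \<kappa> x y z"
    and "V \<equiv> V_set Q \<kappa> x y z"
    and "\<phi> \<equiv> Virasoro_map Q \<kappa> x y z"
  defines "I \<equiv> carrier B #>\<^bsub>B\<^esub> (inv\<^bsub>Q\<^esub> z \<otimes>\<^bsub>Q\<^esub> y)"
  defines "BI \<equiv> quotient_module (regular_module B) I"
  assumes "uncountable (UNIV :: 'k set)"
    and "p \<noteq> 0" and "q \<noteq> 0"
    and "independent_case p q Q \<kappa> x y z \<or> dependent_case p q Q \<kappa> x y z"
  shows "(simple_left_module B M \<and> \<not> left_module_iso B M BI \<longrightarrow>
            simple_left_module (Virasoro_alg p q) (restrict_scalars \<phi> M)) \<and>
         composition_series (Virasoro_alg p q) (restrict_scalars \<phi> BI)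
           [carrier BI,
            a_rcosets\<^bsub>B\<lparr>carrier := V <+>\<^bsub>B\<^esub> I\<rparr>\<^esub> I,
            {\<zero>\<^bsub>BI\<^esub>}]"
proof -
  note pq = \<open>p \<noteq> 0\<close> \<open>q \<noteq> 0\<close> and cases = assms(9)
  have div: "is_division_ring Q" and triple: "H_triple Q \<kappa> p q x y z"
    and nonzero: "z \<noteq> \<zero>\<^bsub>Q\<^esub>" "H_triple.commutator_element Q \<kappa> p x y \<noteq> \<zero>\<^bsub>Q\<^esub>"
    using cases independent_case_division[OF pq] independent_case_triple[OF pq]
      independent_case_nonzero[OF pq] dependent_case_division[OF pq] dependent_case_triple[OF pq]
      dependent_case_nonzero[OF pq] by metis+
  define u where "u = inv\<^bsub>Q\<^esub> z \<otimes>\<^bsub>Q\<^esub> y"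
  define L where "L = L_elem Q x y z"
  note root = product_not_root_of_unity[OF pq cases]
  have weyl: "localized_weyl Q \<kappa> (p * q) x (inv\<^bsub>Q\<^esub> z \<otimes>\<^bsub>Q\<^esub> y)"
    by (rule localized_weyl_of_H_triple(1)[OF triple div nonzero root])
  interpret W: localized_weyl Q \<kappa> "p * q" x u
    unfolding u_def by (rule weyl)
  have L_eq: "L n = W.scale (p powi (n + 1)) (x [^]\<^bsub>Q\<^esub> (n + 1) \<otimes>\<^bsub>Q\<^esub> u)" for n
    unfolding u_def L_def by (rule localized_weyl_of_H_triple(2)[OF triple div nonzero root])
  have B_eq: "B = W.weyl_alg"
    unfolding B_def u_def by (rule B_alg_eq[OF weyl])
  have I_eq: "I = W.I"
    unfolding I_def u_def[symmetric] W.I_def B_eq by (auto simp: r_coset_def)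
  have BI_eq: "BI = quotient_module W.weyl_mod W.I"
    unfolding BI_def I_eq B_eq ..
  interpret B: central_algebra B \<kappa>
    unfolding B_eq by (rule W.central_algebra_weyl_alg)
  have B_simps: "carrier B = W.weyl_ring" "\<one>\<^bsub>B\<^esub> = \<one>\<^bsub>Q\<^esub>" "\<zero>\<^bsub>B\<^esub> = \<zero>\<^bsub>Q\<^esub>" "a \<oplus>\<^bsub>B\<^esub> b = a \<oplus>\<^bsub>Q\<^esub> b"
    "a \<otimes>\<^bsub>B\<^esub> b = a \<otimes>\<^bsub>Q\<^esub> b" for a b
    by (simp_all add: B_eq)
  have scal_L: "L n \<in> W.I" for n
    unfolding L_eq by (intro W.I_scale) (auto simp: W.I_def)
  have L_closed: "L n \<in> carrier B" for n
    using scal_L W.I_weyl_ring B_simps(1) by blast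
  define \<theta> where "\<theta> = free_eval B \<kappa> L"
  have \<theta>_hom: "\<theta> \<in> ring_hom ring_of_type_algebra B"
    unfolding \<theta>_def by (rule B.free_eval_hom[OF L_closed])
  have \<theta>_scal: "\<theta> (scal c) = \<kappa> c" and \<theta>_gen: "\<theta> (gen n) = L n" for c n
    unfolding \<theta>_def by (rule B.free_eval_scal[OF L_closed], rule B.free_eval_gen[OF L_closed])
  \<comment> \<open>so that the value of \<open>Virasoro_map\<close> on a class is the value of \<open>\<theta>\<close> on any representative\<close>
  have \<theta>_rel: "\<theta> f = \<zero>\<^bsub>B\<^esub>" if rel: "f \<in> Virasoro_rels p q" for f
  proof -
    obtain m n where f: "f = scal (p powi (n - m)) * gen n * gen m -
        scal (q powi (m - n)) * gen m * gen n - scal (pq_bracket p q (m - n)) * gen (m + n)"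
      using rel unfolding Virasoro_rels_def by blast
    let ?g = "scal (p powi (n - m)) * gen n * gen m"
      and ?h = "scal (q powi (m - n)) * gen m * gen n + scal (pq_bracket p q (m - n)) * gen (m + n)"
    have \<kappa>: "\<kappa> = (\<lambda>c. \<theta> (scal c))" by (simp add: \<theta>_scal)
    note simps = free_hom_simps(1-3)[OF B.central_algebra_axioms \<theta>_hom \<kappa>] \<theta>_scal \<theta>_gen
    have Lc: "L n \<in> carrier Q" for n using scal_L by (rule W.I_carrier)
    let ?A = "W.scale (p powi (n - m)) (L n \<otimes>\<^bsub>Q\<^esub> L m)"
      and ?B = "W.scale (q powi (m - n)) (L m \<otimes>\<^bsub>Q\<^esub> L n)"
      and ?C = "W.scale (pq_bracket p q (m - n)) (L (m + n))"
    have closed: "?A \<in> carrier Q" "?B \<in> carrier Q" "?C \<in> carrier Q" by (simp_all add: Lc)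
    have "?A \<ominus>\<^bsub>Q\<^esub> (?B \<oplus>\<^bsub>Q\<^esub> ?C) = ?A \<ominus>\<^bsub>Q\<^esub> ?B \<ominus>\<^bsub>Q\<^esub> ?C"
      using closed by (simp add: a_minus_def W.minus_add W.a_assoc)
    also have "\<dots> = \<zero>\<^bsub>Q\<^esub>"
      by (rule W.Virasoro_relation[OF refl pq L_eq])
    finally have "?A = ?B \<oplus>\<^bsub>Q\<^esub> ?C"
      using closed by simp
    then have "\<theta> ?g = \<theta> ?h"
      by (simp add: simps B_simps W.scale_def W.m_assoc Lc)
    then have "\<theta> (?g - ?h) = \<zero>\<^bsub>B\<^esub>"
      by (simp add: free_hom_diff[OF B.central_algebra_axioms \<theta>_hom \<kappa>] simps(1))
    then show ?thesis by (simp add: f diff_diff_add)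
  qed
  have \<phi>_eq: "\<phi> = (\<lambda>C. the_elem (\<theta> ` C))"
    by (simp add: \<phi>_def Virasoro_map_def \<theta>_def L_def B_def fun_eq_iff)
  have \<phi>_hom: "\<phi> \<in> ring_hom (Virasoro_alg p q) W.weyl_alg"
    unfolding \<phi>_eq Virasoro_alg_def B_eq[symmetric]
    by (rule presented_eval_hom[OF \<theta>_hom B.ring_axioms \<theta>_rel])
  have \<phi>_image: "\<phi> ` carrier (Virasoro_alg p q) = range \<theta>"
    unfolding Virasoro_alg_def carrier_presented_algebra \<phi>_eq image_image
    by (simp only: presented_class_eval[OF \<theta>_hom B.ring_axioms \<theta>_rel])
  have \<theta>_hom_Q: "\<theta> \<in> ring_hom ring_of_type_algebra Q"
    using ring_hom_closed[OF \<theta>_hom] ring_hom_add[OF \<theta>_hom] ring_hom_mult[OF \<theta>_hom]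
      ring_hom_one[OF \<theta>_hom] W.weyl_ring_carrier
    by (intro ring_hom_memI) (simp_all add: B_simps)
  have subring_range: "subring (range \<theta>) Q"
    using ring_hom_ring.img_is_subring[OF ring_hom_ringI2[OF ring_type_algebra W.ring_axioms \<theta>_hom_Q]
        ring.carrier_is_subring[OF ring_type_algebra]]
    by (simp add: ring_of_type_algebra_simps)
  have scalars: "range \<kappa> \<subseteq> range \<theta>"
    by (auto simp flip: \<theta>_scal)
  have derivations: "x [^]\<^bsub>Q\<^esub> i \<otimes>\<^bsub>Q\<^esub> u \<in> range \<theta>" for i :: int
  proof -
    have "\<theta> (scal (p powi (- i)) * gen (i - 1)) = W.scale (p powi (- i)) (L (i - 1))"
      using ring_hom_mult[OF \<theta>_hom_Q, of "scal (p powi (- i))" "gen (i - 1)"]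
      by (simp add: ring_of_type_algebra_simps \<theta>_scal \<theta>_gen W.scale_def)
    also have "\<dots> = x [^]\<^bsub>Q\<^esub> i \<otimes>\<^bsub>Q\<^esub> u"
      unfolding L_eq using pq(1) by (simp add: W.scale_assoc W.scale_one_zero_neg power_int_minus)
    finally show ?thesis by (metis rangeI)
  qed
  have I_range: "W.I \<subseteq> range \<theta>"
    by (rule W.I_in_subring[OF subring_range scalars derivations])
  note K = subringE[OF W.subring_scalars_plus_I]
  have K_mem: "\<kappa> c \<oplus>\<^bsub>Q\<^esub> a \<in> W.scalars_plus_I" if "a \<in> W.I" for c a
    using that unfolding W.scalars_plus_I_def by blast
  have zero_I: "\<zero>\<^bsub>Q\<^esub> \<in> W.I"
    using additive_subgroup.zero_closed[OF W.additive_subgroup_I] .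
  have \<kappa>_K: "\<kappa> c \<in> W.scalars_plus_I" for c
    using K_mem[OF zero_I, of c] by simp
  have L_K: "L n \<in> W.scalars_plus_I" for n
    using K_mem[OF scal_L, of 0 n] W.I_carrier[OF scal_L] by (simp add: W.scal_zero)
  have range_K: "range \<theta> \<subseteq> W.scalars_plus_I"
  proof (rule image_subsetI)
    fix f show "\<theta> f \<in> W.scalars_plus_I"
      by (rule free_algebra_hom_in_subring[OF \<theta>_hom_Q W.subring_scalars_plus_I])
         (simp_all only: \<theta>_scal \<theta>_gen \<kappa>_K L_K)
  qed
  note K_weyl = W.scalars_plus_I_weyl_ring
  have minus_B: "\<ominus>\<^bsub>B\<^esub> a = \<ominus>\<^bsub>Q\<^esub> a" if "a \<in> W.weyl_ring" for a
    using that W.weyl_ring_closed(3) W.weyl_ring_carrier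
    by (intro B.minus_equality) (simp_all add: B_simps W.l_neg)
  have V: "V = generate_ring B (range \<kappa> \<union> range L)"
    by (simp add: V_def V_set_def subalgebra_generated_def B_def L_def)
  have V_K: "V \<subseteq> W.scalars_plus_I"
  proof
    fix v assume "v \<in> V"
    then show "v \<in> W.scalars_plus_I"
      unfolding V
    proof induction
      case (incl h)
      then show ?case using \<kappa>_K L_K by auto
    next
      case (a_inv h)
      then show ?case using minus_B[of h] K_weyl K(5) by auto
    qed (use K(3,6,7) in \<open>simp_all add: B_simps\<close>)
  qed
  have V_I: "V <+>\<^bsub>B\<^esub> I = W.scalars_plus_I"
  proof
    have "I \<subseteq> W.scalars_plus_I"
      using K_mem[of _ 0] W.I_carrier by (auto simp: I_eq W.scal_zero)
    then show "V <+>\<^bsub>B\<^esub> I \<subseteq> W.scalars_plus_I"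
      using V_K K(7) by (auto simp: set_add_def' B_simps)
    have "\<kappa> c \<in> V" for c
      unfolding V by (rule generate_ring.incl) simp
    then show "W.scalars_plus_I \<subseteq> V <+>\<^bsub>B\<^esub> I"
      by (auto simp: set_add_def' B_simps W.scalars_plus_I_def I_eq)
  qed
  have middle: "a_rcosets\<^bsub>B\<lparr>carrier := V <+>\<^bsub>B\<^esub> I\<rparr>\<^esub> I =
      (\<lambda>b. W.I +>\<^bsub>W.weyl_mod\<^esub> b) ` W.scalars_plus_I"
    unfolding V_I unfolding I_eq
    by (auto simp: A_RCOSETS_def' a_r_coset_def' B_simps W.weyl_mod_simps)
  have bottom: "\<zero>\<^bsub>BI\<^esub> = W.I"
    by (simp add: BI_eq quotient_module_def)
  have ring_Vir: "ring (Virasoro_alg p q)"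
    unfolding Virasoro_alg_def by (rule ring_presented_algebra)
  show ?thesis
  proof
    show "simple_left_module B M \<and> \<not> left_module_iso B M BI \<longrightarrow>
        simple_left_module (Virasoro_alg p q) (restrict_scalars \<phi> M)"
      unfolding B_eq BI_eq
      using W.simple_restrict_scalars[OF ring_Vir \<phi>_hom] I_range \<phi>_image by blast
    show "composition_series (Virasoro_alg p q) (restrict_scalars \<phi> BI)
        [carrier BI, a_rcosets\<^bsub>B\<lparr>carrier := V <+>\<^bsub>B\<^esub> I\<rparr>\<^esub> I, {\<zero>\<^bsub>BI\<^esub>}]"
      unfolding middle bottom unfolding BI_eq
      by (rule W.composition_series_restrict_scalars[OF ring_Vir \<phi>_hom])
         (unfold \<phi>_image, fact scalars, fact derivations, fact range_K)
  qed
qed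

end
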